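(* Let $1<p<\infty$. There is $\gamma_0=\gamma_0(p)>0$ such that for every $0<\gamma<\gamma_0$ the following holds: the canonical basis $(e^*_j)_{j=1}^\infty$ of the dual space $Ti^*(p,\gamma)$ is subsymmetric but not symmetric, and every subsymmetric basic sequence in $Ti^*(p,\gamma)$ is equivalent to $(e^*_j)_{j=1}^\infty$.
   Context: For $1<p<\infty$, $\frac1p+\frac1q=1$ and $0<\gamma<1$, the Tirilman space $Ti(p,\gamma)$ is the completion of $c_{00}$ (finitely supported real sequences) under the norm defined implicitly by $$\|a\|=\max\Big\{\|a\|_\infty,\ \gamma\sup\frac{\sum_{j=1}^n\|E_ja\|}{n^{1/q}}\Big\},$$ where the supremum is over all $n\in\mathbb{N}$ and all finite sets of consecutive natural numbers $E_1<\dots<E_n$, and $E_ja$ denotes the restriction of $a$ to $E_j$. $(e^*_j)$ is the sequence of biorthogonal functionals to the unit vector basis $(e_j)$, a basis of the dual $Ti^*(p,\gamma)$. Two basic sequences $(x_j),(y_j)$ are equivalent if $\sum a_jx_j$ converges iff $\sum a_jy_j$ converges. A basic sequence is symmetric if it is equivalent to all its permutations, and subsymmetric if it is unconditional and equivalent to all of its subsequences. *)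

theory Defs
  imports Complex_Main
begin

definition c00 :: "(nat \<Rightarrow> real) set" where
  "c00 = {a. finite {i. a i \<noteq> 0}}"

definition supnorm :: "(nat \<Rightarrow> real) \<Rightarrow> real" where
  "supnorm a = (SUP i. \<bar>a i\<bar>)"

definition restr :: "nat set \<Rightarrow> (nat \<Rightarrow> real) \<Rightarrow> (nat \<Rightarrow> real)" where
  "restr E a = (\<lambda>i. if i \<in> E then a i else 0)"

definition intervals :: "(nat \<times> (nat \<Rightarrow> nat set)) set" where
  "intervals = {(n, E). n \<ge> 1 \<and> (\<exists>l r. (\<forall>j<n. l j \<le> r j \<and> E j = {l j..r j})
                                     \<and> (\<forall>j. Suc j < n \<longrightarrow> r j < l (Suc j)))}"

definition conj_exp :: "real \<Rightarrow> real" where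
  "conj_exp p = p / (p - 1)"

text \<open>Standard iterative construction of the implicitly defined Tirilman norm:
  norm_0 = sup norm, norm_(k+1) a = max(sup norm, gamma * sup sum norm_k(E_j a) / n^(1/q)),
  and the Tirilman norm is the (increasing) limit = supremum over k.\<close>
fun ti_iter :: "real \<Rightarrow> real \<Rightarrow> nat \<Rightarrow> (nat \<Rightarrow> real) \<Rightarrow> real" where
  "ti_iter p \<gamma> 0 a = supnorm a"
| "ti_iter p \<gamma> (Suc k) a =
     max (supnorm a)
       (\<gamma> * (SUP nE \<in> intervals.
          (\<Sum>j<fst nE. ti_iter p \<gamma> k (restr (snd nE j) a)) / real (fst nE) powr (1 / conj_exp p)))"

definition ti_norm :: "real \<Rightarrow> real \<Rightarrow> (nat \<Rightarrow> real) \<Rightarrow> real" where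
  "ti_norm p \<gamma> a = (SUP k. ti_iter p \<gamma> k a)"

text \<open>The dual Ti*(p,gamma): a functional on Ti(p,gamma) is determined by its values b j = f(e_j);
  its norm is the supremum of the pairing over the unit ball of c00 (which is dense).\<close>
definition pairing :: "(nat \<Rightarrow> real) \<Rightarrow> (nat \<Rightarrow> real) \<Rightarrow> real" where
  "pairing b a = (\<Sum>i\<in>{i. a i \<noteq> 0}. b i * a i)"

definition dual_ball_vals :: "real \<Rightarrow> real \<Rightarrow> (nat \<Rightarrow> real) \<Rightarrow> real set" where
  "dual_ball_vals p \<gamma> b = {pairing b a | a. a \<in> c00 \<and> ti_norm p \<gamma> a \<le> 1}"

definition TiDual :: "real \<Rightarrow> real \<Rightarrow> (nat \<Rightarrow> real) set" where
  "TiDual p \<gamma> = {b. bdd_above (dual_ball_vals p \<gamma> b)}"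

definition dual_norm :: "real \<Rightarrow> real \<Rightarrow> (nat \<Rightarrow> real) \<Rightarrow> real" where
  "dual_norm p \<gamma> b = Sup (dual_ball_vals p \<gamma> b)"

definition estar :: "nat \<Rightarrow> (nat \<Rightarrow> real)" where
  "estar j = (\<lambda>i. if i = j then 1 else 0)"

definition psum :: "(nat \<Rightarrow> (nat \<Rightarrow> real)) \<Rightarrow> (nat \<Rightarrow> real) \<Rightarrow> nat \<Rightarrow> (nat \<Rightarrow> real)" where
  "psum x a n = (\<lambda>i. \<Sum>j<n. a j * x j i)"

definition series_to :: "real \<Rightarrow> real \<Rightarrow> (nat \<Rightarrow> (nat \<Rightarrow> real)) \<Rightarrow> (nat \<Rightarrow> real) \<Rightarrow> (nat \<Rightarrow> real) \<Rightarrow> bool" where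
  "series_to p \<gamma> x a y \<longleftrightarrow> y \<in> TiDual p \<gamma> \<and>
     (\<lambda>n. dual_norm p \<gamma> (\<lambda>i. y i - psum x a n i)) \<longlonglongrightarrow> 0"

definition series_conv :: "real \<Rightarrow> real \<Rightarrow> (nat \<Rightarrow> (nat \<Rightarrow> real)) \<Rightarrow> (nat \<Rightarrow> real) \<Rightarrow> bool" where
  "series_conv p \<gamma> x a \<longleftrightarrow> (\<exists>y. series_to p \<gamma> x a y)"

definition cspan :: "real \<Rightarrow> real \<Rightarrow> (nat \<Rightarrow> (nat \<Rightarrow> real)) \<Rightarrow> (nat \<Rightarrow> real) set" where
  "cspan p \<gamma> x = {y \<in> TiDual p \<gamma>. \<forall>\<epsilon>>0. \<exists>n c. dual_norm p \<gamma> (\<lambda>i. y i - psum x c n i) < \<epsilon>}"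

definition basic :: "real \<Rightarrow> real \<Rightarrow> (nat \<Rightarrow> (nat \<Rightarrow> real)) \<Rightarrow> bool" where
  "basic p \<gamma> x \<longleftrightarrow> (\<forall>j. x j \<in> TiDual p \<gamma>) \<and>
     (\<forall>y \<in> cspan p \<gamma> x. \<exists>!a. series_to p \<gamma> x a y)"

definition equivalent :: "real \<Rightarrow> real \<Rightarrow> (nat \<Rightarrow> (nat \<Rightarrow> real)) \<Rightarrow> (nat \<Rightarrow> (nat \<Rightarrow> real)) \<Rightarrow> bool" where
  "equivalent p \<gamma> x y \<longleftrightarrow> (\<forall>a. series_conv p \<gamma> x a \<longleftrightarrow> series_conv p \<gamma> y a)"

definition unconditional :: "real \<Rightarrow> real \<Rightarrow> (nat \<Rightarrow> (nat \<Rightarrow> real)) \<Rightarrow> bool" where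
  "unconditional p \<gamma> x \<longleftrightarrow> basic p \<gamma> x \<and>
     (\<forall>a \<sigma>. bij \<sigma> \<longrightarrow> series_conv p \<gamma> x a \<longrightarrow> series_conv p \<gamma> (x \<circ> \<sigma>) (a \<circ> \<sigma>))"

definition symmetric_seq :: "real \<Rightarrow> real \<Rightarrow> (nat \<Rightarrow> (nat \<Rightarrow> real)) \<Rightarrow> bool" where
  "symmetric_seq p \<gamma> x \<longleftrightarrow> basic p \<gamma> x \<and>
     (\<forall>\<sigma>. bij \<sigma> \<longrightarrow> equivalent p \<gamma> x (x \<circ> \<sigma>))"

definition subsymmetric :: "real \<Rightarrow> real \<Rightarrow> (nat \<Rightarrow> (nat \<Rightarrow> real)) \<Rightarrow> bool" where
  "subsymmetric p \<gamma> x \<longleftrightarrow> unconditional p \<gamma> x \<and>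
     (\<forall>f. strict_mono f \<longrightarrow> equivalent p \<gamma> x (x \<circ> f))"

end

theory Submission
  imports Defs "HOL-Analysis.Analysis" "HOL-Library.Diagonal_Subsequence"
begin

text \<open>Blocks in the Tirilman space satisfy an upper \<open>p\<close>-estimate with constant
  \<open>2 powr (1/q) / (1 - \<gamma>)\<close>, and normalised blocks dominate the unit vector basis. For \<open>\<gamma> < 1/3\<close> no
  block sequence satisfies a lower \<open>p\<close>-estimate: a sum of many flat layers of very different lengths
  cannot be split efficiently by one family of intervals, so its norm is at most about \<open>\<gamma>\<close> times the
  upper estimate, and this can be iterated. Dually, blocks in the dual space satisfy a lower
  \<open>q\<close>-estimate, are dominated by \<open>(e*_j)\<close>, and never satisfy an upper \<open>q\<close>-estimate; on the other hand,
  \<open>m\<close> blocks with small coordinates satisfy an upper \<open>q\<close>-estimate, since they can be cut into pieces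
  of nearly equal norm.

  Asymmetry: repeating each coordinate of a vector \<open>b\<close> many times has dual norm comparable to the
  \<open>q\<close>-norm of \<open>b\<close>, whereas the same coordinates arranged as repeated copies of \<open>b\<close> have at least the
  dual norm of \<open>b\<close> up to a constant, which can be arbitrarily large.

  Uniqueness: a subsymmetric basic sequence tends to zero coordinatewise, so it is equivalent to
  blocks. If their coordinates do not tend to zero uniformly, they dominate \<open>(e*_j)\<close>, hence are
  equivalent to it; otherwise a sparse subsequence has an upper \<open>q\<close>-estimate, which is impossible.\<close>


text \<open>Equivalence only compares which series converge, so no uniform constants come with the
  hypotheses. Every contradiction is therefore glued together: finite vectors that are bounded in
  one arrangement and have norm at least \<open>2 ^ k\<close> in another are put on consecutive
  intervals with weights \<open>(1/2) ^ k\<close>, which gives one series converging in the first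
  arrangement only. This is why finite constructions are wanted arbitrarily far out, and bounds for
  all subsets of an interval.

  Norm computations compare two partitions, the blocks and an interval family. A block meeting an
  interval lies inside it or straddles it, and \<open>n\<close> intervals have at most
  \<open>2 * n\<close> straddling incidences. Whole blocks reproduce an estimate with an extra
  factor \<gamma>, straddling blocks cost \<open>2 powr (1/q)\<close>; the constant of the upper
  estimate is the fixed point of this recursion. In the layered combinations the straddling cost
  becomes negligible and the factor \<open>\<gamma> * CU\<close> is what remains; it is below 1 when
  \<gamma> is small.

  Tails of functionals vanish because the lower \<open>q\<close>-estimate forbids infinitely many
  disjoint pieces of norm bounded below.\<close>

lemma Holder_sum:
  fixes x y :: "'i \<Rightarrow> real"
  assumes fin: "finite I" and x: "\<And>i. i \<in> I \<Longrightarrow> x i \<ge> 0" and y: "\<And>i. i \<in> I \<Longrightarrow> y i \<ge> 0"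
    and p: "1 < p" and pq: "1/p + 1/q = 1" and q: "1 < q"
  shows "(\<Sum>i\<in>I. x i * y i) \<le> (\<Sum>i\<in>I. x i powr p) powr (1/p) * (\<Sum>i\<in>I. y i powr q) powr (1/q)"
proof -
  define X where "X = (\<Sum>i\<in>I. x i powr p)"
  define Y where "Y = (\<Sum>i\<in>I. y i powr q)"
  have X0: "X \<ge> 0" and Y0: "Y \<ge> 0" unfolding X_def Y_def by (auto intro: sum_nonneg)
  show ?thesis
  proof (cases "X = 0 \<or> Y = 0")
    case True
    have "x i * y i = 0" if "i \<in> I" for i
    proof -
      have "X = 0 \<Longrightarrow> x i powr p = 0" unfolding X_def using that fin
        by (subst (asm) sum_nonneg_eq_0_iff) auto
      moreover have "Y = 0 \<Longrightarrow> y i powr q = 0" unfolding Y_def using that fin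
        by (subst (asm) sum_nonneg_eq_0_iff) auto
      ultimately show ?thesis using True by auto
    qed
    then have "(\<Sum>i\<in>I. x i * y i) = 0" by (intro sum.neutral) blast
    then show ?thesis using True unfolding X_def Y_def by auto
  next
    case False
    then have X: "X > 0" and Y: "Y > 0" using X0 Y0 by auto
    define \<xi> where "\<xi> = X powr (1/p)"
    define \<eta> where "\<eta> = Y powr (1/q)"
    have pos: "\<xi> > 0" "\<eta> > 0" using X Y by (auto simp: \<xi>_def \<eta>_def)
    have \<xi>p: "\<xi> powr p = X" and \<eta>q: "\<eta> powr q = Y" using X Y p q by (auto simp: \<xi>_def \<eta>_def powr_powr)
    have "(\<Sum>i\<in>I. (x i / \<xi>) * (y i / \<eta>)) \<le> (\<Sum>i\<in>I. (x i / \<xi>) powr p / p + (y i / \<eta>) powr q / q)"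
      by (intro sum_mono Youngs_inequality) (use p q pq x y pos in auto)
    also have "\<dots> = (\<Sum>i\<in>I. x i powr p) / (X * p) + (\<Sum>i\<in>I. y i powr q) / (Y * q)"
      using x y pos by (simp add: sum.distrib powr_divide \<xi>p \<eta>q sum_divide_distrib)
    also have "\<dots> = 1/p + 1/q" using X Y by (simp add: X_def[symmetric] Y_def[symmetric])
    finally have "(\<Sum>i\<in>I. x i * y i) / (\<xi> * \<eta>) \<le> 1" using pq by (simp add: sum_divide_distrib)
    then show ?thesis using pos unfolding \<xi>_def \<eta>_def X_def Y_def by (simp add: pos_divide_le_eq)
  qed
qed

subsection \<open>Finitely supported sequences\<close>

lemma c00_restr: "a \<in> c00 \<Longrightarrow> restr E a \<in> c00"
  unfolding c00_def restr_def by (auto elim: rev_finite_subset)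

lemma c00_le: "b \<in> c00 \<Longrightarrow> (\<And>i. \<bar>a i\<bar> \<le> \<bar>b i\<bar>) \<Longrightarrow> a \<in> c00"
  unfolding c00_def mem_Collect_eq by (erule rev_finite_subset) (metis (mono_tags, lifting) abs_0_eq abs_le_zero_iff mem_Collect_eq subsetI)

lemma c00_scale: "a \<in> c00 \<Longrightarrow> (\<lambda>i. c * a i) \<in> c00"
  unfolding c00_def mem_Collect_eq by (erule rev_finite_subset) auto

lemma c00_add: "a \<in> c00 \<Longrightarrow> b \<in> c00 \<Longrightarrow> (\<lambda>i. a i + b i) \<in> c00"
  unfolding c00_def mem_Collect_eq
  by (rule finite_subset[of _ "{i. a i \<noteq> 0} \<union> {i. b i \<noteq> 0}"]) auto

lemma c00_zero[simp]: "(\<lambda>i. 0) \<in> c00" by (simp add: c00_def)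

lemma c00_sum: "(\<And>j. j \<in> F \<Longrightarrow> y j \<in> c00) \<Longrightarrow> (\<lambda>i. \<Sum>j\<in>F. y j i) \<in> c00"
  by (induction F rule: infinite_finite_induct) (auto intro: c00_add)

lemma c00_subset: "finite S \<Longrightarrow> {i. a i \<noteq> 0} \<subseteq> S \<Longrightarrow> a \<in> c00"
  unfolding c00_def by (auto elim: finite_subset)

lemma restr_restr: "restr E (restr F a) = restr (E \<inter> F) a"
  by (auto simp: restr_def)

lemma restr_apply: "restr E a i = (if i \<in> E then a i else 0)" by (simp add: restr_def)

lemma supnorm_ge: assumes "a \<in> c00" shows "\<bar>a i\<bar> \<le> supnorm a"
proof -
  have "range (\<lambda>i. \<bar>a i\<bar>) \<subseteq> insert 0 ((\<lambda>i. \<bar>a i\<bar>) ` {i. a i \<noteq> 0})" by auto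
  then have "finite (range (\<lambda>i. \<bar>a i\<bar>))"
    by (rule finite_subset) (use assms in \<open>simp add: c00_def\<close>)
  then show ?thesis unfolding supnorm_def by (intro cSUP_upper) auto
qed

lemma supnorm_le: "(\<And>i. \<bar>a i\<bar> \<le> B) \<Longrightarrow> supnorm a \<le> B"
  unfolding supnorm_def by (intro cSUP_least) auto

text \<open>A crude majorant of all iterates, which makes the suprema in the recursion suprema of
  bounded sets. It also measures how fast the layers in \<open>layered_combination\<close> have to
  grow.\<close>

definition l1 :: "(nat \<Rightarrow> real) \<Rightarrow> real" where "l1 a = (\<Sum>i\<in>{i. a i \<noteq> 0}. \<bar>a i\<bar>)"

lemma l1_eq: "finite S \<Longrightarrow> {i. a i \<noteq> 0} \<subseteq> S \<Longrightarrow> l1 a = (\<Sum>i\<in>S. \<bar>a i\<bar>)"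
  unfolding l1_def by (rule sum.mono_neutral_left) auto

lemma l1_nonneg: "l1 a \<ge> 0" unfolding l1_def by (simp add: sum_nonneg)

lemma l1_ge: assumes "a \<in> c00" shows "\<bar>a i\<bar> \<le> l1 a"
proof (cases "a i = 0")
  case False
  then show ?thesis unfolding l1_def using assms
    by (intro member_le_sum) (auto simp: c00_def)
qed (simp add: l1_nonneg)

lemma l1_disjoint:
  assumes "a \<in> c00" "finite J" "disjoint_family_on E J"
  shows "(\<Sum>j\<in>J. l1 (restr (E j) a)) \<le> l1 a"
proof -
  let ?S = "{i. a i \<noteq> 0}"
  have fin: "finite ?S" using assms by (simp add: c00_def)
  have "l1 (restr (E j) a) = (\<Sum>i\<in>?S. if i \<in> E j then \<bar>a i\<bar> else 0)" for j
    using fin by (subst l1_eq[of ?S]) (auto simp: restr_def intro!: sum.cong)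
  then have "(\<Sum>j\<in>J. l1 (restr (E j) a)) = (\<Sum>i\<in>?S. \<Sum>j\<in>J. if i \<in> E j then \<bar>a i\<bar> else 0)"
    by (simp add: sum.swap[of _ J])
  also have "\<dots> \<le> (\<Sum>i\<in>?S. \<bar>a i\<bar>)"
  proof (rule sum_mono)
    fix i
    have "(\<Sum>j\<in>J. if i \<in> E j then \<bar>a i\<bar> else 0) = (\<Sum>j\<in>{j\<in>J. i \<in> E j}. \<bar>a i\<bar>)"
      using assms(2) by (rule sum.inter_filter[symmetric])
    also have "\<dots> = real (card {j\<in>J. i \<in> E j}) * \<bar>a i\<bar>" by simp
    also have "\<dots> \<le> 1 * \<bar>a i\<bar>"
    proof (rule mult_right_mono)
      have "card {j\<in>J. i \<in> E j} \<le> 1"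
        using assms(2,3) by (subst card_le_Suc0_iff_eq[simplified One_nat_def[symmetric]]) (auto simp: disjoint_family_on_def)
      then show "real (card {j\<in>J. i \<in> E j}) \<le> 1" by simp
    qed simp
    finally show "(\<Sum>j\<in>J. if i \<in> E j then \<bar>a i\<bar> else 0) \<le> \<bar>a i\<bar>" by simp
  qed
  finally show ?thesis by (simp add: l1_def)
qed

text \<open>Sending \<open>v\<close> to the least such index is the lower adjoint of
  \<open>h\<close>; it pulls cut points back along \<open>h\<close>.\<close>

lemma strict_mono_Least_iff:
  assumes "strict_mono (h::nat \<Rightarrow> nat)" shows "v \<le> h i \<longleftrightarrow> (LEAST i. v \<le> h i) \<le> i"
proof
  assume "(LEAST i. v \<le> h i) \<le> i"
  then have "h (LEAST i. v \<le> h i) \<le> h i" using strict_mono_mono[OF assms] by (simp add: monoD)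
  moreover have "v \<le> h (LEAST i. v \<le> h i)"
    using strict_mono_imp_increasing[OF assms, of v] by (rule LeastI)
  ultimately show "v \<le> h i" by linarith
qed (rule Least_le)

text \<open>If a suitable finite set exists beyond every \<open>L\<close>, such sets can be placed
  in consecutive intervals: the next cut lies just past the maximum of the set chosen at the current
  one. Inserting \<open>L\<close> keeps the cuts strictly increasing when that set is empty.\<close>

lemma consecutive_cuts:
  assumes fin: "\<And>k L. finite (G k L)" and sub: "\<And>k L. G k L \<subseteq> {L::nat..}"
  obtains l where "strict_mono l" "l 0 = L" "\<And>k. G k (l k) \<subseteq> {l k..<l (Suc k)}"
proof
  define l where "l = rec_nat L (\<lambda>k L. Suc (Max (insert L (G k L))))"
  have lS: "l (Suc k) = Suc (Max (insert (l k) (G k (l k))))" for k by (simp add: l_def)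
  show "l 0 = L" by (simp add: l_def)
  have "l k < l (Suc k)" for k unfolding lS using fin by (simp add: less_Suc_eq_le)
  then show "strict_mono l" by (simp add: strict_mono_Suc_iff)
  show "G k (l k) \<subseteq> {l k..<l (Suc k)}" for k
  proof
    fix j assume j: "j \<in> G k (l k)"
    then have "j \<le> Max (insert (l k) (G k (l k)))" using fin by (intro Max_ge) auto
    then show "j \<in> {l k..<l (Suc k)}" using sub[of k "l k"] j by (auto simp: lS)
  qed
qed

text \<open>Consecutive pieces of a vector are encoded by a monotone sequence of cut points;
  pieces may be empty, which makes the encoding stable under pulling back along injections.\<close>

abbreviation cut :: "(nat \<Rightarrow> nat) \<Rightarrow> nat \<Rightarrow> (nat \<Rightarrow> real) \<Rightarrow> nat \<Rightarrow> real" where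
  "cut t j a \<equiv> restr {t j..<t (Suc j)} a"

lemma mono_cut_unique:
  assumes "mono (t::nat \<Rightarrow> nat)" "i \<in> {t j..<t (Suc j)}" "i \<in> {t k..<t (Suc k)}"
  shows "j = k"
proof (rule ccontr)
  assume "j \<noteq> k"
  then consider "Suc j \<le> k" | "Suc k \<le> j" by linarith
  then show False
  proof cases
    case 1 then have "t (Suc j) \<le> t k" using assms(1) by (simp add: monoD)
    then show ?thesis using assms by auto
  next
    case 2 then have "t (Suc k) \<le> t j" using assms(1) by (simp add: monoD)
    then show ?thesis using assms by auto
  qed
qed

lemma disjoint_cut: "mono (t::nat\<Rightarrow>nat) \<Longrightarrow> disjoint_family_on (\<lambda>j. {t j..<t (Suc j)}) J"
  unfolding disjoint_family_on_def using mono_cut_unique[of t] by blast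

lemma cut_cover:
  assumes "mono (t::nat\<Rightarrow>nat)" "t 0 \<le> i" "i < t n"
  obtains j where "j < n" "i \<in> {t j..<t (Suc j)}"
proof -
  define k where "k = (LEAST k. i < t k)"
  have k: "i < t k" "k \<le> n" unfolding k_def using assms(3) by (auto intro: LeastI Least_le)
  have "k \<noteq> 0" using k assms(2) by (cases k) auto
  then obtain j where j: "k = Suc j" by (cases k) auto
  have "\<not> i < t j" using j not_less_Least[of j "\<lambda>k. i < t k"] unfolding k_def by auto
  then show thesis using that[of j] k j by auto
qed

lemma intervals_props:
  assumes "(n, E) \<in> intervals"
  obtains l r where "n \<ge> 1" "\<And>j. j < n \<Longrightarrow> l j \<le> r j" "\<And>j. j < n \<Longrightarrow> E j = {l j..r j}"
    "\<And>i j. i < j \<Longrightarrow> j < n \<Longrightarrow> r i < l j"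
proof -
  from assms obtain l r where lr: "n \<ge> 1" "\<forall>j<n. l j \<le> r j \<and> E j = {l j..r j}"
    "\<forall>j. Suc j < n \<longrightarrow> r j < l (Suc j)" unfolding intervals_def by auto
  have "r i < l j" if "i < j" "j < n" for i j using that
  proof (induction j)
    case (Suc j)
    show ?case
    proof (cases "i = j")
      case True then show ?thesis using lr Suc by auto
    next
      case False then have "r i < l j" "l j \<le> r j" "r j < l (Suc j)" using Suc lr by auto
      then show ?thesis by linarith
    qed
  qed simp
  then show thesis using that lr by metis
qed

lemma intervals_disjoint: "(n, E) \<in> intervals \<Longrightarrow> disjoint_family_on E {..<n}"
  by (elim intervals_props) (auto simp: disjoint_family_on_def, metis leD le_less_trans nat_neq_iff order_less_le_trans)

lemma intervals_nonempty: "intervals \<noteq> {}"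
proof -
  have "(1, \<lambda>_. {0..0}) \<in> intervals" unfolding intervals_def
    by (auto intro!: exI[of _ "\<lambda>_. 0"])
  then show ?thesis by blast
qed

subsection \<open>The Tirilman norm\<close>

lemma conj_exp_gt1: "1 < p \<Longrightarrow> 1 < conj_exp p" by (simp add: conj_exp_def)
lemma conj_exp_sum: "1 < p \<Longrightarrow> 1/p + 1/conj_exp p = 1" by (simp add: conj_exp_def field_simps)

locale tirilman =
  fixes p \<gamma> :: real
  assumes p1: "1 < p" and \<gamma>0: "0 < \<gamma>" and \<gamma>1: "\<gamma> < 1"
begin

abbreviation "q \<equiv> conj_exp p"
abbreviation "it \<equiv> ti_iter p \<gamma>"
abbreviation "N \<equiv> ti_norm p \<gamma>"
abbreviation "rt n \<equiv> real n powr (1 / q)"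

lemma q1: "1 < q" using conj_exp_gt1 p1 .
lemma pq: "1/p + 1/q = 1" using conj_exp_sum p1 .

lemma rt_ge1: "n \<ge> 1 \<Longrightarrow> rt n \<ge> 1" using q1 by (simp add: ge_one_powr_ge_zero)

lemma divide_rt_le: "n \<ge> 1 \<Longrightarrow> x \<le> B * rt n \<Longrightarrow> x / rt n \<le> B"
  using rt_ge1[of n] by (subst pos_divide_le_eq) linarith+

definition V :: "nat \<Rightarrow> (nat \<Rightarrow> real) \<Rightarrow> nat \<times> (nat \<Rightarrow> nat set) \<Rightarrow> real" where
  "V k a nE = (\<Sum>j<fst nE. it k (restr (snd nE j) a)) / rt (fst nE)"

lemma it_Suc: "it (Suc k) a = max (supnorm a) (\<gamma> * (SUP nE\<in>intervals. V k a nE))"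
  by (simp add: V_def)

declare ti_iter.simps(2)[simp del]

lemma V_le_l1:
  assumes a: "a \<in> c00" and k: "\<And>E. it k (restr E a) \<le> l1 (restr E a)" and nE: "nE \<in> intervals"
  shows "V k a nE \<le> l1 a"
proof -
  obtain n E where [simp]: "nE = (n, E)" by (cases nE)
  have n1: "n \<ge> 1" using nE by (auto simp: intervals_def)
  have "(\<Sum>j<n. it k (restr (E j) a)) \<le> (\<Sum>j<n. l1 (restr (E j) a))"
    using k by (intro sum_mono)
  also have "\<dots> \<le> l1 a" using a nE by (intro l1_disjoint intervals_disjoint) auto
  also have "\<dots> \<le> l1 a * rt n" using rt_ge1[OF n1] l1_nonneg[of a] by (simp add: mult_le_cancel_left1)
  finally show ?thesis using divide_rt_le[OF n1] by (simp add: V_def)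
qed

lemma it_bounds: "a \<in> c00 \<Longrightarrow> 0 \<le> it k a \<and> it k a \<le> l1 a"
proof (induction k arbitrary: a)
  case 0
  have "0 \<le> \<bar>a 0\<bar>" by simp
  also have "\<dots> \<le> supnorm a" using supnorm_ge 0 by blast
  finally show ?case using 0 l1_ge by (auto intro: supnorm_le)
next
  case (Suc k)
  have "V k a nE \<le> l1 a" if "nE \<in> intervals" for nE
    using Suc that by (intro V_le_l1) (auto simp: c00_restr)
  then have "(SUP nE\<in>intervals. V k a nE) \<le> l1 a"
    using intervals_nonempty by (intro cSUP_least) auto
  then have "\<gamma> * (SUP nE\<in>intervals. V k a nE) \<le> 1 * l1 a"
    using \<gamma>0 \<gamma>1 l1_nonneg[of a] by (intro order_trans[OF mult_left_mono mult_right_mono]) auto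
  moreover have "supnorm a \<le> l1 a" using Suc l1_ge by (auto intro: supnorm_le)
  moreover have "0 \<le> supnorm a" using supnorm_ge[OF Suc.prems, of 0] by linarith
  ultimately show ?case unfolding it_Suc by auto
qed

lemma V_bdd: "a \<in> c00 \<Longrightarrow> bdd_above (V k a ` intervals)"
  using it_bounds by (intro bdd_aboveI2[of _ _ "l1 a"] V_le_l1) (auto simp: c00_restr)

lemma it_nonneg: "a \<in> c00 \<Longrightarrow> 0 \<le> it k a" using it_bounds by blast

lemma it_Suc_ge: "a \<in> c00 \<Longrightarrow> nE \<in> intervals \<Longrightarrow> \<gamma> * V k a nE \<le> it (Suc k) a"
  unfolding it_Suc using \<gamma>0 by (auto intro!: max.coboundedI2 mult_left_mono cSUP_upper V_bdd)

lemma it_Suc_le: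
  assumes "\<And>i. \<bar>a i\<bar> \<le> B" "\<And>nE. nE \<in> intervals \<Longrightarrow> \<gamma> * V k a nE \<le> B"
  shows "it (Suc k) a \<le> B"
proof -
  have "V k a nE \<le> B / \<gamma>" if "nE \<in> intervals" for nE
    using assms(2)[OF that] \<gamma>0 by (simp add: pos_le_divide_eq mult.commute)
  then have "(SUP nE\<in>intervals. V k a nE) \<le> B / \<gamma>" using intervals_nonempty by (intro cSUP_least) auto
  then have "\<gamma> * (SUP nE\<in>intervals. V k a nE) \<le> B" using \<gamma>0 by (simp add: pos_le_divide_eq mult.commute)
  then show ?thesis unfolding it_Suc using assms(1) by (auto intro: supnorm_le)
qed

lemma it_abs_le: assumes "a \<in> c00" shows "\<bar>a i\<bar> \<le> it k a"
proof (cases k)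
  case 0 then show ?thesis using supnorm_ge assms by auto
next
  case (Suc m) then show ?thesis using supnorm_ge[OF assms, of i] unfolding Suc it_Suc by simp
qed

lemma it_mono:
  assumes "b \<in> c00" "\<And>i. \<bar>a i\<bar> \<le> \<bar>b i\<bar>" shows "it k a \<le> it k b"
  using assms
proof (induction k arbitrary: a b)
  case 0
  then show ?case by (auto intro!: supnorm_le order_trans[OF 0(2) supnorm_ge])
next
  case (Suc k)
  show ?case
  proof (rule it_Suc_le)
    fix i show "\<bar>a i\<bar> \<le> it (Suc k) b" using Suc.prems it_abs_le order_trans by blast
  next
    fix nE assume nE: "nE \<in> intervals"
    have "V k a nE \<le> V k b nE" unfolding V_def
      by (intro divide_right_mono sum_mono Suc.IH c00_restr Suc.prems)
         (use Suc.prems in \<open>auto simp: restr_def\<close>)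
    then have "\<gamma> * V k a nE \<le> \<gamma> * V k b nE" using \<gamma>0 by simp
    also have "\<dots> \<le> it (Suc k) b" using it_Suc_ge Suc.prems nE by blast
    finally show "\<gamma> * V k a nE \<le> it (Suc k) b" .
  qed
qed

lemma it_zero[simp]: "it k (\<lambda>i. 0) = 0"
  using it_bounds[of "\<lambda>i. 0" k] by (simp add: l1_def)

lemma it_cut_sum:
  assumes a: "a \<in> c00" and t: "mono t" and J: "finite J"
  shows "\<gamma> * (\<Sum>j\<in>J. it k (cut t j a)) \<le> rt (card J) * it (Suc k) a"
proof -
  define J' where "J' = {j\<in>J. t j < t (Suc j)}"
  have fJ': "finite J'" using J by (simp add: J'_def)
  have "it k (cut t j a) = 0" if "j \<in> J - J'" for j
  proof -
    have "cut t j a = (\<lambda>i. 0)" using that by (auto simp: J'_def restr_def)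
    then show ?thesis by simp
  qed
  then have eq: "(\<Sum>j\<in>J. it k (cut t j a)) = (\<Sum>j\<in>J'. it k (cut t j a))"
    using J by (intro sum.mono_neutral_right) (auto simp: J'_def)
  show ?thesis
  proof (cases "J' = {}")
    case True
    then show ?thesis using eq it_nonneg[OF a] by simp
  next
    case False
    define n where "n = card J'"
    have n1: "n \<ge> 1" using False fJ' by (simp add: n_def Suc_le_eq card_gt_0_iff)
    obtain e where e: "bij_betw e {..<n} J'" "strict_mono_on {..<n} e"
      using ex_bij_betw_strict_mono_card[OF fJ'] unfolding n_def by blast
    have eJ: "e j \<in> J'" if "j < n" for j using e(1) that by (auto simp: bij_betw_def)
    define E where "E = (\<lambda>j. {t (e j)..t (Suc (e j)) - 1})"
    have E: "E j = {t (e j)..<t (Suc (e j))}" if "j < n" for j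
      using eJ[OF that] unfolding E_def J'_def by auto
    have "(n, E) \<in> intervals" unfolding intervals_def mem_Collect_eq split
    proof (rule conjI[OF n1], rule exI[of _ "\<lambda>j. t (e j)"], rule exI[of _ "\<lambda>j. t (Suc (e j)) - 1"],
        intro conjI allI impI)
      fix j assume "j < n" then show "t (e j) \<le> t (Suc (e j)) - 1" using eJ[of j] by (auto simp: J'_def)
    next
      fix j assume j: "Suc j < n"
      then have "e j < e (Suc j)" using e(2) by (auto simp: strict_mono_on_def)
      then have "t (Suc (e j)) \<le> t (e (Suc j))" using t by (simp add: monoD)
      moreover have "t (e j) < t (Suc (e j))" using eJ[of j] j by (auto simp: J'_def)
      ultimately show "t (Suc (e j)) - 1 < t (e (Suc j))" by linarith
    qed (auto simp: n1 E_def)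
    then have "\<gamma> * V k a (n, E) \<le> it (Suc k) a" using a by (rule it_Suc_ge[rotated])
    moreover have "V k a (n, E) = (\<Sum>j\<in>J'. it k (cut t j a)) / rt n"
    proof -
      have "(\<Sum>j<n. it k (restr (E j) a)) = (\<Sum>j<n. it k (cut t (e j) a))"
        by (intro sum.cong refl) (simp add: E)
      also have "\<dots> = (\<Sum>j\<in>J'. it k (cut t j a))" using sum.reindex_bij_betw[OF e(1)] by simp
      finally show ?thesis by (simp add: V_def)
    qed
    ultimately have "\<gamma> * (\<Sum>j\<in>J'. it k (cut t j a)) / rt n \<le> it (Suc k) a" by simp
    then have "\<gamma> * (\<Sum>j\<in>J'. it k (cut t j a)) \<le> it (Suc k) a * rt n"
      using less_le_trans[OF zero_less_one rt_ge1[OF n1]] by (simp only: pos_divide_le_eq)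
    also have "\<dots> \<le> it (Suc k) a * rt (card J)"
      using it_nonneg[OF a] q1 J by (intro mult_left_mono powr_mono2) (auto simp: n_def J'_def card_mono)
    finally show ?thesis using eq by (simp add: mult.commute)
  qed
qed

text \<open>The converse passage from intervals to cut points: stretching each interval up to the
  start of the next one only increases the norms of the pieces. After the last interval the cut
  points are constant, so later pieces are empty.\<close>

lemma it_le_cut:
  assumes a: "a \<in> c00" and B: "\<And>i. \<bar>a i\<bar> \<le> B"
    and cuts: "\<And>n t. n \<ge> 1 \<Longrightarrow> mono t \<Longrightarrow> \<gamma> * (\<Sum>j<n. it k (cut t j a)) \<le> rt n * B"
  shows "it (Suc k) a \<le> B"
proof (rule it_Suc_le[OF B])
  fix nE assume nE: "nE \<in> intervals"
  obtain n E where [simp]: "nE = (n, E)" by (cases nE)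
  have "(n, E) \<in> intervals" using nE by simp
  then obtain l r where lr: "n \<ge> 1" "\<And>j. j < n \<Longrightarrow> l j \<le> r j" "\<And>j. j < n \<Longrightarrow> E j = {l j..r j}"
    "\<And>i j. i < j \<Longrightarrow> j < n \<Longrightarrow> r i < l j" by (elim intervals_props) blast
  define t where "t = (\<lambda>j. if j < n then l j else Suc (r (n - 1)))"
  have rt': "r j < t (Suc j)" if "j < n" for j
    using that lr(4)[of j "Suc j"] unfolding t_def by (cases "Suc j < n") (auto simp: not_less le_Suc_eq dest: less_antisym)
  have "t j \<le> t (Suc j)" for j
  proof (cases "j < n")
    case True then show ?thesis using rt'[OF True] lr(2)[OF True] by (simp add: t_def)
  qed (simp add: t_def)
  then have t: "mono t" by (simp add: mono_iff_le_Suc)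
  have "(\<Sum>j<n. it k (restr (E j) a)) \<le> (\<Sum>j<n. it k (cut t j a))"
  proof (intro sum_mono it_mono c00_restr a)
    fix j i assume "j \<in> {..<n}"
    then have "E j \<subseteq> {t j..<t (Suc j)}" using rt'[of j] lr(3)[of j] by (auto simp: t_def)
    then show "\<bar>restr (E j) a i\<bar> \<le> \<bar>cut t j a i\<bar>" by (auto simp: restr_def)
  qed
  then have "\<gamma> * (\<Sum>j<n. it k (restr (E j) a)) \<le> rt n * B"
    using cuts[OF lr(1) t] \<gamma>0 by (smt (verit) mult_left_mono)
  then show "\<gamma> * V k a nE \<le> B"
    using divide_rt_le[OF lr(1), of "\<gamma> * (\<Sum>j<n. it k (restr (E j) a))" B] by (simp add: V_def mult.commute)
qed

lemma it_incr: assumes "a \<in> c00" shows "it k a \<le> it (Suc k) a"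
  using assms
proof (induction k arbitrary: a)
  case 0 then show ?case using it_Suc[of 0 a] by simp
next
  case (Suc k)
  show ?case
  proof (rule it_le_cut[OF Suc.prems])
    fix i show "\<bar>a i\<bar> \<le> it (Suc (Suc k)) a" using it_abs_le Suc.prems by blast
  next
    fix n :: nat and t :: "nat \<Rightarrow> nat" assume "n \<ge> 1" "mono t"
    have "\<gamma> * (\<Sum>j<n. it k (cut t j a)) \<le> \<gamma> * (\<Sum>j<n. it (Suc k) (cut t j a))"
      using \<gamma>0 Suc by (intro mult_left_mono sum_mono) (auto intro: c00_restr)
    also have "\<dots> \<le> rt n * it (Suc (Suc k)) a" using it_cut_sum[OF Suc.prems \<open>mono t\<close>, of "{..<n}" "Suc k"] by simp
    finally show "\<gamma> * (\<Sum>j<n. it k (cut t j a)) \<le> rt n * it (Suc (Suc k)) a" .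
  qed
qed

lemma it_scale_le: assumes "a \<in> c00" shows "it k (\<lambda>i. c * a i) \<le> \<bar>c\<bar> * it k a"
  using assms
proof (induction k arbitrary: a)
  case 0 then show ?case by (auto intro!: supnorm_le mult_left_mono supnorm_ge simp: abs_mult)
next
  case (Suc k)
  show ?case
  proof (rule it_le_cut[OF c00_scale[OF Suc.prems]])
    fix i show "\<bar>c * a i\<bar> \<le> \<bar>c\<bar> * it (Suc k) a" using it_abs_le Suc.prems by (auto simp: abs_mult mult_left_mono)
  next
    fix n :: nat and t :: "nat \<Rightarrow> nat" assume "n \<ge> 1" "mono t"
    have eq: "cut t j (\<lambda>i. c * a i) = (\<lambda>i. c * cut t j a i)" for j by (auto simp: restr_def)
    have "\<gamma> * (\<Sum>j<n. it k (cut t j (\<lambda>i. c * a i))) \<le> \<gamma> * (\<Sum>j<n. \<bar>c\<bar> * it k (cut t j a))"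
      unfolding eq using \<gamma>0 Suc by (intro mult_left_mono sum_mono) (auto intro: c00_restr)
    also have "\<dots> = \<bar>c\<bar> * (\<gamma> * (\<Sum>j<n. it k (cut t j a)))" by (simp add: sum_distrib_left mult_ac)
    also have "\<dots> \<le> \<bar>c\<bar> * (rt n * it (Suc k) a)" using it_cut_sum[OF Suc.prems \<open>mono t\<close>, of "{..<n}" k] by (simp add: mult_left_mono)
    finally show "\<gamma> * (\<Sum>j<n. it k (cut t j (\<lambda>i. c * a i))) \<le> rt n * (\<bar>c\<bar> * it (Suc k) a)" by (simp add: mult_ac)
  qed
qed

lemma it_triangle: assumes "a \<in> c00" "b \<in> c00" shows "it k (\<lambda>i. a i + b i) \<le> it k a + it k b"
  using assms
proof (induction k arbitrary: a b)
  case 0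
  show ?case unfolding ti_iter.simps(1)
  proof (rule supnorm_le)
    fix i show "\<bar>a i + b i\<bar> \<le> supnorm a + supnorm b" using supnorm_ge[OF 0(1), of i] supnorm_ge[OF 0(2), of i] by linarith
  qed
next
  case (Suc k)
  show ?case
  proof (rule it_le_cut[OF c00_add[OF Suc.prems]])
    fix i show "\<bar>a i + b i\<bar> \<le> it (Suc k) a + it (Suc k) b"
      using it_abs_le[OF Suc.prems(1), of i "Suc k"] it_abs_le[OF Suc.prems(2), of i "Suc k"] by linarith
  next
    fix n :: nat and t :: "nat \<Rightarrow> nat" assume "n \<ge> 1" "mono t"
    have eq: "cut t j (\<lambda>i. a i + b i) = (\<lambda>i. cut t j a i + cut t j b i)" for j by (auto simp: restr_def)
    have "\<gamma> * (\<Sum>j<n. it k (cut t j (\<lambda>i. a i + b i))) \<le> \<gamma> * (\<Sum>j<n. it k (cut t j a) + it k (cut t j b))"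
      unfolding eq using \<gamma>0 Suc by (intro mult_left_mono sum_mono) (auto intro: c00_restr)
    also have "\<dots> = \<gamma> * (\<Sum>j<n. it k (cut t j a)) + \<gamma> * (\<Sum>j<n. it k (cut t j b))" by (simp add: sum.distrib distrib_left)
    also have "\<dots> \<le> rt n * it (Suc k) a + rt n * it (Suc k) b"
      using it_cut_sum[OF Suc.prems(1) \<open>mono t\<close>, of "{..<n}" k] it_cut_sum[OF Suc.prems(2) \<open>mono t\<close>, of "{..<n}" k] by simp
    finally show "\<gamma> * (\<Sum>j<n. it k (cut t j (\<lambda>i. a i + b i))) \<le> rt n * (it (Suc k) a + it (Suc k) b)"
      by (simp add: distrib_left)
  qed
qed

lemma it_bdd: "a \<in> c00 \<Longrightarrow> bdd_above (range (\<lambda>k. it k a))"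
  using it_bounds by (intro bdd_aboveI2) blast

lemma it_le_N: "a \<in> c00 \<Longrightarrow> it k a \<le> N a"
  unfolding ti_norm_def by (intro cSUP_upper it_bdd) auto

lemma N_le: "(\<And>k. it k a \<le> B) \<Longrightarrow> N a \<le> B"
  unfolding ti_norm_def by (intro cSUP_least) auto

lemma N_tendsto: "a \<in> c00 \<Longrightarrow> (\<lambda>k. it k a) \<longlonglongrightarrow> N a"
  unfolding ti_norm_def by (intro LIMSEQ_incseq_SUP it_bdd) (auto simp: incseq_Suc_iff it_incr)

lemma N_nonneg: "a \<in> c00 \<Longrightarrow> 0 \<le> N a" using it_nonneg it_le_N order_trans by blast

lemma N_abs_le: "a \<in> c00 \<Longrightarrow> \<bar>a i\<bar> \<le> N a" using it_abs_le it_le_N order_trans by blast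

lemma N_le_l1: "a \<in> c00 \<Longrightarrow> N a \<le> l1 a" using it_bounds by (blast intro: N_le)

lemma N_mono: "b \<in> c00 \<Longrightarrow> (\<And>i. \<bar>a i\<bar> \<le> \<bar>b i\<bar>) \<Longrightarrow> N a \<le> N b"
  by (meson N_le it_le_N it_mono order_trans)

lemma N_restr_le: "a \<in> c00 \<Longrightarrow> N (restr E a) \<le> N a"
  by (rule N_mono) (auto simp: restr_def)

lemma N_scale: assumes "a \<in> c00" shows "N (\<lambda>i. c * a i) = \<bar>c\<bar> * N a"
proof -
  have le: "N (\<lambda>i. c * a i) \<le> \<bar>c\<bar> * N a" if "a \<in> c00" for a c
  proof (rule N_le)
    fix k
    have "it k (\<lambda>i. c * a i) \<le> \<bar>c\<bar> * it k a" using that by (rule it_scale_le)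
    also have "\<dots> \<le> \<bar>c\<bar> * N a" using it_le_N[OF that] by (intro mult_left_mono) auto
    finally show "it k (\<lambda>i. c * a i) \<le> \<bar>c\<bar> * N a" .
  qed
  show ?thesis
  proof (cases "c = 0")
    case True
    then show ?thesis using N_le_l1[of "\<lambda>i. 0"] N_nonneg[of "\<lambda>i. 0"] by (simp add: l1_def)
  next
    case False
    have "N a = N (\<lambda>i. (1/c) * (c * a i))" using False by simp
    also have "\<dots> \<le> \<bar>1/c\<bar> * N (\<lambda>i. c * a i)" by (rule le[OF c00_scale[OF assms]])
    finally have "\<bar>c\<bar> * N a \<le> N (\<lambda>i. c * a i)" using False by (simp add: field_simps)
    then show ?thesis using le[OF assms] by (simp add: antisym)
  qed
qed

lemma N_zero[simp]: "N (\<lambda>i. 0) = 0" using N_scale[of "\<lambda>i. 0" 0] by simp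

lemma N_triangle: "a \<in> c00 \<Longrightarrow> b \<in> c00 \<Longrightarrow> N (\<lambda>i. a i + b i) \<le> N a + N b"
  by (rule N_le, rule order_trans[OF it_triangle]) (auto intro: add_mono it_le_N)

lemma N_sum: "(\<And>j. j \<in> F \<Longrightarrow> y j \<in> c00) \<Longrightarrow> N (\<lambda>i. \<Sum>j\<in>F. y j i) \<le> (\<Sum>j\<in>F. N (y j))"
proof (induction F rule: infinite_finite_induct)
  case (insert x F)
  then have "N (\<lambda>i. y x i + (\<Sum>j\<in>F. y j i)) \<le> N (y x) + N (\<lambda>i. \<Sum>j\<in>F. y j i)"
    by (intro N_triangle c00_sum) auto
  then show ?case using insert by auto
qed auto

text \<open>Together with \<open>N_le_cut\<close> this is the implicit norm equation. It is the
  limit of \<open>it_cut_sum\<close> as \<open>k\<close> grows, where the shift from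
  \<open>k\<close> to \<open>Suc k\<close> disappears.\<close>

lemma N_cut_sum:
  assumes a: "a \<in> c00" and t: "mono t" and J: "finite J"
  shows "\<gamma> * (\<Sum>j\<in>J. N (cut t j a)) \<le> rt (card J) * N a"
proof (rule LIMSEQ_le_const2)
  show "(\<lambda>k. \<gamma> * (\<Sum>j\<in>J. it k (cut t j a))) \<longlonglongrightarrow> \<gamma> * (\<Sum>j\<in>J. N (cut t j a))"
    by (intro tendsto_intros N_tendsto c00_restr a)
  have "\<gamma> * (\<Sum>j\<in>J. it k (cut t j a)) \<le> rt (card J) * N a" for k
    using it_cut_sum[OF assms, of k] it_le_N[OF a, of "Suc k"]
    by (smt (verit, ccfv_SIG) mult_left_mono powr_ge_zero)
  then show "\<exists>M. \<forall>k\<ge>M. \<gamma> * (\<Sum>j\<in>J. it k (cut t j a)) \<le> rt (card J) * N a" by blast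
qed

lemma it_Suc_le_cut:
  assumes a: "a \<in> c00" and B: "\<And>i. \<bar>a i\<bar> \<le> B"
    and cuts: "\<And>n t. n \<ge> 1 \<Longrightarrow> mono t \<Longrightarrow> \<gamma> * (\<Sum>j<n. N (cut t j a)) \<le> rt n * B"
  shows "it k a \<le> B"
proof (cases k)
  case 0 then show ?thesis using B by (auto intro: supnorm_le)
next
  case (Suc m)
  have "it (Suc m) a \<le> B"
  proof (rule it_le_cut[OF a B])
    fix n :: nat and t :: "nat \<Rightarrow> nat" assume *: "n \<ge> 1" "mono t"
    have "\<gamma> * (\<Sum>j<n. it m (cut t j a)) \<le> \<gamma> * (\<Sum>j<n. N (cut t j a))"
      using \<gamma>0 by (intro mult_left_mono sum_mono it_le_N c00_restr a) auto
    then show "\<gamma> * (\<Sum>j<n. it m (cut t j a)) \<le> rt n * B" using cuts[OF *] by linarith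
  qed
  then show ?thesis using Suc by simp
qed

lemma N_le_cut:
  assumes "a \<in> c00" and "\<And>i. \<bar>a i\<bar> \<le> B"
    and "\<And>n t. n \<ge> 1 \<Longrightarrow> mono t \<Longrightarrow> \<gamma> * (\<Sum>j<n. N (cut t j a)) \<le> rt n * B"
  shows "N a \<le> B"
  using assms by (intro N_le it_Suc_le_cut)

end

subsection \<open>Blocks and the upper estimate\<close>

definition lincomb :: "(nat \<Rightarrow> nat \<Rightarrow> real) \<Rightarrow> (nat \<Rightarrow> real) \<Rightarrow> nat set \<Rightarrow> nat \<Rightarrow> real" where
  "lincomb y c F = (\<lambda>i. \<Sum>j\<in>F. c j * y j i)"

text \<open>The supports are recorded by cut points, so that \<open>cut u j\<close> recovers the
  \<open>j\<close>-th term of a combination. As \<open>u\<close> is only monotone, some ranges may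
  be empty.\<close>

definition blocks :: "(nat \<Rightarrow> nat) \<Rightarrow> (nat \<Rightarrow> nat \<Rightarrow> real) \<Rightarrow> bool" where
  "blocks u y \<longleftrightarrow> mono u \<and> (\<forall>j i. y j i \<noteq> 0 \<longrightarrow> u j \<le> i \<and> i < u (Suc j))"

lemma blocks_c00: "blocks u y \<Longrightarrow> y j \<in> c00"
  by (rule c00_subset[of "{u j..<u (Suc j)}"]) (auto simp: blocks_def)

lemma blocks_mono: "blocks u y \<Longrightarrow> mono u"
  by (simp add: blocks_def)

lemma c00_lincomb: "(\<And>j. j \<in> F \<Longrightarrow> y j \<in> c00) \<Longrightarrow> lincomb y c F \<in> c00"
  unfolding lincomb_def by (intro c00_sum c00_scale)

lemma blocks_lincomb_apply:
  assumes "blocks u y" "finite F" "u j \<le> i" "i < u (Suc j)"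
  shows "lincomb y c F i = (if j \<in> F then c j * y j i else 0)"
proof -
  have "y k i = 0" if "k \<noteq> j" for k
    using mono_cut_unique[OF blocks_mono[OF assms(1)], of i j k] assms that unfolding blocks_def by auto
  then have "lincomb y c F i = (\<Sum>k\<in>F. if k = j then c j * y j i else 0)"
    unfolding lincomb_def by (intro sum.cong) auto
  then show ?thesis using assms(2) by simp
qed

lemma blocks_cut_lincomb:
  assumes "blocks u y" "finite F"
  shows "cut u j (lincomb y c F) = (\<lambda>i. (if j \<in> F then c j else 0) * y j i)"
proof
  fix i
  show "cut u j (lincomb y c F) i = (if j \<in> F then c j else 0) * y j i"
    using blocks_lincomb_apply[OF assms, of j i c] assms(1)
    by (auto simp: restr_def blocks_def)
qed

lemma blocks_lincomb_support:
  assumes "blocks u y" "lincomb y c F i \<noteq> 0" "F \<subseteq> {l..<m}"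
  shows "u l \<le> i \<and> i < u m"
proof -
  obtain j where j: "j \<in> F" "y j i \<noteq> 0"
    using assms(2) sum.not_neutral_contains_not_neutral[of "\<lambda>j. c j * y j i" F] unfolding lincomb_def by auto
  then have "u j \<le> i" "i < u (Suc j)" using assms(1) by (auto simp: blocks_def)
  moreover have "u l \<le> u j" "u (Suc j) \<le> u m"
    using j assms(3) blocks_mono[OF assms(1)] by (auto intro!: monoD[of u])
  ultimately show ?thesis by linarith
qed

lemma sum_cuts:
  fixes g :: "nat \<Rightarrow> real"
  assumes "mono (s::nat\<Rightarrow>nat)"
  shows "(\<Sum>j\<in>{s 0..<s m}. g j) = (\<Sum>i<m. \<Sum>j\<in>{s i..<s (Suc i)}. g j)"
proof (induction m)
  case (Suc m)
  have "(\<Sum>j\<in>{s 0..<s (Suc m)}. g j) = (\<Sum>j\<in>{s 0..<s m}. g j) + (\<Sum>j\<in>{s m..<s (Suc m)}. g j)"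
    using assms by (subst sum.atLeastLessThan_concat) (auto simp: monoD)
  then show ?case using Suc by simp
qed simp

text \<open>An empty range would be contained in every piece; excluding empty ranges makes the cells
  of different \<open>j\<close> disjoint.\<close>

definition cells :: "(nat \<Rightarrow> nat) \<Rightarrow> (nat \<Rightarrow> nat) \<Rightarrow> nat \<Rightarrow> nat \<Rightarrow> nat set" where
  "cells u t m j = {i. i < m \<and> u i < u (Suc i) \<and> {u i..<u (Suc i)} \<subseteq> {t j..<t (Suc j)}}"

definition straddle :: "(nat \<Rightarrow> nat) \<Rightarrow> (nat \<Rightarrow> nat) \<Rightarrow> nat \<Rightarrow> nat \<Rightarrow> bool" where
  "straddle u t i j \<longleftrightarrow> {u i..<u (Suc i)} \<inter> {t j..<t (Suc j)} \<noteq> {} \<and> \<not> {u i..<u (Suc i)} \<subseteq> {t j..<t (Suc j)}"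

text \<open>A range that meets an interval without being contained in it must contain
  \<open>t j\<close> or \<open>t (Suc j)\<close>, and each of these points lies in at most one
  range.\<close>

lemma card_straddle:
  assumes "mono u" shows "card {i. i < m \<and> straddle u t i j} \<le> 2"
proof -
  have one: "card {i. i < m \<and> x \<in> {u i..<u (Suc i)}} \<le> 1" for x
    using mono_cut_unique[OF assms, of x]
    by (subst card_le_Suc0_iff_eq[simplified One_nat_def[symmetric]]) auto
  have "{i. i < m \<and> straddle u t i j} \<subseteq>
      {i. i < m \<and> t j \<in> {u i..<u (Suc i)}} \<union> {i. i < m \<and> t (Suc j) \<in> {u i..<u (Suc i)}}"
    unfolding straddle_def by (auto simp: subset_iff)
  then have "card {i. i < m \<and> straddle u t i j} \<le>
      card ({i. i < m \<and> t j \<in> {u i..<u (Suc i)}} \<union> {i. i < m \<and> t (Suc j) \<in> {u i..<u (Suc i)}})"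
    by (intro card_mono) auto
  also have "\<dots> \<le> card {i. i < m \<and> t j \<in> {u i..<u (Suc i)}} + card {i. i < m \<and> t (Suc j) \<in> {u i..<u (Suc i)}}"
    by (rule card_Un_le)
  also have "\<dots> \<le> 2" using one[of "t j"] one[of "t (Suc j)"] by linarith
  finally show ?thesis .
qed

text \<open>Double counting of the incidences. This 2 is the 2 in \<open>CU\<close>.\<close>

lemma card_straddle_sum:
  assumes "mono u" shows "(\<Sum>i<m. card {j. j < n \<and> straddle u t i j}) \<le> 2 * n"
proof -
  have "(\<Sum>i<m. card {j. j < n \<and> straddle u t i j}) = (\<Sum>i<m. \<Sum>j\<in>{j\<in>{..<n}. straddle u t i j}. 1)" by simp
  also have "\<dots> = (\<Sum>j<n. \<Sum>i\<in>{i\<in>{..<m}. straddle u t i j}. 1)"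
    by (rule sum.swap_restrict) auto
  also have "\<dots> \<le> (\<Sum>j<n. 2)" using card_straddle[OF assms] by (intro sum_mono) simp
  finally show ?thesis by simp
qed

lemma cut_decomposition:
  assumes u: "mono u" and supp: "\<And>i. a i \<noteq> 0 \<Longrightarrow> u 0 \<le> i \<and> i < u m"
  shows "cut t j a = (\<lambda>x. restr (\<Union>i\<in>cells u t m j. {u i..<u (Suc i)}) a x
            + (\<Sum>i\<in>{i. i < m \<and> straddle u t i j}. cut t j (cut u i a) x))"
proof
  fix x
  show "cut t j a x = restr (\<Union>i\<in>cells u t m j. {u i..<u (Suc i)}) a x
            + (\<Sum>i\<in>{i. i < m \<and> straddle u t i j}. cut t j (cut u i a) x)"
  proof (cases "a x = 0 \<or> x \<notin> {t j..<t (Suc j)}")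
    case True
    then have "(\<Sum>i\<in>{i. i < m \<and> straddle u t i j}. cut t j (cut u i a) x) = 0"
      by (intro sum.neutral) (auto simp: restr_def)
    then show ?thesis using True by (auto simp: restr_def cells_def subset_iff)
  next
    case False
    then obtain l where l: "l < m" "x \<in> {u l..<u (Suc l)}" using cut_cover[OF u, of x m] supp[of x] by blast
    have uniq: "i = l" if "x \<in> {u i..<u (Suc i)}" for i using mono_cut_unique[OF u that l(2)] .
    have "(\<Sum>i\<in>{i. i < m \<and> straddle u t i j}. cut t j (cut u i a) x)
        = (\<Sum>i\<in>{i. i < m \<and> straddle u t i j}. if i = l then a x else 0)"
    proof (intro sum.cong refl)
      fix i
      show "cut t j (cut u i a) x = (if i = l then a x else 0)"
      proof (cases "i = l")
        case True
        then show ?thesis using False l(2) by (simp add: restr_apply)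
      next
        case ne: False
        then have "x \<notin> {u i..<u (Suc i)}" using uniq by blast
        then show ?thesis using ne by (simp only: restr_apply if_False simp_thms if_cancel)
      qed
    qed
    also have "\<dots> = (if straddle u t l j then a x else 0)" using l by simp
    finally have s: "(\<Sum>i\<in>{i. i < m \<and> straddle u t i j}. cut t j (cut u i a) x)
        = (if straddle u t l j then a x else 0)" .
    have "x \<in> (\<Union>i\<in>cells u t m j. {u i..<u (Suc i)}) \<longleftrightarrow> l \<in> cells u t m j"
    proof
      assume "x \<in> (\<Union>i\<in>cells u t m j. {u i..<u (Suc i)})"
      then obtain i where "i \<in> cells u t m j" "x \<in> {u i..<u (Suc i)}" by blast
      then show "l \<in> cells u t m j" using uniq by blast
    qed (use l(2) in blast)
    moreover have "l \<in> cells u t m j \<longleftrightarrow> \<not> straddle u t l j"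
      using l False unfolding cells_def straddle_def by auto
    ultimately show ?thesis using s False by (auto simp: restr_def)
  qed
qed

lemma cut_cells:
  assumes "mono u" "i < m"
  shows "cut u i (restr (\<Union>i\<in>cells u t m j. {u i..<u (Suc i)}) a)
    = (if i \<in> cells u t m j then cut u i a else (\<lambda>x. 0))"
proof
  fix x
  show "cut u i (restr (\<Union>i\<in>cells u t m j. {u i..<u (Suc i)}) a) x
    = (if i \<in> cells u t m j then cut u i a else (\<lambda>x. 0)) x"
    using mono_cut_unique[OF assms(1), of x i] by (auto simp: restr_def)
qed

lemma finite_cells: "finite (cells u t m j)" by (simp add: cells_def)

lemma cells_disjoint:
  assumes "mono t" "j \<noteq> k" shows "cells u t m j \<inter> cells u t m k = {}"
proof (rule ccontr)
  assume "cells u t m j \<inter> cells u t m k \<noteq> {}"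
  then obtain i where "u i < u (Suc i)" "{u i..<u (Suc i)} \<subseteq> {t j..<t (Suc j)}"
    "{u i..<u (Suc i)} \<subseteq> {t k..<t (Suc k)}" by (auto simp: cells_def)
  then have "u i \<in> {t j..<t (Suc j)}" "u i \<in> {t k..<t (Suc k)}" by auto
  then show False using mono_cut_unique[OF assms(1)] assms(2) by blast
qed

context tirilman
begin

text \<open>The solution \<open>C\<close> of \<open>\<gamma> * C + 2 powr (1/q) = C\<close>, exactly
  what closes the induction in \<open>it_upper_estimate\<close>.\<close>

definition "CU = 2 powr (1/q) / (1 - \<gamma>)"

lemma CU_ge1: "CU \<ge> 1"
proof -
  have "2 powr (1/q) \<ge> 1" using q1 by (intro ge_one_powr_ge_zero) auto
  then show ?thesis unfolding CU_def using \<gamma>0 \<gamma>1 by (simp add: pos_le_divide_eq)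
qed

lemma p0: "p > 0" and q0: "q > 0" using p1 q1 by auto

text \<open>Hoelder against the constant 1 produces precisely the factor \<open>rt n\<close> by
  which the norm divides; disjointness of the cells bounds the remaining \<open>p\<close>-sum by the
  full one.\<close>

lemma sum_cells_le:
  assumes g: "\<And>j. j < n \<Longrightarrow> g j \<le> C * (\<Sum>i\<in>cells u t m j. w i powr p) powr (1/p)"
    and t: "mono t" and C: "C \<ge> 0"
  shows "(\<Sum>j<n. g j) \<le> C * rt n * (\<Sum>i<m. w i powr p) powr (1/p)"
proof -
  define S where "S = (\<lambda>j. \<Sum>i\<in>cells u t m j. w i powr p)"
  have S0: "S j \<ge> 0" for j unfolding S_def by (intro sum_nonneg) auto
  have "(\<Sum>j<n. g j) \<le> (\<Sum>j<n. C * (S j powr (1/p) * 1))"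
    using g by (intro sum_mono) (simp add: S_def)
  also have "\<dots> = C * (\<Sum>j<n. S j powr (1/p) * 1)" by (simp add: sum_distrib_left)
  finally have 1: "(\<Sum>j<n. g j) \<le> C * (\<Sum>j<n. S j powr (1/p) * 1)" .
  have "(\<Sum>j<n. S j powr (1/p) * 1) \<le> (\<Sum>j<n. (S j powr (1/p)) powr p) powr (1/p) * (\<Sum>j<n. 1 powr q) powr (1/q)"
    using p1 q1 pq by (intro Holder_sum) auto
  also have "\<dots> = (\<Sum>j<n. S j) powr (1/p) * rt n" using p0 S0 by (simp add: powr_powr)
  also have "(\<Sum>j<n. S j) = (\<Sum>i\<in>(\<Union>j<n. cells u t m j). w i powr p)"
    unfolding S_def using cells_disjoint[OF t] finite_cells
    by (subst sum.UNION_disjoint) auto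
  also have "(\<Sum>i\<in>(\<Union>j<n. cells u t m j). w i powr p) powr (1/p) * rt n \<le> (\<Sum>i<m. w i powr p) powr (1/p) * rt n"
    using p0 by (intro mult_right_mono powr_mono2 sum_mono2 sum_nonneg) (auto simp: cells_def)
  finally have "C * (\<Sum>j<n. S j powr (1/p) * 1) \<le> C * ((\<Sum>i<m. w i powr p) powr (1/p) * rt n)"
    using C by (rule mult_left_mono)
  then show ?thesis using 1 by (simp add: mult_ac)
qed

text \<open>Stated for an abstract \<open>\<Phi>\<close> because it is applied to an iterate, inside
  the induction on \<open>k\<close>, and to the norm itself. The straddling terms are regrouped by
  block, so that each block is charged with the pieces cut from it.\<close>

lemma decomposition_sum:
  assumes \<Phi>: "\<And>a b. a \<in> c00 \<Longrightarrow> b \<in> c00 \<Longrightarrow> \<Phi> (\<lambda>i. a i + b i) \<le> \<Phi> a + N b"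
    and a: "a \<in> c00" and u: "mono u" and supp: "\<And>i. a i \<noteq> 0 \<Longrightarrow> u 0 \<le> i \<and> i < u m"
  shows "(\<Sum>j<n. \<Phi> (cut t j a)) \<le> (\<Sum>j<n. \<Phi> (restr (\<Union>i\<in>cells u t m j. {u i..<u (Suc i)}) a))
    + (\<Sum>i<m. \<Sum>j\<in>{j. j < n \<and> straddle u t i j}. N (cut t j (cut u i a)))"
proof -
  have "\<Phi> (cut t j a) \<le> \<Phi> (restr (\<Union>i\<in>cells u t m j. {u i..<u (Suc i)}) a)
      + (\<Sum>i\<in>{i\<in>{..<m}. straddle u t i j}. N (cut t j (cut u i a)))" for j
  proof -
    have "\<Phi> (cut t j a) \<le> \<Phi> (restr (\<Union>i\<in>cells u t m j. {u i..<u (Suc i)}) a)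
      + N (\<lambda>x. \<Sum>i\<in>{i. i < m \<and> straddle u t i j}. cut t j (cut u i a) x)"
      by (subst cut_decomposition[OF u supp]) (auto intro!: \<Phi> c00_restr c00_sum a)
    also have "N (\<lambda>x. \<Sum>i\<in>{i. i < m \<and> straddle u t i j}. cut t j (cut u i a) x)
        \<le> (\<Sum>i\<in>{i. i < m \<and> straddle u t i j}. N (cut t j (cut u i a)))"
      by (intro N_sum c00_restr a)
    finally show ?thesis by simp
  qed
  then have "(\<Sum>j<n. \<Phi> (cut t j a)) \<le> (\<Sum>j<n. \<Phi> (restr (\<Union>i\<in>cells u t m j. {u i..<u (Suc i)}) a)
      + (\<Sum>i\<in>{i\<in>{..<m}. straddle u t i j}. N (cut t j (cut u i a))))"
    by (intro sum_mono)
  also have "\<dots> = (\<Sum>j<n. \<Phi> (restr (\<Union>i\<in>cells u t m j. {u i..<u (Suc i)}) a))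
      + (\<Sum>j<n. \<Sum>i\<in>{i\<in>{..<m}. straddle u t i j}. N (cut t j (cut u i a)))" by (simp add: sum.distrib)
  also have "(\<Sum>j<n. \<Sum>i\<in>{i\<in>{..<m}. straddle u t i j}. N (cut t j (cut u i a)))
      = (\<Sum>i<m. \<Sum>j\<in>{j\<in>{..<n}. straddle u t i j}. N (cut t j (cut u i a)))"
    by (rule sum.swap_restrict) auto
  finally show ?thesis by simp
qed

lemma full_cells_sum:
  assumes \<Phi>: "\<And>b. b \<in> c00 \<Longrightarrow> (\<And>i. b i \<noteq> 0 \<Longrightarrow> u 0 \<le> i \<and> i < u m)
      \<Longrightarrow> \<Phi> b \<le> CU * (\<Sum>i<m. N (cut u i b) powr p) powr (1/p)"
    and a: "a \<in> c00" and u: "mono u" and t: "mono t"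
    and supp: "\<And>i. a i \<noteq> 0 \<Longrightarrow> u 0 \<le> i \<and> i < u m"
  shows "(\<Sum>j<n. \<Phi> (restr (\<Union>i\<in>cells u t m j. {u i..<u (Suc i)}) a))
    \<le> CU * rt n * (\<Sum>i<m. N (cut u i a) powr p) powr (1/p)"
proof (rule sum_cells_le[OF _ t])
  fix j
  let ?a = "restr (\<Union>i\<in>cells u t m j. {u i..<u (Suc i)}) a"
  have "\<Phi> ?a \<le> CU * (\<Sum>i<m. N (cut u i ?a) powr p) powr (1/p)"
    using supp by (intro \<Phi> c00_restr a) (auto simp: restr_def split: if_splits)
  also have "(\<Sum>i<m. N (cut u i ?a) powr p) = (\<Sum>i<m. if i \<in> cells u t m j then N (cut u i a) powr p else 0)"
    using cut_cells[OF u] by (intro sum.cong) auto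
  also have "\<dots> = (\<Sum>i\<in>cells u t m j. N (cut u i a) powr p)"
    by (subst sum.inter_restrict[symmetric]) (auto simp: cells_def intro!: sum.cong)
  finally show "\<Phi> ?a \<le> CU * (\<Sum>i\<in>cells u t m j. N (cut u i a) powr p) powr (1/p)" .
qed (use CU_ge1 in simp)

text \<open>For a family of \<open>n\<close> intervals, the blocks inside single intervals are
  handled by the induction hypothesis and Hoelder over the intervals. The straddling ones are
  handled by Hoelder over the blocks, where the numbers of pieces sum to at most
  \<open>2 * n\<close>. Only the first part carries the factor \<gamma>, which is why the constant
  does not grow with \<open>k\<close>.\<close>

lemma it_upper_estimate:
  assumes u: "mono u" and "a \<in> c00" and "\<And>i. a i \<noteq> 0 \<Longrightarrow> u 0 \<le> i \<and> i < u m"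
  shows "it k a \<le> CU * (\<Sum>i<m. N (cut u i a) powr p) powr (1/p)"
  using assms(2,3)
proof (induction k arbitrary: a)
  case (0 a)
  show ?case unfolding ti_iter.simps(1)
  proof (rule supnorm_le)
    fix x
    let ?S = "\<Sum>i<m. N (cut u i a) powr p"
    have S0: "?S \<ge> 0" by (intro sum_nonneg) auto
    show "\<bar>a x\<bar> \<le> CU * ?S powr (1/p)"
    proof (cases "a x = 0")
      case True then show ?thesis using CU_ge1 by simp
    next
      case False
      then obtain l where l: "l < m" "x \<in> {u l..<u (Suc l)}" using cut_cover[OF u, of x m] 0(2)[of x] by blast
      have "\<bar>a x\<bar> = \<bar>cut u l a x\<bar>" using l by (simp add: restr_def)
      also have "\<dots> \<le> N (cut u l a)" by (intro N_abs_le c00_restr 0)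
      also have "\<dots> = (N (cut u l a) powr p) powr (1/p)"
        using p0 N_nonneg[OF c00_restr[OF 0(1)]] by (simp add: powr_powr)
      also have "\<dots> \<le> ?S powr (1/p)"
        using l p0 by (intro powr_mono2 member_le_sum) auto
      also have "\<dots> \<le> CU * ?S powr (1/p)" using CU_ge1 by (simp add: mult_le_cancel_right1)
      finally show ?thesis .
    qed
  qed
next
  case (Suc k a)
  let ?S = "\<Sum>i<m. N (cut u i a) powr p"
  have S0: "?S \<ge> 0" by (intro sum_nonneg) auto
  show ?case
  proof (rule it_le_cut[OF Suc.prems(1)])
    fix x show "\<bar>a x\<bar> \<le> CU * ?S powr (1/p)"
      using Suc.IH[OF Suc.prems] it_abs_le[OF Suc.prems(1), of x k] by linarith
  next
    fix n :: nat and t :: "nat \<Rightarrow> nat" assume n: "n \<ge> 1" and t: "mono t"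
    let ?Q = "\<lambda>i. {j. j < n \<and> straddle u t i j}"
    have full: "(\<Sum>j<n. it k (restr (\<Union>i\<in>cells u t m j. {u i..<u (Suc i)}) a))
        \<le> CU * rt n * ?S powr (1/p)"
      using Suc.IH Suc.prems u t by (intro full_cells_sum) auto
    have "\<gamma> * (\<Sum>i<m. \<Sum>j\<in>?Q i. N (cut t j (cut u i a))) = (\<Sum>i<m. \<gamma> * (\<Sum>j\<in>?Q i. N (cut t j (cut u i a))))"
      by (rule sum_distrib_left)
    \<comment> \<open>The pieces cut from one block by the intervals it straddles form an admissible
      family for that block alone, so \<gamma> is absorbed here.\<close>
    also have "\<dots> \<le> (\<Sum>i<m. N (cut u i a) * rt (card (?Q i)))"
      using N_cut_sum[OF c00_restr[OF Suc.prems(1)] t] by (intro sum_mono) (simp add: mult.commute)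
    also have "\<dots> \<le> ?S powr (1/p) * (\<Sum>i<m. rt (card (?Q i)) powr q) powr (1/q)"
      using p1 q1 pq N_nonneg[OF c00_restr[OF Suc.prems(1)]] by (intro Holder_sum) auto
    also have "(\<Sum>i<m. rt (card (?Q i)) powr q) = real (\<Sum>i<m. card (?Q i))"
      using q0 by (simp add: powr_powr)
    also have "?S powr (1/p) * real (\<Sum>i<m. card (?Q i)) powr (1/q) \<le> ?S powr (1/p) * (2 * real n) powr (1/q)"
    proof (intro mult_left_mono powr_mono2)
      have "real (\<Sum>i<m. card (?Q i)) \<le> real (2 * n)"
        using card_straddle_sum[OF u, where m=m and n=n and t=t] by (rule of_nat_mono)
      then show "real (\<Sum>i<m. card (?Q i)) \<le> 2 * real n" by simp
    qed (use q0 in \<open>auto intro: sum_nonneg\<close>)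
    finally have part: "\<gamma> * (\<Sum>i<m. \<Sum>j\<in>?Q i. N (cut t j (cut u i a))) \<le> ?S powr (1/p) * (2 powr (1/q) * rt n)"
      by (simp add: powr_mult)
    have "\<gamma> * (\<Sum>j<n. it k (cut t j a)) \<le> \<gamma> * ((\<Sum>j<n. it k (restr (\<Union>i\<in>cells u t m j. {u i..<u (Suc i)}) a))
      + (\<Sum>i<m. \<Sum>j\<in>?Q i. N (cut t j (cut u i a))))"
      using \<gamma>0 Suc.prems u
      by (intro mult_left_mono decomposition_sum order_trans[OF it_triangle] add_mono it_le_N) auto
    also have "\<dots> \<le> \<gamma> * (CU * rt n * ?S powr (1/p)) + ?S powr (1/p) * (2 powr (1/q) * rt n)"
      using full part \<gamma>0 by (simp add: distrib_left add_mono mult_left_mono)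
    also have "\<dots> = (\<gamma> * CU + 2 powr (1/q)) * (rt n * ?S powr (1/p))" by (simp add: algebra_simps)
    also have "\<gamma> * CU + 2 powr (1/q) = CU"
      unfolding CU_def using \<gamma>1 by (simp add: field_simps)
    finally show "\<gamma> * (\<Sum>j<n. it k (cut t j a)) \<le> rt n * (CU * ?S powr (1/p))" by (simp add: mult_ac)
  qed
qed

lemma N_upper_estimate:
  assumes "mono u" and "a \<in> c00" and "\<And>i. a i \<noteq> 0 \<Longrightarrow> u 0 \<le> i \<and> i < u m"
  shows "N a \<le> CU * (\<Sum>i<m. N (cut u i a) powr p) powr (1/p)"
  using it_upper_estimate[OF assms] by (rule N_le)

section \<open>Domination of the unit vector basis, and spreading\<close>

lemma c00_cut_norms:
  assumes "strict_mono u" "a \<in> c00" shows "(\<lambda>j. N (cut u j a)) \<in> c00"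
proof -
  obtain K where K: "\<And>i. a i \<noteq> 0 \<Longrightarrow> i < K"
    using assms(2) unfolding c00_def by (auto simp: finite_nat_set_iff_bounded)
  have "N (cut u j a) = 0" if "K \<le> j" for j
  proof -
    have "cut u j a = (\<lambda>i. 0)"
      using K that strict_mono_imp_increasing[OF assms(1), of j] by (fastforce simp: restr_def)
    then show ?thesis by simp
  qed
  then show ?thesis by (intro c00_subset[of "{..<K}"]) (auto simp: not_le[symmetric])
qed

text \<open>An interval family for the coefficient vector is transported to the unions of blocks.\<close>

lemma N_domination:
  assumes u: "strict_mono u" and a: "a \<in> c00"
  shows "N (\<lambda>j. N (cut u j a)) \<le> N a"
proof (rule N_le)
  fix k
  have mu: "mono u" using u by (rule strict_mono_mono)
  show "it k (\<lambda>j. N (cut u j a)) \<le> N a" using a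
  proof (induction k arbitrary: a)
    case 0
    then show ?case by (auto intro!: supnorm_le simp: N_nonneg c00_restr N_restr_le)
  next
    case (Suc k)
    show ?case
    proof (rule it_le_cut[OF c00_cut_norms[OF u Suc.prems]])
      fix i show "\<bar>N (cut u i a)\<bar> \<le> N a" using Suc.prems by (simp add: N_nonneg c00_restr N_restr_le)
    next
      fix n :: nat and t :: "nat \<Rightarrow> nat" assume n: "n \<ge> 1" and t: "mono t"
      have mut: "mono (u \<circ> t)" using mu t by (simp add: mono_def)
      have eq: "cut t l (\<lambda>j. N (cut u j a)) = (\<lambda>j. N (cut u j (cut (u \<circ> t) l a)))" for l
      proof
        fix j
        show "cut t l (\<lambda>j. N (cut u j a)) j = N (cut u j (cut (u \<circ> t) l a))"
        proof (cases "j \<in> {t l..<t (Suc l)}")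
          case True
          then have "u (t l) \<le> u j" "u (Suc j) \<le> u (t (Suc l))" using mu by (auto simp: monoD)
          then have "cut u j (cut (u \<circ> t) l a) = cut u j a" by (auto simp: restr_def)
          then show ?thesis using True by (simp add: restr_apply)
        next
          case False
          then have "u (Suc j) \<le> u (t l) \<or> u (t (Suc l)) \<le> u j" using mu by (auto simp: monoD)
          then have "cut u j (cut (u \<circ> t) l a) = (\<lambda>i. 0)" by (auto simp: restr_def)
          moreover have "cut t l (\<lambda>j. N (cut u j a)) j = 0"
            using False by (simp only: restr_apply if_False simp_thms)
          ultimately show ?thesis by simp
        qed
      qed
      have "\<gamma> * (\<Sum>l<n. it k (cut t l (\<lambda>j. N (cut u j a)))) \<le> \<gamma> * (\<Sum>l<n. N (cut (u \<circ> t) l a))"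
        unfolding eq using \<gamma>0 Suc by (intro mult_left_mono sum_mono Suc.IH c00_restr) auto
      also have "\<dots> \<le> rt n * N a" using N_cut_sum[OF Suc.prems mut, of "{..<n}"] by simp
      finally show "\<gamma> * (\<Sum>l<n. it k (cut t l (\<lambda>j. N (cut u j a)))) \<le> rt n * N a" .
    qed
  qed
qed

lemma c00_comp: assumes "a \<in> c00" "strict_mono (h::nat \<Rightarrow> nat)" shows "a \<circ> h \<in> c00"
proof -
  have "{i. (a \<circ> h) i \<noteq> 0} = h -` {i. a i \<noteq> 0}" by auto
  then show ?thesis using assms finite_vimageI[of "{i. a i \<noteq> 0}" h]
    by (simp add: c00_def strict_mono_imp_inj_on)
qed

text \<open>Pulling cut points back along \<open>h\<close> turns a family for \<open>a\<close> into
  a family for \<open>a \<circ> h\<close>. Some pieces may become empty, which cut points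
  permit.\<close>

lemma N_spread:
  assumes h: "strict_mono h" and "a \<in> c00" and "\<And>i. a i \<noteq> 0 \<Longrightarrow> i \<in> range h"
  shows "N a \<le> N (a \<circ> h)"
proof (rule N_le)
  fix k
  show "it k a \<le> N (a \<circ> h)" using assms(2,3)
  proof (induction k arbitrary: a)
    case (0 a)
    show ?case unfolding ti_iter.simps(1)
    proof (rule supnorm_le)
      fix i
      have n: "0 \<le> N (a \<circ> h)" using N_nonneg c00_comp 0 h by blast
      show "\<bar>a i\<bar> \<le> N (a \<circ> h)"
      proof (cases "a i = 0")
        case False
        then obtain j where "i = h j" using 0 by blast
        then show ?thesis using N_abs_le[OF c00_comp[OF 0(1) h], of j] by simp
      qed (simp add: n)
    qed
  next
    case (Suc k a)
    show ?case
    proof (rule it_le_cut[OF Suc.prems(1)])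
      fix i show "\<bar>a i\<bar> \<le> N (a \<circ> h)" using Suc.IH[OF Suc.prems] it_abs_le[OF Suc.prems(1), of i k] by linarith
    next
      fix n :: nat and t :: "nat \<Rightarrow> nat" assume n: "n \<ge> 1" and t: "mono t"
      define s where "s = (\<lambda>j. LEAST i. t j \<le> h i)"
      have s: "t j \<le> h i \<longleftrightarrow> s j \<le> i" for i j unfolding s_def by (rule strict_mono_Least_iff[OF h])
      have ms: "mono s"
        unfolding mono_def using s t by (meson monoD order_refl order_trans)
      have eq: "cut t j a \<circ> h = cut s j (a \<circ> h)" for j
        by (rule ext) (simp add: restr_def s not_le[symmetric])
      have "\<gamma> * (\<Sum>j<n. it k (cut t j a)) \<le> \<gamma> * (\<Sum>j<n. N (cut t j a \<circ> h))"
        using \<gamma>0 Suc.prems by (intro mult_left_mono sum_mono Suc.IH c00_restr) (auto simp: restr_def split: if_splits)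
      also have "\<dots> \<le> rt n * N (a \<circ> h)"
        unfolding eq using N_cut_sum[OF c00_comp[OF Suc.prems(1) h] ms, of "{..<n}"] by simp
      finally show "\<gamma> * (\<Sum>j<n. it k (cut t j a)) \<le> rt n * N (a \<circ> h)" .
    qed
  qed
qed

end

subsection \<open>Failure of lower estimates\<close>

context tirilman
begin

lemma N_lincomb_cell_le:
  assumes y: "blocks u y" and N1: "\<And>j. N (y j) \<le> 1" and c: "\<And>j. c j \<ge> 0" and F: "finite F"
  shows "N (cut u j (lincomb y c F)) \<le> (if j \<in> F then c j else 0)"
proof -
  have "N (cut u j (lincomb y c F)) = \<bar>if j \<in> F then c j else 0\<bar> * N (y j)"
    unfolding blocks_cut_lincomb[OF y F] by (rule N_scale[OF blocks_c00[OF y]])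
  also have "\<dots> \<le> \<bar>if j \<in> F then c j else 0\<bar> * 1" using N1 by (intro mult_left_mono) auto
  finally show ?thesis using c by simp
qed

lemma N_lincomb_le:
  assumes y: "blocks u y" and N1: "\<And>j. N (y j) \<le> 1" and c: "\<And>j. c j \<ge> 0" and F: "finite F"
  shows "N (lincomb y c F) \<le> CU * (\<Sum>j\<in>F. c j powr p) powr (1/p)"
proof -
  obtain m where m: "F \<subseteq> {0..<m}" using F unfolding finite_nat_set_iff_bounded by force
  have "N (lincomb y c F) \<le> CU * (\<Sum>i<m. N (cut u i (lincomb y c F)) powr p) powr (1/p)"
    using blocks_lincomb_support[OF y _ m]
    by (intro N_upper_estimate blocks_mono[OF y] c00_lincomb blocks_c00[OF y])
  also have "\<dots> \<le> CU * (\<Sum>i<m. if i \<in> F then c i powr p else 0) powr (1/p)"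
  proof (intro mult_left_mono powr_mono2 sum_mono sum_nonneg)
    fix i
    have "N (cut u i (lincomb y c F)) powr p \<le> (if i \<in> F then c i else 0) powr p"
      using p0 by (intro powr_mono2 N_lincomb_cell_le[OF assms] N_nonneg c00_restr c00_lincomb blocks_c00[OF y]) auto
    then show "N (cut u i (lincomb y c F)) powr p \<le> (if i \<in> F then c i powr p else 0)" by (simp split: if_splits)
  qed (use p0 CU_ge1 in auto)
  also have "(\<Sum>i<m. if i \<in> F then c i powr p else 0) = (\<Sum>i\<in>F. c i powr p)"
    using m by (subst sum.inter_restrict[symmetric]) (auto intro!: sum.cong)
  finally show ?thesis .
qed

lemma N_sum_cut_l1:
  assumes "a \<in> c00" "mono t" shows "(\<Sum>j<n. N (cut t j a)) \<le> l1 a"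
proof -
  have "(\<Sum>j<n. N (cut t j a)) \<le> (\<Sum>j<n. l1 (cut t j a))"
    using assms by (intro sum_mono N_le_l1 c00_restr)
  also have "\<dots> \<le> l1 a" using assms disjoint_cut by (intro l1_disjoint) auto
  finally show ?thesis .
qed

lemma l1_sum: assumes "finite F" "\<And>j. j \<in> F \<Longrightarrow> y j \<in> c00"
  shows "l1 (lincomb y c F) \<le> (\<Sum>j\<in>F. \<bar>c j\<bar> * l1 (y j))"
proof -
  define X where "X = (\<Union>j\<in>F. {i. y j i \<noteq> 0})"
  have fX: "finite X" using assms by (auto simp: X_def c00_def)
  have "{i. lincomb y c F i \<noteq> 0} \<subseteq> X"
  proof
    fix i assume "i \<in> {i. lincomb y c F i \<noteq> 0}"
    then have "(\<Sum>j\<in>F. c j * y j i) \<noteq> 0" by (simp add: lincomb_def)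
    then obtain j where "j \<in> F" "c j * y j i \<noteq> 0" by (rule sum.not_neutral_contains_not_neutral)
    then show "i \<in> X" by (auto simp: X_def)
  qed
  then have "l1 (lincomb y c F) = (\<Sum>i\<in>X. \<bar>lincomb y c F i\<bar>)" using fX by (rule l1_eq[rotated])
  also have "\<dots> \<le> (\<Sum>i\<in>X. \<Sum>j\<in>F. \<bar>c j\<bar> * \<bar>y j i\<bar>)"
    unfolding lincomb_def by (intro sum_mono order_trans[OF sum_abs]) (simp add: abs_mult)
  also have "\<dots> = (\<Sum>j\<in>F. \<bar>c j\<bar> * (\<Sum>i\<in>X. \<bar>y j i\<bar>))"
    by (subst sum.swap) (simp add: sum_distrib_left)
  also have "\<dots> = (\<Sum>j\<in>F. \<bar>c j\<bar> * l1 (y j))"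
    using fX by (intro sum.cong arg_cong2[of _ _ _ _ "(*)"] l1_eq[symmetric]) (auto simp: X_def)
  finally show ?thesis .
qed

lemma powr_inverse_small: assumes "\<delta> > 0" obtains m :: nat where "m \<ge> 1" "real m powr (-1/p) \<le> \<delta>"
proof -
  define m where "m = Suc (nat \<lceil>(1/\<delta>) powr p\<rceil>)"
  have "(1/\<delta>) powr p \<le> real m" unfolding m_def by linarith
  then have "((1/\<delta>) powr p) powr (1/p) \<le> real m powr (1/p)" using p0 by (intro powr_mono2) auto
  then have "1/\<delta> \<le> real m powr (1/p)" using assms p0 by (simp add: powr_powr)
  moreover have "real m powr (1/p) > 0" unfolding m_def by (simp del: of_nat_Suc)
  ultimately have "1 / real m powr (1/p) \<le> \<delta>" using assms
    by (simp only: pos_divide_le_eq mult.commute[of \<delta>])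
  then have "real m powr (-1/p) \<le> \<delta>" by (simp add: powr_minus_divide)
  moreover have "m \<ge> 1" by (simp add: m_def)
  ultimately show thesis using that by blast
qed

text \<open>The combination consists of \<open>m\<close> flat layers whose lengths grow so quickly that a family of
  \<open>n\<close> intervals is fine enough for the early layers and too coarse for the late ones; only one
  layer can be split efficiently.\<close>

lemma layered_combination:
  assumes y: "blocks u y" and N1: "\<And>j. N (y j) \<le> 1" and \<rho>: "\<gamma> * CU < \<rho>"
  shows "\<exists>c F. finite F \<and> F \<subseteq> {L..} \<and> (\<forall>j. c j \<ge> 0) \<and> (\<Sum>j\<in>F. c j powr p) = 1 \<and> N (lincomb y c F) \<le> \<rho>"
proof -
  define W where "W = (\<lambda>x. \<Sum>j<x. l1 (y j))"
  have W0: "W x \<ge> 0" for x unfolding W_def by (intro sum_nonneg l1_nonneg)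
  have Wmono: "W x \<le> W x'" if "x \<le> x'" for x x'
    unfolding W_def using that l1_nonneg by (intro sum_mono2) auto
  \<comment> \<open>Layer \<open>i\<close> is \<open>{s i..<s (Suc i)}\<close>. Its length is chosen
    so that \<open>rt (len i)\<close> is at least \<open>W (s i)\<close>, the \<open>l1\<close> mass
    of all blocks before it.\<close>
  define s where "s = rec_nat L (\<lambda>_ x. x + Suc (nat \<lceil>W x powr q\<rceil>))"
  define len where "len = (\<lambda>i. Suc (nat \<lceil>W (s i) powr q\<rceil>))"
  have s0: "s 0 = L" and sS: "s (Suc i) = s i + len i" for i by (auto simp: s_def len_def)
  have sm: "mono s" by (auto simp: mono_iff_le_Suc sS)
  have lenmono: "len i \<le> len k" if "i \<le> k" for i k
  proof -
    have "W (s i) powr q \<le> W (s k) powr q"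
      using that q0 W0 by (intro powr_mono2 Wmono monoD[OF sm]) auto
    then show ?thesis unfolding len_def by (simp only: Suc_le_mono) (intro nat_mono ceiling_mono)
  qed
  have len1: "len i \<ge> 1" for i by (simp add: len_def)
  have lenW: "W (s i) \<le> rt (len i)" for i
  proof -
    have "W (s i) powr q \<le> real (len i)" unfolding len_def by linarith
    then have "(W (s i) powr q) powr (1/q) \<le> rt (len i)" using q0 by (intro powr_mono2) auto
    then show ?thesis using W0 q0 by (simp add: powr_powr)
  qed
  \<comment> \<open>The error budget: the early layers will cost \<open>\<gamma> * \<mu>\<close>,
    the critical one \<open>CU * \<mu>\<close> and the straddling blocks
    \<open>2 * \<gamma> * \<mu>\<close>. Since \<open>\<gamma> < 1\<close>, the total is at most
    \<open>(3 + CU) * \<mu>\<close>.\<close>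
  define \<delta> where "\<delta> = (\<rho> - \<gamma> * CU) / (3 + CU)"
  have \<delta>: "\<delta> > 0" using \<rho> CU_ge1 by (simp add: \<delta>_def)
  obtain m where m1: "m \<ge> 1" and m: "real m powr (-1/p) \<le> \<delta>" using powr_inverse_small[OF \<delta>] .
  define \<mu> where "\<mu> = real m powr (-1/p)"
  have \<mu>0: "\<mu> \<ge> 0" by (simp add: \<mu>_def)
  have \<mu>p: "\<mu> powr p = 1 / real m" using m1 p0 by (simp add: \<mu>_def powr_powr powr_divide powr_minus_divide)
  have \<mu>: "\<gamma> * CU + (3 + CU) * \<mu> \<le> \<rho>"
    using m CU_ge1 unfolding \<mu>_def[symmetric] \<delta>_def by (simp add: pos_le_divide_eq mult.commute)
  define lay where "lay = (\<lambda>j. LEAST i. j < s (Suc i))"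
  have lay: "lay j = i" if "j \<in> {s i..<s (Suc i)}" for i j
    unfolding lay_def
  proof (rule Least_equality)
    fix k assume "j < s (Suc k)"
    show "i \<le> k"
    proof (rule ccontr)
      assume "\<not> i \<le> k" then have "s (Suc k) \<le> s i" using sm by (simp add: monoD)
      then show False using that \<open>j < s (Suc k)\<close> by auto
    qed
  qed (use that in auto)
  \<comment> \<open>Constant on each layer and normalised so that each of the \<open>m\<close>
    layers has \<open>p\<close>-mass \<open>1 / m\<close>.\<close>
  define c where "c = (\<lambda>j. \<mu> * real (len (lay j)) powr (-1/p))"
  have c0: "c j \<ge> 0" for j using \<mu>0 by (simp add: c_def)
  have cp: "c j powr p = 1 / (real m * real (len (lay j)))" for j
    using len1[of "lay j"] \<mu>0 p0 by (simp add: c_def powr_mult \<mu>p powr_powr powr_divide powr_minus_divide)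
  have c\<mu>: "c j \<le> \<mu>" for j
  proof -
    have "real (len (lay j)) powr (-1/p) \<le> 1 powr (-1/p)"
      using len1[of "lay j"] p0 by (intro powr_mono2') auto
    then show ?thesis using \<mu>0 by (simp add: c_def mult_left_le)
  qed
  have layer: "(\<Sum>j\<in>{s i..<s (Suc i)}. c j powr p) = 1 / real m" for i
  proof -
    have "(\<Sum>j\<in>{s i..<s (Suc i)}. c j powr p) = (\<Sum>j\<in>{s i..<s (Suc i)}. 1 / (real m * real (len i)))"
      using lay by (intro sum.cong) (auto simp: cp)
    also have "\<dots> = 1 / real m" using len1[of i] by (simp add: sS)
    finally show ?thesis .
  qed
  define F where "F = {s 0..<s m}"
  have total: "(\<Sum>j\<in>F. c j powr p) = 1"
    unfolding F_def sum_cuts[OF sm] layer using m1 by simp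
  define v where "v = lincomb y c F"
  have yc: "y j \<in> c00" for j using blocks_c00[OF y] .
  have vc: "v \<in> c00" unfolding v_def by (intro c00_lincomb yc)
  have um: "mono u" using blocks_mono[OF y] .
  have "N v \<le> \<rho>"
  proof (rule N_le_cut[OF vc])
    fix x
    show "\<bar>v x\<bar> \<le> \<rho>"
    proof (cases "v x = 0")
      case True
      have "0 \<le> \<gamma> * CU" using \<gamma>0 CU_ge1 by simp
      then show ?thesis using True \<rho> by simp
    next
      case False
      then obtain j where "c j * y j x \<noteq> 0" "j \<in> F" using sum.not_neutral_contains_not_neutral
        unfolding v_def lincomb_def by blast
      then have "u j \<le> x" "x < u (Suc j)" using y by (auto simp: blocks_def)
      then have "\<bar>v x\<bar> = \<bar>cut u j v x\<bar>" by (simp add: restr_def)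
      also have "\<dots> \<le> N (cut u j v)" by (intro N_abs_le c00_restr vc)
      also have "\<dots> \<le> c j" unfolding v_def using N_lincomb_cell_le[where c=c, OF y N1 c0, of F j] \<open>j \<in> F\<close>
        by (simp add: F_def)
      also have "\<dots> \<le> \<mu>" by (rule c\<mu>)
      also have "\<dots> \<le> \<gamma> * CU + (3 + CU) * \<mu>" using \<gamma>0 CU_ge1 \<mu>0 by (simp add: distrib_right)
      finally show ?thesis using \<mu> by simp
    qed
  next
    fix n :: nat and t :: "nat \<Rightarrow> nat" assume n: "n \<ge> 1" and t: "mono t"
    \<comment> \<open>Layers below \<open>i0\<close> are shorter than \<open>n\<close>; if
      \<open>i0 < m\<close>, all layers from \<open>i0\<close> on have length at least
      \<open>n\<close>. The disjunct \<open>m \<le> i\<close> gives \<open>i0\<close> the value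
      \<open>m\<close> when every layer is short.\<close>
    define i0 where "i0 = (LEAST i. m \<le> i \<or> n \<le> len i)"
    have i0: "m \<le> i0 \<or> n \<le> len i0" unfolding i0_def by (rule LeastI[of _ m]) simp
    have i0m: "i0 \<le> m" unfolding i0_def by (rule Least_le) simp
    have below: "len i < n" if "i < i0" for i using not_less_Least[of i "\<lambda>i. m \<le> i \<or> n \<le> len i"] that
      unfolding i0_def by auto
    \<comment> \<open>The last short layer \<open>i0 - 1\<close> is the critical one. If
      \<open>i0 = 0\<close>, truncated subtraction makes both \<open>FL\<close> and
      \<open>FC\<close> empty.\<close>
    define FL FC FH where "FL = {s 0..<s (i0 - 1)}" and "FC = {s (i0 - 1)..<s i0}" and "FH = {s i0..<s m}"
    define vL vC vH where "vL = lincomb y c FL" and "vC = lincomb y c FC" and "vH = lincomb y c FH"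
    have vcs: "vL \<in> c00" "vC \<in> c00" "vH \<in> c00" unfolding vL_def vC_def vH_def by (intro c00_lincomb yc)+
    have ss: "s 0 \<le> s (i0 - 1)" "s (i0 - 1) \<le> s i0" "s i0 \<le> s m" using sm i0m by (auto simp: monoD)
    have "v = (\<lambda>x. vL x + (vC x + vH x))"
    proof
      fix x
      have "sum g F = sum g FL + (sum g FC + sum g FH)" for g :: "nat \<Rightarrow> real"
        unfolding F_def FL_def FC_def FH_def
        using sum.atLeastLessThan_concat[OF ss(2,3), of g] sum.atLeastLessThan_concat[OF ss(1) order_trans[OF ss(2,3)], of g]
        by simp
      then show "v x = vL x + (vC x + vH x)" unfolding v_def vL_def vC_def vH_def lincomb_def .
    qed
    then have split: "cut t j v = (\<lambda>x. cut t j vL x + (cut t j vC x + cut t j vH x))" for j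
      by (auto simp: restr_def)
    have sp: "N (cut t j v) \<le> N (cut t j vL) + (N (cut t j vC) + N (cut t j vH))" for j
      unfolding split
      by (intro order_trans[OF N_triangle] add_mono order_refl N_triangle c00_restr c00_add vcs)
    \<comment> \<open>The blocks before layer \<open>i0 - 1\<close> have total \<open>l1\<close>
      mass at most \<open>rt (len (i0 - 1))\<close>, and that layer is shorter than
      \<open>n\<close>.\<close>
    have low: "(\<Sum>j<n. N (cut t j vL)) \<le> \<mu> * rt n"
    proof (cases i0)
      case 0
      then have "vL = (\<lambda>x. 0)" by (simp add: vL_def FL_def lincomb_def)
      then have "cut t j vL = (\<lambda>x. 0)" for j by (simp add: restr_def)
      then show ?thesis using \<mu>0 by simp
    next
      case (Suc i)
      have "(\<Sum>j<n. N (cut t j vL)) \<le> l1 vL" by (rule N_sum_cut_l1[OF vcs(1) t])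
      also have "\<dots> \<le> (\<Sum>j\<in>FL. \<bar>c j\<bar> * l1 (y j))" unfolding vL_def by (rule l1_sum) (auto simp: FL_def yc)
      also have "\<dots> \<le> (\<Sum>j\<in>FL. \<mu> * l1 (y j))"
        using c0 c\<mu> l1_nonneg by (intro sum_mono mult_right_mono) auto
      also have "\<dots> = \<mu> * (\<Sum>j\<in>FL. l1 (y j))" by (simp add: sum_distrib_left)
      also have "\<dots> \<le> \<mu> * W (s i)" unfolding W_def FL_def using \<mu>0 Suc l1_nonneg
        by (intro mult_left_mono sum_mono2) auto
      also have "\<dots> \<le> \<mu> * rt n"
      proof (intro mult_left_mono order_trans[OF lenW] powr_mono2)
        show "real (len i) \<le> real n" using below[of i] Suc by simp
      qed (use q0 \<mu>0 in auto)
      finally show ?thesis .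
    qed
    \<comment> \<open>A single layer has \<open>p\<close>-mass \<open>1 / m\<close>, hence norm at
      most \<open>CU * \<mu>\<close>, and an admissible sum never exceeds the norm.\<close>
    have crit: "\<gamma> * (\<Sum>j<n. N (cut t j vC)) \<le> rt n * (CU * \<mu>)"
    proof -
      have "N vC \<le> CU * (\<Sum>j\<in>FC. c j powr p) powr (1/p)"
        unfolding vC_def using N_lincomb_le[where c=c, OF y N1 c0, of FC] by (simp add: FC_def)
      also have "\<dots> \<le> CU * (1 / real m) powr (1/p)"
      proof (intro mult_left_mono powr_mono2 sum_nonneg)
        show "(\<Sum>j\<in>FC. c j powr p) \<le> 1 / real m" unfolding FC_def using layer[of "i0 - 1"] by (cases i0) auto
      qed (use CU_ge1 p0 in auto)
      also have "(1 / real m) powr (1/p) = \<mu>" by (simp add: \<mu>_def powr_divide powr_minus_divide)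
      finally have "N vC \<le> CU * \<mu>" .
      then have "rt n * N vC \<le> rt n * (CU * \<mu>)" by (intro mult_left_mono) auto
      then show ?thesis using N_cut_sum[OF vcs(2) t, of "{..<n}"] by simp
    qed
    \<comment> \<open>Whole blocks give the main term \<open>CU * rt n\<close>, to be multiplied by
      \<gamma>. There are at most \<open>2 * n\<close> straddling incidences, each with coefficient
      at most \<open>\<mu> * real n powr (-1/p)\<close> because these layers have length at least
      \<open>n\<close>; the product is \<open>2 * \<mu> * rt n\<close>.\<close>
    have high: "(\<Sum>j<n. N (cut t j vH)) \<le> CU * rt n + 2 * \<mu> * rt n"
    proof -
      have suppH: "u 0 \<le> x \<and> x < u (s m)" if "vH x \<noteq> 0" for x
        using blocks_lincomb_support[OF y that[unfolded vH_def], of 0 "s m"] by (auto simp: FH_def)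
      have cellH: "N (cut u i vH) \<le> (if i \<in> FH then c i else 0)" for i
        unfolding vH_def using N_lincomb_cell_le[where c=c, OF y N1 c0, of FH i] by (simp add: FH_def)
      have N0: "0 \<le> N (cut u i vH)" for i by (intro N_nonneg c00_restr vcs)
      have "(\<Sum>j<n. N (cut t j vH)) \<le> (\<Sum>j<n. N (restr (\<Union>i\<in>cells u t (s m) j. {u i..<u (Suc i)}) vH))
        + (\<Sum>i<s m. \<Sum>j\<in>{j. j < n \<and> straddle u t i j}. N (cut t j (cut u i vH)))"
        using vcs suppH um by (intro decomposition_sum N_triangle) auto
      moreover have "(\<Sum>j<n. N (restr (\<Union>i\<in>cells u t (s m) j. {u i..<u (Suc i)}) vH)) \<le> CU * rt n"
      proof -
        have "(\<Sum>j<n. N (restr (\<Union>i\<in>cells u t (s m) j. {u i..<u (Suc i)}) vH))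
            \<le> CU * rt n * (\<Sum>i<s m. N (cut u i vH) powr p) powr (1/p)"
          using vcs suppH um t by (intro full_cells_sum N_upper_estimate) auto
        also have "\<dots> \<le> CU * rt n * 1 powr (1/p)"
        proof (intro mult_left_mono powr_mono2 sum_nonneg)
          have "(\<Sum>i<s m. N (cut u i vH) powr p) \<le> (\<Sum>i<s m. if i \<in> F then c i powr p else 0)"
          proof (intro sum_mono)
            fix i
            have "N (cut u i vH) powr p \<le> (if i \<in> FH then c i else 0) powr p"
              using cellH N0 p0 by (intro powr_mono2) auto
            also have "\<dots> \<le> (if i \<in> F then c i powr p else 0)"
              using ss by (auto simp: F_def FH_def)
            finally show "N (cut u i vH) powr p \<le> (if i \<in> F then c i powr p else 0)" .
          qed
          also have "\<dots> = (\<Sum>i\<in>F. c i powr p)"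
            by (subst sum.inter_restrict[symmetric]) (auto simp: F_def intro!: sum.cong)
          finally show "(\<Sum>i<s m. N (cut u i vH) powr p) \<le> 1" using total by simp
        qed (use CU_ge1 p0 in auto)
        finally show ?thesis by simp
      qed
      moreover have "(\<Sum>i<s m. \<Sum>j\<in>{j. j < n \<and> straddle u t i j}. N (cut t j (cut u i vH))) \<le> 2 * \<mu> * rt n"
      proof -
        define w where "w = \<mu> * real n powr (-1/p)"
        have w0: "w \<ge> 0" using \<mu>0 by (simp add: w_def)
        have "N (cut t j (cut u i vH)) \<le> w" for i j
        proof -
          have "N (cut t j (cut u i vH)) \<le> N (cut u i vH)" by (intro N_restr_le c00_restr vcs)
          also have "\<dots> \<le> w"
          proof (cases "i \<in> FH")
            case True
            then have "s i0 \<le> i" "i0 < m" using sm i0m by (auto simp: FH_def) (metis leD le_antisym linorder_not_le order_less_le_trans)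
            have "i0 \<le> lay i"
            proof (rule ccontr)
              assume "\<not> i0 \<le> lay i"
              then have "s (Suc (lay i)) \<le> s i0" using sm by (simp add: monoD)
              moreover have "i < s (Suc (lay i))" unfolding lay_def
              proof (rule LeastI)
                show "i < s (Suc m)" using True sS[of m] by (simp add: FH_def)
              qed
              ultimately show False using \<open>s i0 \<le> i\<close> by simp
            qed
            then have "n \<le> len (lay i)" using i0 \<open>i0 < m\<close> lenmono[of i0 "lay i"] by simp
            then have "c i \<le> w" unfolding c_def w_def using n p0 \<mu>0 by (intro mult_left_mono powr_mono2') auto
            then show ?thesis using cellH[of i] True by simp
          next
            case False then show ?thesis using cellH[of i] w0 by simp
          qed
          finally show ?thesis .
        qed
        then have "(\<Sum>i<s m. \<Sum>j\<in>{j. j < n \<and> straddle u t i j}. N (cut t j (cut u i vH)))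
            \<le> (\<Sum>i<s m. \<Sum>j\<in>{j. j < n \<and> straddle u t i j}. w)" by (intro sum_mono)
        also have "\<dots> = real (\<Sum>i<s m. card {j. j < n \<and> straddle u t i j}) * w"
          by (simp add: sum_distrib_right)
        also have "\<dots> \<le> real (2 * n) * w"
          using card_straddle_sum[OF um, where m="s m" and n=n and t=t] w0 by (intro mult_right_mono of_nat_mono)
        also have "\<dots> = 2 * \<mu> * (real n powr 1 * real n powr (-1/p))" using n by (simp add: w_def)
        also have "real n powr 1 * real n powr (-1/p) = real n powr (1 + - 1/p)" by (rule powr_add[symmetric])
        also have "1 + - 1/p = 1/q" using pq by linarith
        finally show ?thesis .
      qed
      ultimately show ?thesis by linarith
    qed
    have "\<gamma> * (\<Sum>j<n. N (cut t j v)) \<le> \<gamma> * (\<Sum>j<n. N (cut t j vL) + (N (cut t j vC) + N (cut t j vH)))"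
      using \<gamma>0 sp by (intro mult_left_mono sum_mono) auto
    also have "\<dots> = \<gamma> * (\<Sum>j<n. N (cut t j vL)) + (\<gamma> * (\<Sum>j<n. N (cut t j vC)) + \<gamma> * (\<Sum>j<n. N (cut t j vH)))"
      by (simp add: sum.distrib distrib_left)
    also have "\<dots> \<le> \<gamma> * (\<mu> * rt n) + (rt n * (CU * \<mu>) + \<gamma> * (CU * rt n + 2 * \<mu> * rt n))"
      using low crit high \<gamma>0 by (intro add_mono mult_left_mono) auto
    also have "\<dots> = rt n * (\<gamma> * CU + (3 * \<gamma> + CU) * \<mu>)" by (simp add: algebra_simps)
    also have "\<dots> \<le> rt n * (\<gamma> * CU + (3 + CU) * \<mu>)"
      using \<gamma>1 \<mu>0 by (intro mult_left_mono add_left_mono mult_right_mono) auto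
    also have "\<dots> \<le> rt n * \<rho>" using \<mu> by (intro mult_left_mono) auto
    finally show "\<gamma> * (\<Sum>j<n. N (cut t j v)) \<le> rt n * \<rho>" .
  qed
  then show ?thesis
    using total c0 monoD[OF sm, of 0 m] s0 unfolding v_def
    by (intro exI[of _ c] exI[of _ F]) (auto simp: F_def)
qed

text \<open>Combinations of norm at most \<rho>, taken on consecutive ranges and divided by \<rho>,
  are again blocks of norm at most 1, so the induction hypothesis applies to them. Multiplying outer
  and inner coefficients keeps the \<open>p\<close>-mass equal to 1 while another factor \<rho> is
  gained.\<close>

lemma iterated_combination:
  assumes "blocks u y" and "\<And>j. N (y j) \<le> 1" and \<rho>: "\<gamma> * CU < \<rho>"
  shows "\<exists>c F. finite F \<and> F \<subseteq> {L..} \<and> (\<forall>j. c j \<ge> 0) \<and> (\<Sum>j\<in>F. c j powr p) = 1 \<and> N (lincomb y c F) \<le> \<rho> ^ k"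
  using assms(1,2)
proof (induction k arbitrary: u y L)
  case (0 u y L)
  have "lincomb y (\<lambda>_. 1) {L} = y L" by (simp add: lincomb_def)
  then show ?case using 0 by (intro exI[of _ "\<lambda>_. 1"] exI[of _ "{L}"]) simp
next
  case (Suc k u y L)
  have y: "blocks u y" and N1: "\<And>j. N (y j) \<le> 1" by fact+
  have \<rho>0: "\<rho> > 0" using \<rho> \<gamma>0 CU_ge1 by (smt (verit) mult_pos_pos)
  have "\<exists>c F. finite F \<and> F \<subseteq> {l..} \<and> (\<forall>j. c j \<ge> 0) \<and> (\<Sum>j\<in>F. c j powr p) = 1 \<and> N (lincomb y c F) \<le> \<rho>" for l
    by (rule layered_combination[OF y N1 \<rho>])
  then obtain cc FF where cF: "\<And>l. finite (FF l)" "\<And>l. FF l \<subseteq> {l..}" "\<And>l j. cc l j \<ge> (0::real)"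
    "\<And>l. (\<Sum>j\<in>FF l. cc l j powr p) = 1" "\<And>l. N (lincomb y (cc l) (FF l)) \<le> \<rho>"
    by metis
  obtain l where lsm: "strict_mono l" and l0: "l 0 = L" and Fl: "\<And>i. FF (l i) \<subseteq> {l i..<l (Suc i)}"
    using consecutive_cuts[of "\<lambda>_. FF" L] cF(1,2) by blast
  define F where "F = (\<lambda>i. FF (l i))"
  define c where "c = (\<lambda>i. cc (l i))"
  have Fsub: "F i \<subseteq> {l i..<l (Suc i)}" for i using Fl by (simp add: F_def)
  have Ffin: "finite (F i)" for i by (simp add: F_def cF)
  define v where "v = (\<lambda>i x. (1/\<rho>) * lincomb y (c i) (F i) x)"
  have yc: "y j \<in> c00" for j using blocks_c00[OF y] .
  have bv: "blocks (u \<circ> l) v"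
    unfolding blocks_def
  proof (intro conjI allI impI)
    show "mono (u \<circ> l)" using blocks_mono[OF y] strict_mono_mono[OF lsm] by (simp add: mono_def)
    fix i x assume "v i x \<noteq> 0"
    then have "lincomb y (c i) (F i) x \<noteq> 0" by (auto simp: v_def)
    then show "(u \<circ> l) i \<le> x" "x < (u \<circ> l) (Suc i)" using blocks_lincomb_support[OF y _ Fsub] by auto
  qed
  have "N (v i) \<le> 1" for i
  proof -
    have "N (v i) = \<bar>1/\<rho>\<bar> * N (lincomb y (c i) (F i))" unfolding v_def by (rule N_scale[OF c00_lincomb[OF yc]])
    also have "\<dots> \<le> \<bar>1/\<rho>\<bar> * \<rho>" using cF(5) by (intro mult_left_mono) (auto simp: c_def F_def)
    finally show ?thesis using \<rho>0 by simp
  qed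
  then obtain d G where d: "finite G" "\<And>i. d i \<ge> 0" "(\<Sum>i\<in>G. d i powr p) = 1" "N (lincomb v d G) \<le> \<rho> ^ k"
    using Suc.IH[OF bv, of 0] by blast
  define H where "H = (\<Union>i\<in>G. F i)"
  define g where "g = (\<lambda>j. SOME i. j \<in> F i)"
  have g: "g j = i" if "j \<in> F i" for i j
  proof -
    have "j \<in> F (g j)" unfolding g_def using that by (rule someI)
    then show ?thesis using that Fsub mono_cut_unique[OF strict_mono_mono[OF lsm], of j "g j" i] by blast
  qed
  define e where "e = (\<lambda>j. d (g j) * c (g j) j)"
  have disj: "\<forall>i\<in>G. \<forall>k\<in>G. i \<noteq> k \<longrightarrow> F i \<inter> F k = {}" using g by blast
  have e0: "e j \<ge> 0" for j using d(2) cF(3) by (simp add: e_def c_def)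
  have "(\<Sum>j\<in>H. e j powr p) = (\<Sum>i\<in>G. \<Sum>j\<in>F i. e j powr p)"
    unfolding H_def using d(1) Ffin disj by (subst sum.UNION_disjoint) auto
  also have "\<dots> = (\<Sum>i\<in>G. d i powr p * (\<Sum>j\<in>F i. c i j powr p))"
  proof (intro sum.cong refl)
    fix i
    have "(\<Sum>j\<in>F i. e j powr p) = (\<Sum>j\<in>F i. d i powr p * c i j powr p)"
      using d(2) cF(3) g by (intro sum.cong) (auto simp: e_def c_def powr_mult)
    then show "(\<Sum>j\<in>F i. e j powr p) = d i powr p * (\<Sum>j\<in>F i. c i j powr p)" by (simp add: sum_distrib_left)
  qed
  also have "\<dots> = 1" using cF(4) d(3) by (simp add: c_def F_def)
  finally have e1: "(\<Sum>j\<in>H. e j powr p) = 1" .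
  have eq: "lincomb y e H = (\<lambda>x. \<rho> * lincomb v d G x)"
  proof
    fix x
    have "lincomb y e H x = (\<Sum>i\<in>G. \<Sum>j\<in>F i. e j * y j x)"
      unfolding lincomb_def H_def using d(1) Ffin disj by (subst sum.UNION_disjoint) auto
    also have "\<dots> = (\<Sum>i\<in>G. d i * (\<Sum>j\<in>F i. c i j * y j x))"
      by (intro sum.cong refl) (auto simp: e_def sum_distrib_left g mult_ac intro!: sum.cong)
    also have "\<dots> = \<rho> * lincomb v d G x"
      unfolding lincomb_def v_def using \<rho>0 by (simp add: sum_distrib_left mult_ac)
    finally show "lincomb y e H x = \<rho> * lincomb v d G x" .
  qed
  have "N (lincomb y e H) = \<bar>\<rho>\<bar> * N (lincomb v d G)"
    unfolding eq by (rule N_scale[OF c00_lincomb[OF blocks_c00[OF bv]]])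
  then have small: "N (lincomb y e H) \<le> \<rho> ^ Suc k" using d(4) \<rho>0 by simp
  have "H \<subseteq> {L..}"
  proof
    fix j assume "j \<in> H"
    then obtain i where "j \<in> F i" by (auto simp: H_def)
    then have "l i \<le> j" using Fsub[of i] by auto
    moreover have "l 0 \<le> l i" using strict_mono_mono[OF lsm] by (simp add: monoD)
    ultimately show "j \<in> {L..}" using l0 by simp
  qed
  then show ?case using e0 e1 small d(1) Ffin
    by (intro exI[of _ e] exI[of _ H]) (auto simp: H_def)
qed

end

text \<open>A threshold independent of \<open>p\<close>: since \<open>2 powr (1/q) \<le> 2\<close>,
  the inequality \<open>2 * \<gamma> < 1 - \<gamma>\<close> already gives
  \<open>\<gamma> * CU < 1\<close>.\<close>

locale tirilman_small = tirilman +
  assumes \<gamma>_small: "\<gamma> < 1/3"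
begin

lemma \<gamma>CU: "\<gamma> * CU < 1"
proof -
  have "2 powr (1/q) \<le> 2 powr 1" using q1 by (intro powr_mono) auto
  then have "\<gamma> * 2 powr (1/q) \<le> \<gamma> * 2" using \<gamma>0 by simp
  then have "\<gamma> * 2 powr (1/q) < 1 - \<gamma>" using \<gamma>_small by linarith
  then show ?thesis unfolding CU_def using \<gamma>1 by (simp add: pos_divide_less_eq)
qed

lemma no_lower_p_estimate:
  assumes "blocks u y" and "\<And>j. N (y j) \<le> 1" and \<epsilon>: "\<epsilon> > 0"
  obtains c F where "finite F" "F \<subseteq> {L..}" "\<And>j. c j \<ge> 0" "(\<Sum>j\<in>F. c j powr p) = 1" "N (lincomb y c F) \<le> \<epsilon>"
proof -
  define \<rho> where "\<rho> = (1 + \<gamma> * CU) / 2"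
  have \<rho>: "\<gamma> * CU < \<rho>" "\<rho> < 1" using \<gamma>CU by (auto simp: \<rho>_def)
  have "\<rho> > 0" using \<gamma>0 CU_ge1 unfolding \<rho>_def by (simp add: add_pos_pos)
  obtain k where "\<rho> ^ k < \<epsilon>" using real_arch_pow_inv[OF \<epsilon> \<rho>(2)] by blast
  then show thesis using iterated_combination[OF assms(1,2) \<rho>(1), of L k] that by force
qed

end

subsection \<open>The dual norm\<close>

lemma pairing_eq: "finite A \<Longrightarrow> {i. a i \<noteq> 0} \<subseteq> A \<Longrightarrow> pairing b a = (\<Sum>i\<in>A. b i * a i)"
  unfolding pairing_def by (rule sum.mono_neutral_left) auto

lemma pairing_restr: "a \<in> c00 \<Longrightarrow> pairing (restr E b) a = pairing b (restr E a)"
  by (subst (1 2) pairing_eq[of "{i. a i \<noteq> 0}"]) (auto simp: c00_def restr_def intro!: sum.cong)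

lemma pairing_lincomb: "pairing (lincomb y c F) a = (\<Sum>j\<in>F. c j * pairing (y j) a)"
  unfolding pairing_def lincomb_def
  by (simp add: sum_distrib_left sum_distrib_right mult_ac) (rule sum.swap)

lemma pairing_scale: "pairing b (\<lambda>i. r * a i) = r * pairing b a"
  by (cases "r = 0") (auto simp: pairing_def sum_distrib_left mult_ac)

lemma pairing_scale_left: "pairing (\<lambda>i. r * b i) a = r * pairing b a"
  by (auto simp: pairing_def sum_distrib_left mult_ac)

lemma pairing_add_left: "pairing (\<lambda>i. b i + b' i) a = pairing b a + pairing b' a"
  by (auto simp: pairing_def sum.distrib distrib_right)

lemma pairing_zero[simp]: "pairing b (\<lambda>i. 0) = 0" by (simp add: pairing_def)
lemma pairing_zero_left[simp]: "pairing (\<lambda>i. 0) a = 0" by (simp add: pairing_def)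

lemma pairing_estar[simp]: assumes "a \<in> c00" shows "pairing (estar k) a = a k"
proof -
  have "pairing (estar k) a = (\<Sum>i\<in>insert k {i. a i \<noteq> 0}. estar k i * a i)"
    using assms by (intro pairing_eq) (auto simp: c00_def)
  also have "\<dots> = (\<Sum>i\<in>insert k {i. a i \<noteq> 0}. if i = k then a k else 0)"
    by (intro sum.cong) (auto simp: estar_def)
  also have "\<dots> = a k" using assms by (simp add: c00_def)
  finally show ?thesis .
qed

lemma lincomb_estar: "finite F \<Longrightarrow> lincomb estar c F = (\<lambda>i. if i \<in> F then c i else 0)"
  by (rule ext) (simp add: lincomb_def estar_def if_distrib[of "\<lambda>z. _ * z"] cong: if_cong)

lemma cut_sum_eq:
  assumes "mono t" "\<And>x. b x \<noteq> 0 \<Longrightarrow> t 0 \<le> x \<and> x < t n"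
  shows "b x = (\<Sum>j<n. cut t j b x)"
proof (cases "b x = 0")
  case True then show ?thesis by (simp add: restr_def cong: if_cong)
next
  case False
  then obtain l where l: "l < n" "x \<in> {t l..<t (Suc l)}" using cut_cover[OF assms(1), of x n] assms(2) by blast
  have "cut t j b x = (if j = l then b x else 0)" for j
  proof (cases "j = l")
    case ne: False
    then have "x \<notin> {t j..<t (Suc j)}" using mono_cut_unique[OF assms(1) _ l(2)] by blast
    then show ?thesis using ne by (simp only: restr_apply if_False simp_thms if_cancel)
  qed (use l(2) in \<open>simp add: restr_apply\<close>)
  then show ?thesis using l(1) by simp
qed

context tirilman
begin

abbreviation "D \<equiv> dual_norm p \<gamma>"
abbreviation "TD \<equiv> TiDual p \<gamma>"

lemma dual_vals_zero: "0 \<in> dual_ball_vals p \<gamma> b"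
  unfolding dual_ball_vals_def by (auto intro!: exI[of _ "\<lambda>i. 0"])

lemma D_upper: "b \<in> TD \<Longrightarrow> a \<in> c00 \<Longrightarrow> N a \<le> 1 \<Longrightarrow> pairing b a \<le> D b"
  unfolding dual_norm_def TiDual_def by (intro cSup_upper) (auto simp: dual_ball_vals_def)

lemma D_nonneg: "b \<in> TD \<Longrightarrow> 0 \<le> D b"
  using D_upper[of b "\<lambda>i. 0"] by simp

lemma dualI:
  assumes "\<And>a. a \<in> c00 \<Longrightarrow> N a \<le> 1 \<Longrightarrow> pairing b a \<le> B"
  shows "b \<in> TD" "D b \<le> B"
proof -
  have "x \<le> B" if "x \<in> dual_ball_vals p \<gamma> b" for x using that assms by (auto simp: dual_ball_vals_def)
  then show "b \<in> TD" "D b \<le> B" unfolding TiDual_def dual_norm_def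
    using dual_vals_zero[of b] by (auto intro!: bdd_aboveI cSup_least)
qed

lemma pairing_le: assumes "b \<in> TD" "a \<in> c00" shows "pairing b a \<le> D b * N a"
proof (cases "N a = 0")
  case True
  then have "a i = 0" for i using N_abs_le[OF assms(2), of i] by simp
  then have "a = (\<lambda>i. 0)" by auto
  then show ?thesis using True by simp
next
  case False
  then have N: "N a > 0" using N_nonneg[OF assms(2)] by simp
  have "N (\<lambda>i. (1 / N a) * a i) = 1" using N by (subst N_scale[OF assms(2)]) simp
  then have "pairing b (\<lambda>i. (1 / N a) * a i) \<le> D b" by (intro D_upper assms c00_scale) simp
  then show ?thesis using N unfolding pairing_scale by (simp add: pos_divide_le_eq)
qed

lemma D_almost_attained:
  assumes "b \<in> TD" "r < D b"
  obtains a where "a \<in> c00" "N a \<le> 1" "r < pairing b a"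
proof -
  have "\<exists>x\<in>dual_ball_vals p \<gamma> b. r < x"
    using assms dual_vals_zero[of b] by (subst less_cSup_iff[symmetric]) (auto simp: TiDual_def dual_norm_def)
  then show thesis using that by (auto simp: dual_ball_vals_def)
qed

lemma D_half_attained:
  assumes "b \<in> TD" obtains a where "a \<in> c00" "N a \<le> 1" "D b / 2 \<le> pairing b a"
proof (cases "D b = 0")
  case True then show thesis using that[of "\<lambda>i. 0"] by simp
next
  case False then have "D b / 2 < D b" using D_nonneg[OF assms] by simp
  then show thesis using D_almost_attained[OF assms] that by (metis less_imp_le)
qed

text \<open>The dual basis inherits 1-unconditionality: the signs of \<open>b\<close> are moved to
  the test vector, whose absolute values do not increase.\<close>

lemma D_mono:
  assumes b: "b \<in> TD" and le: "\<And>i. \<bar>b' i\<bar> \<le> \<bar>b i\<bar>"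
  shows "b' \<in> TD" "D b' \<le> D b"
proof -
  have "pairing b' a \<le> D b" if a: "a \<in> c00" "N a \<le> 1" for a
  proof -
    define a' where "a' = (\<lambda>i. sgn (b i) * \<bar>a i\<bar>)"
    have le': "\<bar>a' i\<bar> \<le> \<bar>a i\<bar>" for i by (simp add: a'_def abs_mult sgn_if)
    have a': "a' \<in> c00" using a(1) le' by (rule c00_le)
    have fin: "finite {i. a i \<noteq> 0}" using a by (simp add: c00_def)
    have "pairing b' a \<le> (\<Sum>i\<in>{i. a i \<noteq> 0}. b i * a' i)" unfolding pairing_def
    proof (rule sum_mono)
      fix i
      have "b' i * a i \<le> \<bar>b' i\<bar> * \<bar>a i\<bar>" by (metis abs_ge_self abs_mult)
      also have "\<dots> \<le> \<bar>b i\<bar> * \<bar>a i\<bar>" using le by (intro mult_right_mono) auto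
      also have "\<dots> = b i * a' i" by (simp add: a'_def sgn_if)
      finally show "b' i * a i \<le> b i * a' i" .
    qed
    also have "\<dots> = pairing b a'" using fin by (intro pairing_eq[symmetric]) (auto simp: a'_def)
    also have "\<dots> \<le> D b" using N_mono[OF a(1) le'] a by (intro D_upper b a') simp
    finally show ?thesis .
  qed
  note bound = this
  show "b' \<in> TD" "D b' \<le> D b" by (rule dualI[OF bound], assumption+)+
qed

lemma D_restr: assumes "b \<in> TD" shows "restr E b \<in> TD" "D (restr E b) \<le> D b"
  by (rule D_mono[OF assms], simp add: restr_def)+

lemma D_subset: assumes "b \<in> TD" "E \<subseteq> E'" shows "D (restr E b) \<le> D (restr E' b)"
  by (rule D_mono[OF D_restr(1)[OF assms(1)]]) (use assms in \<open>auto simp: restr_def\<close>)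

lemma D_add: assumes "b \<in> TD" "b' \<in> TD"
  shows "(\<lambda>i. b i + b' i) \<in> TD" "D (\<lambda>i. b i + b' i) \<le> D b + D b'"
proof -
  have "pairing (\<lambda>i. b i + b' i) a \<le> D b + D b'" if "a \<in> c00" "N a \<le> 1" for a
    unfolding pairing_add_left using that assms by (intro add_mono D_upper)
  note bound = this
  show "(\<lambda>i. b i + b' i) \<in> TD" "D (\<lambda>i. b i + b' i) \<le> D b + D b'" by (rule dualI[OF bound], assumption+)+
qed

lemma D_scale_le: assumes "b \<in> TD" shows "(\<lambda>i. r * b i) \<in> TD" "D (\<lambda>i. r * b i) \<le> \<bar>r\<bar> * D b"
proof -
  have "pairing (\<lambda>i. r * b i) a \<le> \<bar>r\<bar> * D b" if a: "a \<in> c00" "N a \<le> 1" for a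
  proof -
    have "pairing (\<lambda>i. r * b i) a = pairing b (\<lambda>i. r * a i)"
      unfolding pairing_scale pairing_scale_left ..
    also have "\<dots> \<le> D b * (\<bar>r\<bar> * N a)" using pairing_le[OF assms c00_scale[OF a(1)], of r] N_scale[OF a(1)] by simp
    also have "\<dots> \<le> D b * (\<bar>r\<bar> * 1)" using D_nonneg[OF assms] a by (intro mult_left_mono) auto
    finally show ?thesis by (simp add: mult.commute)
  qed
  note bound = this
  show "(\<lambda>i. r * b i) \<in> TD" "D (\<lambda>i. r * b i) \<le> \<bar>r\<bar> * D b" by (rule dualI[OF bound], assumption+)+
qed

lemma D_scale: assumes "b \<in> TD" shows "D (\<lambda>i. r * b i) = \<bar>r\<bar> * D b"
proof (cases "r = 0")
  case True then show ?thesis using D_scale_le(2)[OF assms, of 0] D_nonneg[OF D_scale_le(1)[OF assms, of 0]] by simp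
next
  case False
  have "D (\<lambda>i. (1/r) * (r * b i)) \<le> \<bar>1/r\<bar> * D (\<lambda>i. r * b i)" by (intro D_scale_le assms)
  then have "\<bar>r\<bar> * D b \<le> D (\<lambda>i. r * b i)" using False by (simp add: field_simps)
  then show ?thesis using D_scale_le(2)[OF assms, of r] by simp
qed

lemma D_zero[simp]: "D (\<lambda>i. 0) = 0" "(\<lambda>i. 0) \<in> TD"
proof -
  show z: "(\<lambda>i. 0) \<in> TD" by (rule dualI[of _ 0]) simp
  show "D (\<lambda>i. 0) = 0" using D_scale[OF z, of 0] by simp
qed

lemma D_diff: assumes "b \<in> TD" "b' \<in> TD"
  shows "(\<lambda>i. b i - b' i) \<in> TD" "D (\<lambda>i. b i - b' i) \<le> D b + D b'"
  using D_add[OF assms(1) D_scale_le(1)[OF assms(2), of "-1"]] D_scale[OF assms(2), of "-1"] by auto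

lemma D_minus_commute: "b \<in> TD \<Longrightarrow> b' \<in> TD \<Longrightarrow> D (\<lambda>i. b i - b' i) = D (\<lambda>i. b' i - b i)"
  using D_scale[OF D_diff(1), of b b' "-1"] by simp

lemma D_lincomb:
  assumes "\<And>j. j \<in> F \<Longrightarrow> y j \<in> TD"
  shows "lincomb y c F \<in> TD" "D (lincomb y c F) \<le> (\<Sum>j\<in>F. \<bar>c j\<bar> * D (y j))"
proof -
  have "pairing (lincomb y c F) a \<le> (\<Sum>j\<in>F. \<bar>c j\<bar> * D (y j))" if a: "a \<in> c00" "N a \<le> 1" for a
    unfolding pairing_lincomb
  proof (rule sum_mono)
    fix j assume j: "j \<in> F"
    have "c j * pairing (y j) a = pairing (\<lambda>i. c j * y j i) a" by (simp add: pairing_scale_left)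
    also have "\<dots> \<le> D (\<lambda>i. c j * y j i)" using assms j a by (intro D_upper D_scale_le)
    also have "\<dots> = \<bar>c j\<bar> * D (y j)" using assms j by (intro D_scale)
    finally show "c j * pairing (y j) a \<le> \<bar>c j\<bar> * D (y j)" .
  qed
  note bound = this
  show "lincomb y c F \<in> TD" "D (lincomb y c F) \<le> (\<Sum>j\<in>F. \<bar>c j\<bar> * D (y j))" by (rule dualI[OF bound], assumption+)+
qed

lemma c00_estar: "estar k \<in> c00"
  by (rule c00_subset[of "{k}"]) (auto simp: estar_def)

lemma N_estar: "N (estar k) \<le> 1"
proof -
  have "l1 (estar k) = 1" by (subst l1_eq[of "{k}"]) (auto simp: estar_def)
  then show ?thesis using N_le_l1[OF c00_estar, of k] by simp
qed

lemma pairing_commute_estar: "pairing b (estar k) = b k"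
  by (subst pairing_eq[of "{k}"]) (auto simp: estar_def)

lemma D_abs_le: assumes "b \<in> TD" shows "\<bar>b k\<bar> \<le> D b"
proof -
  have "pairing b (\<lambda>i. s * estar k i) \<le> D b" if "\<bar>s\<bar> = 1" for s
    using N_estar[of k] N_scale[OF c00_estar, of s k] that by (intro D_upper assms c00_scale c00_estar) auto
  from this[of 1] this[of "-1"] show ?thesis
    unfolding pairing_scale pairing_commute_estar by (simp add: abs_le_iff)
qed

lemma D_estar: "estar k \<in> TD" "D (estar k) \<le> 1"
proof -
  have "pairing (estar k) a \<le> 1" if "a \<in> c00" "N a \<le> 1" for a
    using N_abs_le[OF that(1), of k] that by simp
  note bound = this
  show "estar k \<in> TD" "D (estar k) \<le> 1" by (rule dualI[OF bound], assumption+)+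
qed

lemma c00_lincomb_estar: assumes "b \<in> c00" shows "b = lincomb estar b {i. b i \<noteq> 0}"
  using assms by (subst lincomb_estar) (auto simp: c00_def)

lemma c00_TD: "b \<in> c00 \<Longrightarrow> b \<in> TD"
  by (subst c00_lincomb_estar) (auto intro: D_lincomb D_estar)

lemma blocks_TD: "blocks u f \<Longrightarrow> f j \<in> TD" using blocks_c00 c00_TD by blast

text \<open>The norm inequality read in the dual: a vector of norm at most 1 satisfies
  \<open>(\<Sum>j<n. N (cut t j a)) \<le> rt n / \<gamma>\<close>, and each piece of
  \<open>b\<close> is paired only with the corresponding piece of \<open>a\<close>. It serves as an
  upper \<open>q\<close>-estimate for pieces of comparable norm.\<close>

lemma D_cut_upper:
  assumes t: "mono t" and supp: "\<And>x. b x \<noteq> 0 \<Longrightarrow> t 0 \<le> x \<and> x < t n"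
    and B: "\<And>j. j < n \<Longrightarrow> D (cut t j b) \<le> B" and B0: "B \<ge> 0"
  shows "D b \<le> rt n * B / \<gamma>"
proof -
  have b: "b \<in> TD" by (rule c00_TD, rule c00_subset[of "{t 0..<t n}"]) (use supp in auto)
  have "pairing b a \<le> rt n * B / \<gamma>" if a: "a \<in> c00" "N a \<le> 1" for a
  proof -
    have "b = lincomb (\<lambda>j. cut t j b) (\<lambda>_. 1) {..<n}"
      unfolding lincomb_def using cut_sum_eq[OF t supp] by (intro ext) simp
    then have "pairing b a = (\<Sum>j<n. pairing (cut t j b) a)"
      by (metis (no_types, lifting) mult_1 pairing_lincomb sum.cong)
    also have "\<dots> \<le> (\<Sum>j<n. B * N (cut t j a))"
    proof (rule sum_mono)
      fix j assume j: "j \<in> {..<n}"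
      have "pairing (cut t j b) a = pairing (cut t j b) (cut t j a)"
        by (subst pairing_restr[OF a(1)], subst pairing_restr[OF c00_restr[OF a(1)]]) (simp add: restr_restr)
      also have "\<dots> \<le> D (cut t j b) * N (cut t j a)" by (intro pairing_le D_restr b c00_restr a)
      also have "\<dots> \<le> B * N (cut t j a)" using j by (intro mult_right_mono B N_nonneg c00_restr a) auto
      finally show "pairing (cut t j b) a \<le> B * N (cut t j a)" .
    qed
    also have "\<dots> = B * (\<Sum>j<n. N (cut t j a))" by (simp add: sum_distrib_left)
    also have "\<dots> \<le> B * (rt n / \<gamma>)"
    proof (rule mult_left_mono[OF _ B0])
      have "\<gamma> * (\<Sum>j<n. N (cut t j a)) \<le> rt n * N a" using N_cut_sum[OF a(1) t, of "{..<n}"] by simp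
      also have "\<dots> \<le> rt n * 1" using a by (intro mult_left_mono) auto
      finally show "(\<Sum>j<n. N (cut t j a)) \<le> rt n / \<gamma>" using \<gamma>0 by (simp add: pos_le_divide_eq mult.commute)
    qed
    finally show ?thesis by (simp add: mult.commute)
  qed
  then show ?thesis by (rule dualI)
qed

section \<open>The lower \<open>q\<close>-estimate, domination and vanishing tails in the
  dual\<close>

lemma conj_exp_mult: "(q - 1) * p = q" "(p - 1) * q = p"
  using p1 by (auto simp: conj_exp_def field_simps)

text \<open>Dual to the upper \<open>p\<close>-estimate: nearly norming vectors of the pieces are
  combined into one test vector. The factor 2 comes from norming each piece only up to one half,
  \<open>CU\<close> from the norm of the combination.\<close>

lemma D_lower_estimate:
  assumes b: "b \<in> TD" and t: "mono t" and J: "finite J"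
  shows "(\<Sum>j\<in>J. D (cut t j b) powr q) \<le> (2 * CU * D b) powr q"
proof -
  define d where "d = (\<lambda>j. D (cut t j b))"
  have d0: "d j \<ge> 0" for j unfolding d_def by (intro D_nonneg D_restr b)
  have "\<exists>a. a \<in> c00 \<and> N a \<le> 1 \<and> d j / 2 \<le> pairing (cut t j b) a" for j
    unfolding d_def using D_half_attained[OF D_restr(1)[OF b]] by metis
  then obtain \<alpha> where \<alpha>: "\<And>j. \<alpha> j \<in> c00" "\<And>j. N (\<alpha> j) \<le> 1" "\<And>j. d j / 2 \<le> pairing (cut t j b) (\<alpha> j)"
    by metis
  define y where "y = (\<lambda>j. cut t j (\<alpha> j))"
  have y: "blocks t y" using t by (auto simp: blocks_def y_def restr_def split: if_splits)
  have N1: "N (y j) \<le> 1" for j using N_restr_le[OF \<alpha>(1)] \<alpha>(2) order_trans unfolding y_def by blast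
  \<comment> \<open>The extremal weights of Hoelder's inequality: by \<open>(q - 1) * p = q\<close>,
    both \<open>w j powr p\<close> and \<open>w j * d j\<close> equal
    \<open>d j powr q\<close>.\<close>
  define w where "w = (\<lambda>j. d j powr (q - 1))"
  define S where "S = (\<Sum>j\<in>J. d j powr q)"
  have S0: "S \<ge> 0" unfolding S_def by (intro sum_nonneg) auto
  have wp: "w j powr p = d j powr q" for j by (simp add: w_def powr_powr conj_exp_mult)
  have wd: "w j * d j = d j powr q" for j
  proof (cases "d j = 0")
    case False
    then have "w j * d j = d j powr (q - 1) * d j powr 1" using d0[of j] by (simp add: w_def)
    also have "\<dots> = d j powr q" by (subst powr_add[symmetric]) simp
    finally show ?thesis .
  qed (simp add: w_def)
  have Nv: "N (lincomb y w J) \<le> CU * S powr (1/p)"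
    using N_lincomb_le[OF y N1 _ J, of w] by (simp add: w_def[symmetric] wp S_def) (simp add: w_def wp[unfolded w_def])
  have c: "lincomb y w J \<in> c00" by (intro c00_lincomb blocks_c00[OF y])
  have "S / 2 \<le> pairing b (lincomb y w J)"
  proof -
    have "{i. lincomb y w J i \<noteq> 0} \<subseteq> (\<Union>j\<in>J. {i. y j i \<noteq> 0})"
      unfolding lincomb_def using sum.not_neutral_contains_not_neutral by fastforce
    have "S / 2 = (\<Sum>j\<in>J. w j * (d j / 2))" by (simp add: S_def sum_divide_distrib wd)
    also have "\<dots> \<le> (\<Sum>j\<in>J. w j * pairing b (y j))"
    proof (intro sum_mono mult_left_mono)
      fix j show "d j / 2 \<le> pairing b (y j)" using \<alpha>(3)[of j] unfolding y_def pairing_restr[OF \<alpha>(1)] .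
    qed (simp add: w_def)
    also have "\<dots> = pairing b (lincomb y w J)"
    proof -
      define X where "X = (\<Union>j\<in>J. {i. y j i \<noteq> 0})"
      have fX: "finite X" using J blocks_c00[OF y] by (auto simp: X_def c00_def)
      have "pairing b (y j) = (\<Sum>i\<in>X. b i * y j i)" if "j \<in> J" for j
        using that fX by (intro pairing_eq) (auto simp: X_def)
      then have "(\<Sum>j\<in>J. w j * pairing b (y j)) = (\<Sum>j\<in>J. \<Sum>i\<in>X. b i * (w j * y j i))"
        by (intro sum.cong refl) (simp add: sum_distrib_left mult_ac)
      also have "\<dots> = (\<Sum>i\<in>X. b i * lincomb y w J i)" by (subst sum.swap) (simp add: lincomb_def sum_distrib_left)
      also have "\<dots> = pairing b (lincomb y w J)"
        using fX \<open>{i. lincomb y w J i \<noteq> 0} \<subseteq> (\<Union>j\<in>J. {i. y j i \<noteq> 0})\<close>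
        by (intro pairing_eq[symmetric]) (auto simp: X_def)
      finally show ?thesis .
    qed
    finally show ?thesis .
  qed
  also have "\<dots> \<le> D b * N (lincomb y w J)" by (intro pairing_le b c)
  also have "\<dots> \<le> D b * (CU * S powr (1/p))" using Nv D_nonneg[OF b] by (intro mult_left_mono)
  finally have main: "S \<le> 2 * CU * D b * S powr (1/p)" by (simp add: mult_ac)
  have "S \<le> (2 * CU * D b) powr q"
  proof (cases "S = 0")
    case False
    then have S: "S > 0" using S0 by simp
    have "S powr (1/q) * S powr (1/p) = S" using pq S by (simp add: powr_add[symmetric] add.commute)
    then have "S powr (1/q) * S powr (1/p) \<le> (2 * CU * D b) * S powr (1/p)" using main by simp
    then have "S powr (1/q) \<le> 2 * CU * D b" using S by (simp only: mult_le_cancel_right) auto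
    then have "(S powr (1/q)) powr q \<le> (2 * CU * D b) powr q" using q0 by (intro powr_mono2) auto
    then show ?thesis using S q0 by (simp add: powr_powr)
  qed simp
  then show ?thesis by (simp add: S_def d_def)
qed

text \<open>Paired with \<open>a\<close>, the block \<open>f j\<close> gives at most
  \<open>C * N (cut u j a)\<close>, and by \<open>N_domination\<close> the sequence of these norms
  is itself an admissible test vector for the unit vectors.\<close>

lemma D_domination:
  assumes u: "strict_mono u" and f: "blocks u f" and F: "finite F" and C: "\<And>j. j \<in> F \<Longrightarrow> D (f j) \<le> C" "C \<ge> 0"
  shows "D (lincomb f c F) \<le> C * D (lincomb estar c F)"
proof -
  have eTD: "lincomb estar c F \<in> TD" for c using D_lincomb D_estar by blast
  have "pairing (lincomb f c F) a \<le> C * D (lincomb estar c F)" if a: "a \<in> c00" "N a \<le> 1" for a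
  proof -
    define w where "w = (\<lambda>j. N (cut u j a))"
    have wc: "w \<in> c00" unfolding w_def by (rule c00_cut_norms[OF u a(1)])
    have "pairing (lincomb f c F) a \<le> (\<Sum>j\<in>F. \<bar>c j\<bar> * (C * w j))"
      unfolding pairing_lincomb
    proof (rule sum_mono)
      fix j assume j: "j \<in> F"
      have "f j = cut u j (f j)" using f unfolding blocks_def by (intro ext) (auto simp: restr_apply)
      then have eq: "pairing (f j) a = pairing (f j) (cut u j a)"
        using pairing_restr[OF a(1), of "{u j..<u (Suc j)}" "f j"] by simp
      have ab: "\<bar>pairing (f j) (cut u j a)\<bar> \<le> C * w j"
      proof -
        have "pairing (f j) (\<lambda>i. s * cut u j a i) \<le> C * w j" if s: "\<bar>s\<bar> = 1" for s
        proof -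
          have "pairing (f j) (\<lambda>i. s * cut u j a i) \<le> D (f j) * (\<bar>s\<bar> * w j)"
            unfolding w_def using pairing_le[OF blocks_TD[OF f] c00_scale[OF c00_restr[OF a(1)]]] N_scale[OF c00_restr[OF a(1)]] by simp
          also have "\<dots> \<le> C * w j" using s C j N_nonneg[OF c00_restr[OF a(1)]]
            by (simp add: w_def mult_right_mono)
          finally show ?thesis .
        qed
        from this[of 1] this[of "-1"] show ?thesis unfolding pairing_scale by (simp add: abs_le_iff)
      qed
      have "c j * pairing (f j) a \<le> \<bar>c j\<bar> * \<bar>pairing (f j) a\<bar>" by (metis abs_ge_self abs_mult)
      also have "\<dots> \<le> \<bar>c j\<bar> * (C * w j)" using ab eq by (intro mult_left_mono) auto
      finally show "c j * pairing (f j) a \<le> \<bar>c j\<bar> * (C * w j)" .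
    qed
    also have "\<dots> = C * pairing (lincomb estar (\<lambda>j. \<bar>c j\<bar>) F) w"
      using wc by (simp add: pairing_lincomb sum_distrib_left mult_ac)
    also have "\<dots> \<le> C * D (lincomb estar c F)"
    proof (rule mult_left_mono[OF _ C(2)])
      have "pairing (lincomb estar (\<lambda>j. \<bar>c j\<bar>) F) w \<le> D (lincomb estar (\<lambda>j. \<bar>c j\<bar>) F)"
        using N_domination[OF u a(1)] a(2) by (intro D_upper eTD wc) (simp add: w_def)
      also have "\<dots> \<le> D (lincomb estar c F)"
        by (rule D_mono[OF eTD]) (use F in \<open>auto simp: lincomb_estar\<close>)
      finally show "pairing (lincomb estar (\<lambda>j. \<bar>c j\<bar>) F) w \<le> D (lincomb estar c F)" .
    qed
    finally show ?thesis .
  qed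
  then show ?thesis by (rule dualI)
qed

text \<open>A test vector can be moved to the positions \<open>h i\<close> and filled up with zeros
  without increasing its norm, by \<open>N_spread\<close>.\<close>

lemma D_spread:
  assumes h: "strict_mono h"
  shows "D (lincomb estar c F) \<le> D (lincomb (estar \<circ> h) c F)"
proof -
  have TD': "lincomb (estar \<circ> h) c F \<in> TD" by (rule D_lincomb) (simp add: D_estar)
  have injh: "inj h" using h by (rule strict_mono_imp_inj_on)
  have "pairing (lincomb estar c F) a \<le> D (lincomb (estar \<circ> h) c F)" if a: "a \<in> c00" "N a \<le> 1" for a
  proof -
    define a' where "a' = (\<lambda>i. if i \<in> range h then a (inv h i) else 0)"
    have comp: "a' \<circ> h = a" using injh by (auto simp: a'_def)
    have a': "a' \<in> c00"
    proof (rule c00_subset)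
      show "finite (h ` {i. a i \<noteq> 0})" using a by (simp add: c00_def)
      show "{i. a' i \<noteq> 0} \<subseteq> h ` {i. a i \<noteq> 0}" using injh by (auto simp: a'_def split: if_splits)
    qed
    have "N a' \<le> N (a' \<circ> h)" by (rule N_spread[OF h a']) (auto simp: a'_def split: if_splits)
    then have "N a' \<le> 1" using a comp by simp
    then have "pairing (lincomb (estar \<circ> h) c F) a' \<le> D (lincomb (estar \<circ> h) c F)" by (intro D_upper TD' a')
    moreover have "pairing (lincomb (estar \<circ> h) c F) a' = pairing (lincomb estar c F) a"
      using a a' fun_cong[OF comp] by (simp add: pairing_lincomb)
    ultimately show ?thesis by simp
  qed
  then show ?thesis by (rule dualI)
qed

text \<open>Otherwise infinitely many consecutive pieces would have norm at least
  \<open>\<epsilon> / 2\<close>, against the lower \<open>q\<close>-estimate. Hence every functional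
  is the norm limit of its finite sections.\<close>

lemma D_tail:
  assumes b: "b \<in> TD" and \<epsilon>: "\<epsilon> > 0"
  shows "\<exists>M. \<forall>n\<ge>M. D (restr {n..} b) < \<epsilon>"
proof (rule ccontr)
  assume "\<not> (\<exists>M. \<forall>n\<ge>M. D (restr {n..} b) < \<epsilon>)"
  then have big: "D (restr {n..} b) \<ge> \<epsilon>" for n
    using D_subset[OF b, of "{m..}" "{n..}" for m] by (smt (verit, ccfv_threshold) atLeast_subset_iff)
  have "\<exists>n'>n. D (restr {n..<n'} b) \<ge> \<epsilon> / 2" for n
  proof -
    have "\<epsilon> / 2 < D (restr {n..} b)" using big[of n] \<epsilon> by simp
    then obtain a where a: "a \<in> c00" "N a \<le> 1" "\<epsilon> / 2 < pairing (restr {n..} b) a"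
      using D_almost_attained[OF D_restr(1)[OF b]] by blast
    obtain K where K: "\<And>i. a i \<noteq> 0 \<Longrightarrow> i < K"
      using a(1) unfolding c00_def by (auto simp: finite_nat_set_iff_bounded)
    define n' where "n' = max K (Suc n)"
    have "restr {n..<n'} a = restr {n..} a" using K by (fastforce simp: restr_def n'_def)
    then have "pairing (restr {n..} b) a = pairing (restr {n..<n'} b) a"
      by (simp add: pairing_restr[OF a(1)])
    also have "\<dots> \<le> D (restr {n..<n'} b)" by (intro D_upper D_restr b a)
    finally show ?thesis using a(3) by (intro exI[of _ n']) (auto simp: n'_def)
  qed
  then obtain nx where nx: "\<And>n. n < nx n" "\<And>n. D (restr {n..<nx n} b) \<ge> \<epsilon> / 2" by metis
  define t where "t = rec_nat 0 (\<lambda>_. nx)"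
  have tS: "t (Suc k) = nx (t k)" for k by (simp add: t_def)
  have t: "mono t" using nx(1) by (simp add: mono_iff_le_Suc tS less_imp_le)
  have "real m * (\<epsilon> / 2) powr q \<le> (2 * CU * D b) powr q" for m
  proof -
    have "real m * (\<epsilon> / 2) powr q = (\<Sum>j<m. (\<epsilon> / 2) powr q)" by simp
    also have "\<dots> \<le> (\<Sum>j<m. D (cut t j b) powr q)"
      using nx(2) \<epsilon> q0 by (intro sum_mono powr_mono2) (auto simp: tS)
    also have "\<dots> \<le> (2 * CU * D b) powr q" by (intro D_lower_estimate b t) simp
    finally show ?thesis .
  qed
  moreover have "(\<epsilon> / 2) powr q > 0" using \<epsilon> by simp
  ultimately show False using reals_Archimedean3[of "(\<epsilon> / 2) powr q"] by (meson not_less)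
qed

text \<open>The last piece absorbs the next coordinate as long as its norm is at most \<tau>;
  otherwise a new piece is started. One coordinate adds at most \<tau>, whence the bound
  \<open>2 * \<tau>\<close>. The last of the \<open>Suc n\<close> pieces may still be small, so the
  lower bound is claimed for \<open>j < n\<close> only.\<close>

lemma greedy_cuts:
  assumes b: "b \<in> TD" and \<tau>: "\<And>s. \<bar>b s\<bar> \<le> \<tau>"
  shows "\<exists>n t. mono t \<and> t 0 = 0 \<and> t (Suc n) = K \<and> (\<forall>j\<le>n. D (cut t j b) \<le> 2 * \<tau>) \<and> (\<forall>j<n. D (cut t j b) > \<tau>)"
proof (induction K)
  case 0
  have "\<tau> \<ge> 0" using \<tau>[of 0] by linarith
  moreover have "restr {} b = (\<lambda>i. 0)" by (simp add: restr_def)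
  ultimately show ?case by (intro exI[of _ 0] exI[of _ "\<lambda>_. 0"]) (auto simp: mono_def)
next
  case (Suc K)
  then obtain n t where t: "mono t" "t 0 = 0" "t (Suc n) = K" "\<And>j. j \<le> n \<Longrightarrow> D (cut t j b) \<le> 2 * \<tau>"
    "\<And>j. j < n \<Longrightarrow> D (cut t j b) > \<tau>" by blast
  have \<tau>0: "\<tau> \<ge> 0" using \<tau>[of 0] by linarith
  have single: "D (restr {K..<Suc K} b) \<le> \<tau>"
  proof -
    have "restr {K..<Suc K} b = (\<lambda>i. b K * estar K i)" by (auto simp: restr_def estar_def)
    then have "D (restr {K..<Suc K} b) \<le> \<bar>b K\<bar> * D (estar K)" using D_scale_le(2)[OF D_estar(1)] by simp
    also have "\<dots> \<le> \<tau> * 1" using \<tau>[of K] \<tau>0 D_estar D_nonneg[OF D_estar(1)] by (intro mult_mono) auto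
    finally show ?thesis by simp
  qed
  have tn: "t n \<le> K" using t(1) t(3) monoD[of t n "Suc n"] by simp
  show ?case
  proof (cases "D (cut t n b) \<le> \<tau>")
    case True
    define t' where "t' = (\<lambda>i. if i \<le> n then t i else Suc K)"
    have m: "mono t'" unfolding mono_iff_le_Suc
    proof
      fix i show "t' i \<le> t' (Suc i)"
        using monoD[OF t(1), of i "Suc i"] tn by (cases "i = n") (auto simp: t'_def)
    qed
    have eq: "cut t' j b = cut t j b" if "j < n" for j using that by (simp add: t'_def)
    have "cut t' n b = (\<lambda>i. cut t n b i + restr {K..<Suc K} b i)"
      using tn t(3) by (auto simp: t'_def restr_def)
    then have "D (cut t' n b) \<le> D (cut t n b) + D (restr {K..<Suc K} b)" by (simp add: D_add D_restr b)
    then have last: "D (cut t' n b) \<le> 2 * \<tau>" using True single by linarith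
    show ?thesis
    proof (intro exI[of _ n] exI[of _ t'] conjI allI impI m)
      fix j assume "j \<le> n" then show "D (cut t' j b) \<le> 2 * \<tau>" using last eq t(4) by (cases "j = n") auto
    qed (use t(2,5) eq in \<open>auto simp: t'_def\<close>)
  next
    case False
    define t' where "t' = (\<lambda>i. if i \<le> Suc n then t i else Suc K)"
    have m: "mono t'" unfolding mono_iff_le_Suc
      using t(1,3) by (auto simp: t'_def mono_iff_le_Suc le_Suc_eq)
    have eq: "cut t' j b = cut t j b" if "j \<le> n" for j using that by (simp add: t'_def)
    have "cut t' (Suc n) b = restr {K..<Suc K} b" using t(3) by (simp add: t'_def)
    then have last: "D (cut t' (Suc n) b) \<le> 2 * \<tau>" using single \<tau>0 by simp
    show ?thesis
    proof (intro exI[of _ "Suc n"] exI[of _ t'] conjI allI impI m)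
      fix j assume "j \<le> Suc n" then show "D (cut t' j b) \<le> 2 * \<tau>" using last eq t(4) by (cases "j = Suc n") auto
    next
      fix j assume "j < Suc n" then show "D (cut t' j b) > \<tau>" using False eq t(5) by (cases "j = n") auto
    qed (use t(2) in \<open>auto simp: t'_def\<close>)
  qed
qed


end

section \<open>Upper \<open>q\<close>-estimates for blocks with small coordinates\<close>

context tirilman
begin

text \<open>The greedy procedure yields at most \<open>m * (2 + (2 * CU) powr q)\<close> pieces of
  norm at most \<open>2 * m powr (-1/q)\<close>; \<open>D_cut_upper\<close> turns this into
  \<open>CS\<close>, in which \<open>m\<close> cancels.\<close>

definition "CS = 2 / \<gamma> * (2 + (2 * CU) powr q) powr (1/q)"

text \<open>Pieces inside block \<open>i\<close> have norm above \<tau>, so the lower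
  \<open>q\<close>-estimate bounds their number by a multiple of
  \<open>m * \<bar>c i\<bar> powr q\<close>; summed over \<open>i\<close> this is a multiple of
  \<open>m\<close>. All other pieces but the last contain the left end of some block, so there are
  at most \<open>m\<close> of them. Flatness is what allows the cutting into pieces of nearly equal
  norm.\<close>

lemma D_flat_blocks:
  assumes f: "blocks u f" and F: "F \<subseteq> {..<m}" and m: "m \<ge> 1"
    and D1: "\<And>i. i \<in> F \<Longrightarrow> D (f i) \<le> 1"
    and flat: "\<And>i s. i \<in> F \<Longrightarrow> \<bar>f i s\<bar> \<le> real m powr (-1/q)"
    and c: "(\<Sum>i\<in>F. \<bar>c i\<bar> powr q) \<le> 1"
  shows "D (lincomb f c F) \<le> CS"
proof -
  have finF: "finite F" using F finite_subset by blast
  have um: "mono u" using blocks_mono[OF f] .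
  define b where "b = lincomb f c F"
  define \<tau> where "\<tau> = real m powr (-1/q)"
  have \<tau>0: "\<tau> > 0" using m by (simp add: \<tau>_def)
  have \<tau>q: "\<tau> powr q = 1 / real m" using m q0 by (simp add: \<tau>_def powr_powr powr_divide powr_minus_divide)
  have bTD: "b \<in> TD" unfolding b_def by (intro D_lincomb blocks_TD[OF f])
  have supp: "u 0 \<le> x \<and> x < u m" if "b x \<noteq> 0" for x
    using blocks_lincomb_support[OF f that[unfolded b_def], of 0 m] F lessThan_atLeast0 by metis
  have c1: "\<bar>c i\<bar> \<le> 1" if "i \<in> F" for i
  proof -
    have "\<bar>c i\<bar> powr q \<le> (\<Sum>i\<in>F. \<bar>c i\<bar> powr q)" using that finF by (intro member_le_sum) auto
    then have "\<bar>c i\<bar> powr q \<le> 1" using c by linarith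
    then have "(\<bar>c i\<bar> powr q) powr (1/q) \<le> 1 powr (1/q)" using q0 by (intro powr_mono2) auto
    then show ?thesis using q0 by (simp add: powr_powr)
  qed
  have small: "\<bar>b x\<bar> \<le> \<tau>" for x
  proof (cases "b x = 0")
    case False
    then obtain i where i: "i < m" "x \<in> {u i..<u (Suc i)}" using cut_cover[OF um, of x m] supp[of x] by blast
    have bx: "b x = (if i \<in> F then c i * f i x else 0)"
      unfolding b_def using i by (intro blocks_lincomb_apply[OF f finF]) auto
    then have iF: "i \<in> F" using False by presburger
    then have "\<bar>b x\<bar> = \<bar>c i\<bar> * \<bar>f i x\<bar>" using bx by (simp add: abs_mult)
    also have "\<dots> \<le> 1 * \<tau>" unfolding \<tau>_def using c1[OF iF] flat[OF iF] by (intro mult_mono) auto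
    finally show ?thesis by simp
  qed (use \<tau>0 in simp)
  obtain n t where t: "mono t" "t 0 = 0" "t (Suc n) = u m" "\<And>j. j \<le> n \<Longrightarrow> D (cut t j b) \<le> 2 * \<tau>"
    "\<And>j. j < n \<Longrightarrow> D (cut t j b) > \<tau>" using greedy_cuts[OF bTD small, where K="u m"] by blast
  have cell: "D (cut u i b) \<le> (if i \<in> F then \<bar>c i\<bar> else 0)" for i
  proof -
    have "D (cut u i b) = \<bar>if i \<in> F then c i else 0\<bar> * D (f i)"
      unfolding b_def blocks_cut_lincomb[OF f finF] by (rule D_scale[OF blocks_TD[OF f]])
    then show ?thesis using D1[of i] by (cases "i \<in> F") (auto simp: mult_left_le)
  qed
  have cardJ: "real (card (cells t u n i)) \<le> real m * (2 * CU) powr q * (if i \<in> F then \<bar>c i\<bar> powr q else 0)" for i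
  proof -
    have "real (card (cells t u n i)) * \<tau> powr q = (\<Sum>j\<in>cells t u n i. \<tau> powr q)" by simp
    also have "\<dots> \<le> (\<Sum>j\<in>cells t u n i. D (cut t j (cut u i b)) powr q)"
    proof (intro sum_mono powr_mono2)
      fix j assume j: "j \<in> cells t u n i"
      then have "cut t j (cut u i b) = cut t j b" unfolding restr_restr cells_def by (auto simp: Int_absorb2)
      then show "\<tau> \<le> D (cut t j (cut u i b))" using t(5)[of j] j by (simp add: cells_def)
    qed (use q0 \<tau>0 in auto)
    also have "\<dots> \<le> (2 * CU * D (cut u i b)) powr q"
      by (intro D_lower_estimate D_restr bTD t finite_cells)
    also have "\<dots> \<le> (2 * CU * (if i \<in> F then \<bar>c i\<bar> else 0)) powr q"
      using cell CU_ge1 q0 D_nonneg[OF D_restr(1)[OF bTD]] by (intro powr_mono2 mult_left_mono) auto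
    also have "\<dots> = (2 * CU) powr q * (if i \<in> F then \<bar>c i\<bar> powr q else 0)"
      using CU_ge1 by (simp add: powr_mult)
    finally have "real (card (cells t u n i)) / real m \<le> (2 * CU) powr q * (if i \<in> F then \<bar>c i\<bar> powr q else 0)"
      unfolding \<tau>q by simp
    then show ?thesis using m by (simp add: pos_divide_le_eq mult_ac)
  qed
  have sumJ: "real (\<Sum>i<m. card (cells t u n i)) \<le> real m * (2 * CU) powr q"
  proof -
    have "real (\<Sum>i<m. card (cells t u n i)) \<le> (\<Sum>i<m. real m * (2 * CU) powr q * (if i \<in> F then \<bar>c i\<bar> powr q else 0))"
      using cardJ by (simp add: sum_mono)
    also have "\<dots> = real m * (2 * CU) powr q * (\<Sum>i\<in>{..<m} \<inter> F. \<bar>c i\<bar> powr q)"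
      unfolding sum_distrib_left[symmetric] by (subst sum.inter_restrict) auto
    also have "{..<m} \<inter> F = F" using F by auto
    also have "real m * (2 * CU) powr q * (\<Sum>i\<in>F. \<bar>c i\<bar> powr q) \<le> real m * (2 * CU) powr q * 1"
      using c by (intro mult_left_mono) auto
    finally show ?thesis by simp
  qed
  define R where "R = {..<n} - (\<Union>i<m. cells t u n i)"
  \<comment> \<open>A piece of positive norm inside no single block contains the left end of one.
    Disjointness of the pieces then makes the choice of that block injective.\<close>
  have ex: "\<exists>k<m. u k \<in> {t j..<t (Suc j)}" if "j \<in> R" for j
  proof -
    have jn: "j < n" using that by (simp add: R_def)
    have "D (cut t j b) > 0" using t(5)[OF jn] \<tau>0 by simp
    then have "cut t j b \<noteq> (\<lambda>i. 0)" by auto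
    then obtain x where "cut t j b x \<noteq> 0" by blast
    then have x: "x \<in> {t j..<t (Suc j)}" "b x \<noteq> 0" by (auto simp: restr_apply split: if_splits)
    then obtain i where i: "i < m" "x \<in> {u i..<u (Suc i)}" using cut_cover[OF um, of x m] supp[of x] by blast
    have "j \<notin> cells t u n i" using that i by (auto simp: R_def)
    then have "\<not> {t j..<t (Suc j)} \<subseteq> {u i..<u (Suc i)}" using jn x by (auto simp: cells_def)
    then have "t j < u i \<or> u (Suc i) < t (Suc j)" by (rule contrapos_np) (auto simp: not_less)
    then show ?thesis
    proof
      assume "t j < u i" then show ?thesis using i x by (intro exI[of _ i]) auto
    next
      assume *: "u (Suc i) < t (Suc j)"
      have "t (Suc j) \<le> u m" using jn t(1,3) by (metis Suc_leI Suc_le_mono less_imp_le monoD)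
      then have "u (Suc i) < u m" using * by simp
      then have "Suc i < m" using um by (meson leD leI monoD)
      then show ?thesis using * i x by (intro exI[of _ "Suc i"]) auto
    qed
  qed
  then obtain \<phi> where \<phi>: "\<And>j. j \<in> R \<Longrightarrow> \<phi> j < m \<and> u (\<phi> j) \<in> {t j..<t (Suc j)}" by metis
  have "inj_on \<phi> R"
  proof (rule inj_onI)
    fix j k assume "j \<in> R" "k \<in> R" "\<phi> j = \<phi> k"
    then show "j = k" using \<phi>[of j] \<phi>[of k] mono_cut_unique[OF t(1), of "u (\<phi> j)" j k] by simp
  qed
  then have cardR: "card R \<le> m" using \<phi> card_inj_on_le[of \<phi> R "{..<m}"] by auto
  have "n = card {..<n}" by simp
  also have "\<dots> \<le> card (R \<union> (\<Union>i<m. cells t u n i))"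
    by (intro card_mono finite_UnI finite_UN_I) (auto simp: R_def finite_cells)
  also have "\<dots> \<le> card R + card (\<Union>i<m. cells t u n i)" by (rule card_Un_le)
  also have "card (\<Union>i<m. cells t u n i) \<le> (\<Sum>i<m. card (cells t u n i))" by (rule card_UN_le) simp
  finally have "n \<le> m + (\<Sum>i<m. card (cells t u n i))" using cardR by simp
  then have "real n \<le> real m + real (\<Sum>i<m. card (cells t u n i))" by linarith
  \<comment> \<open>The extra 1 counts the last greedy piece; \<open>m \<ge> 1\<close> absorbs
    it.\<close>
  then have "real (Suc n) \<le> 1 + real m + real m * (2 * CU) powr q" using sumJ by simp
  also have "\<dots> \<le> real m * (2 + (2 * CU) powr q)" using m by (simp add: distrib_left)
  finally have n: "real (Suc n) \<le> real m * (2 + (2 * CU) powr q)" .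
  have "D b \<le> rt (Suc n) * (2 * \<tau>) / \<gamma>"
  proof (rule D_cut_upper[OF t(1)])
    fix x assume "b x \<noteq> 0" then show "t 0 \<le> x \<and> x < t (Suc n)" using supp t(2,3) by simp
  qed (use t(4) \<tau>0 in auto)
  also have "\<dots> \<le> (real m * (2 + (2 * CU) powr q)) powr (1/q) * (2 * \<tau>) / \<gamma>"
    using n \<gamma>0 \<tau>0 q0 by (intro divide_right_mono mult_right_mono powr_mono2) auto
  also have "\<dots> = CS"
  proof -
    have one: "rt m * \<tau> = 1" using m by (simp add: \<tau>_def powr_minus_divide)
    have "(real m * (2 + (2 * CU) powr q)) powr (1/q) * (2 * \<tau>)
        = 2 * (rt m * \<tau>) * (2 + (2 * CU) powr q) powr (1/q)"
      unfolding powr_mult by (simp only: mult_ac)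
    also have "\<dots> = 2 * (2 + (2 * CU) powr q) powr (1/q)" unfolding one by simp
    finally have "(real m * (2 + (2 * CU) powr q)) powr (1/q) * (2 * \<tau>) = 2 * (2 + (2 * CU) powr q) powr (1/q)" .
    then show ?thesis by (simp add: CS_def)
  qed
  finally show ?thesis unfolding b_def .
qed

lemma CS_pos: "CS > 0" proof -
  have "2 + (2 * CU) powr q > 0" by (simp add: add_pos_nonneg)
  then show ?thesis unfolding CS_def using \<gamma>0 by simp
qed

subsection \<open>Convergent series in the dual\<close>

text \<open>Speaks of finite sections only, so that norm inequalities between finite combinations
  transfer convergence directly.\<close>

definition cauchy_series :: "(nat \<Rightarrow> nat \<Rightarrow> real) \<Rightarrow> (nat \<Rightarrow> real) \<Rightarrow> bool" where
  "cauchy_series x a \<longleftrightarrow> (\<forall>\<epsilon>>0. \<exists>M. \<forall>m n. M \<le> m \<longrightarrow> m \<le> n \<longrightarrow> D (lincomb x a {m..<n}) < \<epsilon>)"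

lemma psum_lincomb: "psum x a n = lincomb x a {..<n}"
  by (simp add: psum_def lincomb_def)

lemma lincomb_diff:
  assumes "m \<le> n" shows "lincomb x a {m..<n} = (\<lambda>i. psum x a n i - psum x a m i)"
proof
  fix i
  have "{..<n} = {..<m} \<union> {m..<n}" using assms by auto
  then have "psum x a n i = psum x a m i + lincomb x a {m..<n} i"
    unfolding psum_def lincomb_def by (simp add: sum.union_disjoint ivl_disj_int)
  then show "lincomb x a {m..<n} i = psum x a n i - psum x a m i" by simp
qed

lemma pairing_tendsto:
  assumes "a \<in> c00" "\<And>i. (\<lambda>n. b n i) \<longlonglongrightarrow> b' i"
  shows "(\<lambda>n. pairing (b n) a) \<longlonglongrightarrow> pairing b' a"
  unfolding pairing_def by (intro tendsto_intros assms)

text \<open>Completeness of the dual: the coordinates of the partial sums are Cauchy because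
  \<open>D\<close> dominates them, and since test vectors have finite support, norm bounds pass to
  the coordinatewise limit.\<close>

lemma series_conv_iff:
  assumes x: "\<And>j. x j \<in> TD"
  shows "series_conv p \<gamma> x a \<longleftrightarrow> cauchy_series x a"
proof
  have P: "psum x a n \<in> TD" for n unfolding psum_lincomb by (intro D_lincomb x)
  {
    assume "series_conv p \<gamma> x a"
    then obtain y where y: "y \<in> TD" "(\<lambda>n. D (\<lambda>i. y i - psum x a n i)) \<longlonglongrightarrow> 0"
      by (auto simp: series_conv_def series_to_def)
    show "cauchy_series x a" unfolding cauchy_series_def
    proof (intro allI impI)
      fix \<epsilon> :: real assume \<epsilon>: "\<epsilon> > 0"
      then obtain M where M: "\<And>n. n \<ge> M \<Longrightarrow> D (\<lambda>i. y i - psum x a n i) < \<epsilon> / 2"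
        using order_tendstoD(2)[OF y(2), of "\<epsilon> / 2"] by (auto simp: eventually_sequentially)
      have "D (lincomb x a {m..<n}) < \<epsilon>" if "M \<le> m" "m \<le> n" for m n
      proof -
        have "lincomb x a {m..<n} = (\<lambda>i. (y i - psum x a m i) - (y i - psum x a n i))"
          unfolding lincomb_diff[OF that(2)] by simp
        then have "D (lincomb x a {m..<n}) \<le> D (\<lambda>i. y i - psum x a m i) + D (\<lambda>i. y i - psum x a n i)"
          by (simp only:) (intro D_diff y P)
        then show ?thesis using M[of m] M[of n] that by simp
      qed
      then show "\<exists>M. \<forall>m n. M \<le> m \<longrightarrow> m \<le> n \<longrightarrow> D (lincomb x a {m..<n}) < \<epsilon>" by blast
    qed
  }
  {
    assume C: "cauchy_series x a"
    have "Cauchy (\<lambda>n. psum x a n i)" for i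
    proof (rule CauchyI')
      fix \<epsilon> :: real assume "\<epsilon> > 0"
      then obtain M where M: "\<And>m n. M \<le> m \<Longrightarrow> m \<le> n \<Longrightarrow> D (lincomb x a {m..<n}) < \<epsilon>"
        using C unfolding cauchy_series_def by meson
      have "dist (psum x a m i) (psum x a n i) < \<epsilon>" if "M \<le> m" "m < n" for m n
      proof -
        have "\<bar>lincomb x a {m..<n} i\<bar> \<le> D (lincomb x a {m..<n})" by (intro D_abs_le D_lincomb x)
        then show ?thesis using M[of m n] that by (simp add: lincomb_diff dist_real_def abs_minus_commute)
      qed
      then show "\<exists>M. \<forall>m\<ge>M. \<forall>n>m. dist (psum x a m i) (psum x a n i) < \<epsilon>" by blast
    qed
    then have "\<forall>i. \<exists>y. (\<lambda>n. psum x a n i) \<longlonglongrightarrow> y" by (simp add: Cauchy_convergent_iff convergent_def)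
    then obtain y where y: "\<And>i. (\<lambda>n. psum x a n i) \<longlonglongrightarrow> y i" by metis
    have close: "(\<lambda>i. y i - psum x a m i) \<in> TD \<and> D (\<lambda>i. y i - psum x a m i) \<le> \<epsilon>"
      if M: "\<And>n. m \<le> n \<Longrightarrow> D (lincomb x a {m..<n}) < \<epsilon>" for m \<epsilon>
    proof -
      have bound: "pairing (\<lambda>i. y i - psum x a m i) c \<le> \<epsilon>" if c: "c \<in> c00" "N c \<le> 1" for c
      proof (rule LIMSEQ_le_const2)
        show "(\<lambda>n. pairing (\<lambda>i. psum x a n i - psum x a m i) c) \<longlonglongrightarrow> pairing (\<lambda>i. y i - psum x a m i) c"
          by (intro pairing_tendsto c tendsto_diff y tendsto_const)
        have "pairing (\<lambda>i. psum x a n i - psum x a m i) c \<le> \<epsilon>" if "n \<ge> m" for n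
        proof -
          have "pairing (lincomb x a {m..<n}) c \<le> D (lincomb x a {m..<n})"
            by (intro D_upper D_lincomb x c)
          then show ?thesis using M[OF that] by (simp add: lincomb_diff[OF that])
        qed
        then show "\<exists>n0. \<forall>n\<ge>n0. pairing (\<lambda>i. psum x a n i - psum x a m i) c \<le> \<epsilon>" by blast
      qed
      show ?thesis using dualI[OF bound] by blast
    qed
    have yTD: "y \<in> TD"
    proof -
      obtain M where "\<And>n. M \<le> n \<Longrightarrow> D (lincomb x a {M..<n}) < 1"
        using C unfolding cauchy_series_def by (meson order_refl zero_less_one)
      then have "(\<lambda>i. (y i - psum x a M i) + psum x a M i) \<in> TD" using close P by (intro D_add) blast+
      then show ?thesis by simp
    qed
    have "(\<lambda>n. D (\<lambda>i. y i - psum x a n i)) \<longlonglongrightarrow> 0"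
    proof (rule LIMSEQ_I)
      fix r :: real assume "r > 0"
      then have "r / 2 > 0" by simp
      then obtain M where M: "\<And>m n. M \<le> m \<Longrightarrow> m \<le> n \<Longrightarrow> D (lincomb x a {m..<n}) < r / 2"
        using C unfolding cauchy_series_def by meson
      have "norm (D (\<lambda>i. y i - psum x a n i) - 0) < r" if "n \<ge> M" for n
        using close[of n "r / 2"] M[OF that] D_nonneg[of "\<lambda>i. y i - psum x a n i"] \<open>r > 0\<close> by force
      then show "\<exists>no. \<forall>n\<ge>no. norm (D (\<lambda>i. y i - psum x a n i) - 0) < r" by blast
    qed
    then show "series_conv p \<gamma> x a" using yTD by (auto simp: series_conv_def series_to_def)
  }
qed

lemma cauchy_series_terms:
  assumes "cauchy_series x a" "\<And>j. x j \<in> TD" shows "(\<lambda>j. \<bar>a j\<bar> * D (x j)) \<longlonglongrightarrow> 0"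
proof (rule LIMSEQ_I)
  fix r :: real assume "r > 0"
  then obtain M where M: "\<And>m n. M \<le> m \<Longrightarrow> m \<le> n \<Longrightarrow> D (lincomb x a {m..<n}) < r"
    using assms(1) unfolding cauchy_series_def by meson
  have "norm (\<bar>a j\<bar> * D (x j) - 0) < r" if "j \<ge> M" for j
  proof -
    have "lincomb x a {j..<Suc j} = (\<lambda>i. a j * x j i)" by (simp add: lincomb_def)
    then show ?thesis using M[of j "Suc j"] that D_scale[OF assms(2), of "a j" j] D_nonneg[OF assms(2), of j] by simp
  qed
  then show "\<exists>no. \<forall>n\<ge>no. norm (\<bar>a n\<bar> * D (x n) - 0) < r" by blast
qed

lemma cauchy_series_summable:
  assumes "summable (\<lambda>j. \<bar>a j\<bar> * D (x j))" "\<And>j. x j \<in> TD" shows "cauchy_series x a"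
  unfolding cauchy_series_def
proof (intro allI impI)
  fix \<epsilon> :: real assume "\<epsilon> > 0"
  then obtain M where M: "\<And>m n. m \<ge> M \<Longrightarrow> norm (\<Sum>j\<in>{m..<n}. \<bar>a j\<bar> * D (x j)) < \<epsilon>"
    using assms(1) unfolding summable_Cauchy by meson
  have "D (lincomb x a {m..<n}) < \<epsilon>" if "M \<le> m" for m n
    using D_lincomb(2)[where y=x and F="{m..<n}" and c=a, OF assms(2)] M[OF that, of n] by simp
  then show "\<exists>M. \<forall>m n. M \<le> m \<longrightarrow> m \<le> n \<longrightarrow> D (lincomb x a {m..<n}) < \<epsilon>" by blast
qed

lemma cauchy_series_add:
  assumes "cauchy_series x a" "cauchy_series y a" "\<And>j. x j \<in> TD" "\<And>j. y j \<in> TD"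
  shows "cauchy_series (\<lambda>j i. x j i + y j i) a"
  unfolding cauchy_series_def
proof (intro allI impI)
  fix \<epsilon> :: real assume "\<epsilon> > 0"
  then have "\<epsilon> / 2 > 0" by simp
  then obtain M1 M2 where M: "\<And>m n. M1 \<le> m \<Longrightarrow> m \<le> n \<Longrightarrow> D (lincomb x a {m..<n}) < \<epsilon> / 2"
    "\<And>m n. M2 \<le> m \<Longrightarrow> m \<le> n \<Longrightarrow> D (lincomb y a {m..<n}) < \<epsilon> / 2"
    using assms(1,2) unfolding cauchy_series_def by meson
  have "D (lincomb (\<lambda>j i. x j i + y j i) a {m..<n}) < \<epsilon>" if "max M1 M2 \<le> m" "m \<le> n" for m n
  proof -
    have "lincomb (\<lambda>j i. x j i + y j i) a {m..<n} = (\<lambda>i. lincomb x a {m..<n} i + lincomb y a {m..<n} i)"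
      by (simp add: lincomb_def distrib_left sum.distrib)
    then have "D (lincomb (\<lambda>j i. x j i + y j i) a {m..<n}) \<le> D (lincomb x a {m..<n}) + D (lincomb y a {m..<n})"
      by (simp only:) (intro D_add D_lincomb assms)
    then show ?thesis using M(1)[of m n] M(2)[of m n] that by simp
  qed
  then show "\<exists>M. \<forall>m n. M \<le> m \<longrightarrow> m \<le> n \<longrightarrow> D (lincomb (\<lambda>j i. x j i + y j i) a {m..<n}) < \<epsilon>" by blast
qed

lemma cauchy_series_perturb:
  assumes "cauchy_series x a" "\<And>j. x j \<in> TD" "\<And>j. y j \<in> TD"
    and s: "summable (\<lambda>j. D (\<lambda>i. y j i - x j i))" and a: "\<And>j. \<bar>a j\<bar> \<le> B"
  shows "cauchy_series y a"
proof -
  have d: "(\<lambda>i. y j i - x j i) \<in> TD" for j using assms by (intro D_diff)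
  have "cauchy_series (\<lambda>j i. y j i - x j i) a"
  proof (rule cauchy_series_summable[OF _ d])
    show "summable (\<lambda>j. \<bar>a j\<bar> * D (\<lambda>i. y j i - x j i))"
      using a D_nonneg[OF d] by (intro summable_comparison_test'[OF summable_mult[OF s, of B]]) (auto simp: mult_right_mono)
  qed
  then have "cauchy_series (\<lambda>j i. x j i + (y j i - x j i)) a" using assms d by (intro cauchy_series_add) auto
  then show ?thesis by simp
qed

lemma cauchy_series_dominated:
  assumes "cauchy_series x a" "C > 0" "\<And>m n. m \<le> n \<Longrightarrow> D (lincomb y a {m..<n}) \<le> C * D (lincomb x a {m..<n})"
  shows "cauchy_series y a"
  unfolding cauchy_series_def
proof (intro allI impI)
  fix \<epsilon> :: real assume "\<epsilon> > 0"
  then have "\<epsilon> / C > 0" using assms(2) by simp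
  then obtain M where M: "\<And>m n. M \<le> m \<Longrightarrow> m \<le> n \<Longrightarrow> D (lincomb x a {m..<n}) < \<epsilon> / C"
    using assms(1) unfolding cauchy_series_def by meson
  have "D (lincomb y a {m..<n}) < \<epsilon>" if "M \<le> m" "m \<le> n" for m n
    using assms(3)[OF that(2)] M[OF that] assms(2) by (simp add: pos_less_divide_eq mult.commute)
  then show "\<exists>M. \<forall>m n. M \<le> m \<longrightarrow> m \<le> n \<longrightarrow> D (lincomb y a {m..<n}) < \<epsilon>" by blast
qed

text \<open>The convergence half of the gluing arguments. The bound is asked for all subsets of a
  piece because a section \<open>{m..<n}\<close> may begin and end in the middle of pieces.\<close>

lemma cauchy_series_pieces:
  assumes x: "\<And>j. x j \<in> TD" and l: "strict_mono l" "l 0 = 0"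
    and w: "summable w" "\<And>k. w k \<ge> 0"
    and B: "\<And>k F. F \<subseteq> {l k..<l (Suc k)} \<Longrightarrow> D (lincomb x a F) \<le> w k"
  shows "cauchy_series x a"
  unfolding cauchy_series_def
proof (intro allI impI)
  fix \<epsilon> :: real assume "\<epsilon> > 0"
  then obtain K where K: "\<And>m n. m \<ge> K \<Longrightarrow> norm (\<Sum>k\<in>{m..<n}. w k) < \<epsilon>"
    using w(1) unfolding summable_Cauchy by meson
  have lm: "mono l" using l(1) by (rule strict_mono_mono)
  have "D (lincomb x a {m..<n}) < \<epsilon>" if mn: "l K \<le> m" "m \<le> n" for m n
  proof -
    define F where "F = (\<lambda>k. {m..<n} \<inter> {l k..<l (Suc k)})"
    have "{m..<n} = (\<Union>k\<in>{K..<K + n}. F k)"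
    proof
      show "{m..<n} \<subseteq> (\<Union>k\<in>{K..<K + n}. F k)"
      proof
        fix j assume j: "j \<in> {m..<n}"
        have "j < l (Suc j)" using strict_mono_imp_increasing[OF l(1), of "Suc j"] by simp
        then obtain k where k: "k < Suc j" "j \<in> {l k..<l (Suc k)}" using cut_cover[OF lm, of j "Suc j"] l(2) by auto
        have "K \<le> k"
        proof (rule ccontr)
          assume "\<not> K \<le> k" then have "l (Suc k) \<le> l K" using lm by (simp add: monoD)
          then show False using k j mn by auto
        qed
        then show "j \<in> (\<Union>k\<in>{K..<K + n}. F k)" using k j by (auto simp: F_def)
      qed
    qed (auto simp: F_def)
    then have "lincomb x a {m..<n} = lincomb (\<lambda>k. lincomb x a (F k)) (\<lambda>_. 1) {K..<K + n}"
      unfolding lincomb_def using mono_cut_unique[OF lm]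
      by (intro ext) (simp, subst sum.UNION_disjoint, auto simp: F_def)
    then have "D (lincomb x a {m..<n}) \<le> (\<Sum>k\<in>{K..<K + n}. \<bar>1\<bar> * D (lincomb x a (F k)))"
      by (simp only:) (intro D_lincomb x)
    also have "\<dots> \<le> (\<Sum>k\<in>{K..<K + n}. w k)" using B by (intro sum_mono) (simp add: F_def)
    also have "\<dots> < \<epsilon>" using K[of K "K + n"] by simp
    finally show ?thesis .
  qed
  then show "\<exists>M. \<forall>m n. M \<le> m \<longrightarrow> m \<le> n \<longrightarrow> D (lincomb x a {m..<n}) < \<epsilon>" by blast
qed

section \<open>The biorthogonal functionals form a subsymmetric basis\<close>

lemma D_le_subset_estar:
  assumes "F \<subseteq> G" "finite G" shows "D (lincomb estar a F) \<le> D (lincomb estar a G)"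
proof (rule D_mono)
  show "lincomb estar a G \<in> TD" by (intro D_lincomb D_estar)
  have "finite F" using assms finite_subset by blast
  then show "\<bar>lincomb estar a F i\<bar> \<le> \<bar>lincomb estar a G i\<bar>" for i
    using assms by (auto simp: lincomb_estar)
qed

text \<open>The coefficients of \<open>y\<close> are its own coordinates: \<open>D_tail\<close>
  gives convergence, and control of coordinates by \<open>D\<close> gives uniqueness.\<close>

lemma basic_estar: "basic p \<gamma> estar"
  unfolding basic_def
proof (intro conjI allI ballI)
  fix y assume "y \<in> cspan p \<gamma> estar"
  then have y: "y \<in> TD" by (simp add: cspan_def)
  show "\<exists>!a. series_to p \<gamma> estar a y"
  proof (rule ex1I)
    have "(\<lambda>i. y i - psum estar y n i) = restr {n..} y" for n
      unfolding psum_lincomb by (auto simp: lincomb_estar restr_def)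
    moreover have "(\<lambda>n. D (restr {n..} y)) \<longlonglongrightarrow> 0"
    proof (rule LIMSEQ_I)
      fix r :: real assume "r > 0"
      then show "\<exists>no. \<forall>n\<ge>no. norm (D (restr {n..} y) - 0) < r"
        using D_tail[OF y] D_nonneg[OF D_restr(1)[OF y]] by simp
    qed
    ultimately show "series_to p \<gamma> estar y y" using y by (simp add: series_to_def)
  next
    fix a assume a: "series_to p \<gamma> estar a y"
    show "a = y"
    proof
      fix i
      have "(\<lambda>n. D (\<lambda>i. y i - psum estar a n i)) \<longlonglongrightarrow> 0" using a by (simp add: series_to_def)
      moreover have "\<bar>y i - a i\<bar> \<le> D (\<lambda>i. y i - psum estar a n i)" if "n \<ge> Suc i" for n
      proof -
        have "(\<lambda>i. y i - psum estar a n i) \<in> TD" unfolding psum_lincomb by (intro D_diff y D_lincomb D_estar)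
        from D_abs_le[OF this, of i] show ?thesis using that by (simp add: psum_lincomb lincomb_estar)
      qed
      then have "\<forall>n\<ge>Suc i. \<bar>y i - a i\<bar> \<le> D (\<lambda>i. y i - psum estar a n i)" by blast
      ultimately have "\<bar>y i - a i\<bar> \<le> 0" by (intro LIMSEQ_le_const) blast+
      then show "a i = y i" by simp
    qed
  qed
qed (rule D_estar)

lemma unconditional_estar: "unconditional p \<gamma> estar"
  unfolding unconditional_def
proof (intro conjI basic_estar allI impI)
  fix a and \<sigma> :: "nat \<Rightarrow> nat" assume \<sigma>: "bij \<sigma>" and "series_conv p \<gamma> estar a"
  then have C: "cauchy_series estar a" using series_conv_iff D_estar by simp
  have "cauchy_series (estar \<circ> \<sigma>) (a \<circ> \<sigma>)" unfolding cauchy_series_def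
  proof (intro allI impI)
    fix \<epsilon> :: real assume "\<epsilon> > 0"
    then obtain M where M: "\<And>m n. M \<le> m \<Longrightarrow> m \<le> n \<Longrightarrow> D (lincomb estar a {m..<n}) < \<epsilon>"
      using C unfolding cauchy_series_def by meson
    have inj: "inj \<sigma>" using \<sigma> by (rule bij_is_inj)
    have "finite (\<sigma> -` {..<M})" using inj by (intro finite_vimageI) auto
    then obtain M' where M': "\<And>j. \<sigma> j < M \<Longrightarrow> j < M'" by (auto simp: finite_nat_set_iff_bounded)
    have "D (lincomb (estar \<circ> \<sigma>) (a \<circ> \<sigma>) {m..<n}) < \<epsilon>" if "M' \<le> m" for m n
    proof -
      have "lincomb (estar \<circ> \<sigma>) (a \<circ> \<sigma>) {m..<n} = lincomb estar a (\<sigma> ` {m..<n})"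
        unfolding lincomb_def using inj by (subst sum.reindex) (auto intro: inj_on_subset)
      moreover obtain K where K: "\<sigma> ` {m..<n} \<subseteq> {..<K}"
        using finite_nat_iff_bounded[of "\<sigma> ` {m..<n}"] by auto
      moreover have "\<sigma> ` {m..<n} \<subseteq> {M..<max K M}" using K M' that by (fastforce simp: not_less[symmetric])
      then have "D (lincomb estar a (\<sigma> ` {m..<n})) \<le> D (lincomb estar a {M..<max K M})"
        by (rule D_le_subset_estar) simp
      ultimately show ?thesis using M[of M "max K M"] by simp
    qed
    then show "\<exists>M. \<forall>m n. M \<le> m \<longrightarrow> m \<le> n \<longrightarrow> D (lincomb (estar \<circ> \<sigma>) (a \<circ> \<sigma>) {m..<n}) < \<epsilon>" by blast
  qed
  then show "series_conv p \<gamma> (estar \<circ> \<sigma>) (a \<circ> \<sigma>)" using series_conv_iff D_estar by simp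
qed

lemma blocks_estar: "strict_mono h \<Longrightarrow> blocks h (estar \<circ> h)"
  by (auto simp: blocks_def estar_def strict_mono_mono strict_mono_Suc_iff split: if_splits)

text \<open>One direction is \<open>D_spread\<close>; for the other, a subsequence of the unit
  vectors is itself a block sequence, so \<open>D_domination\<close> applies.\<close>

lemma cauchy_estar_subseq:
  assumes h: "strict_mono h" shows "cauchy_series (estar \<circ> h) a \<longleftrightarrow> cauchy_series estar a"
proof
  assume "cauchy_series (estar \<circ> h) a"
  then show "cauchy_series estar a" by (rule cauchy_series_dominated[of _ _ 1]) (auto simp: D_spread[OF h])
next
  assume C: "cauchy_series estar a"
  have dom: "D (lincomb (estar \<circ> h) a {m..<n}) \<le> 1 * D (lincomb estar a {m..<n})" for m n
    by (rule D_domination[OF h blocks_estar[OF h]]) (auto simp: D_estar)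
  show "cauchy_series (estar \<circ> h) a" by (rule cauchy_series_dominated[OF C zero_less_one dom])
qed

lemma subsymmetric_estar: "subsymmetric p \<gamma> estar"
  unfolding subsymmetric_def equivalent_def
proof (intro conjI unconditional_estar allI impI)
  fix f :: "nat \<Rightarrow> nat" and a assume f: "strict_mono f"
  have "series_conv p \<gamma> estar a \<longleftrightarrow> cauchy_series estar a" by (rule series_conv_iff[OF D_estar(1)])
  moreover have "series_conv p \<gamma> (estar \<circ> f) a \<longleftrightarrow> cauchy_series (estar \<circ> f) a" by (rule series_conv_iff) (simp add: D_estar)
  ultimately show "series_conv p \<gamma> estar a \<longleftrightarrow> series_conv p \<gamma> (estar \<circ> f) a" using cauchy_estar_subseq[OF f] by simp
qed

end

section \<open>Failure of upper \<open>q\<close>-estimates in the dual\<close>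

context tirilman_small
begin

text \<open>Nearly norming vectors of the \<open>f j\<close> are blocks, so they have a combination
  of \<open>p\<close>-mass 1 and tiny norm. With coefficients \<open>c j powr (p - 1)\<close>, which
  have \<open>q\<close>-mass 1, the pairing of the two combinations is at least
  \<open>c0 / 2\<close>; hence the dual norm is huge.\<close>

lemma no_upper_q_estimate:
  assumes f: "blocks u f" and c0: "c0 > 0" "\<And>j. D (f j) \<ge> c0" and K: "K > 0"
  obtains b F where "finite F" "F \<subseteq> {L..}" "\<And>j. b j \<ge> 0" "(\<Sum>j\<in>F. b j powr q) = 1" "D (lincomb f b F) \<ge> K"
proof -
  have fTD: "f j \<in> TD" for j using blocks_TD[OF f] .
  have "\<exists>a. a \<in> c00 \<and> N a \<le> 1 \<and> c0 / 2 \<le> pairing (f j) a" for j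
  proof -
    obtain a where "a \<in> c00" "N a \<le> 1" "D (f j) / 2 \<le> pairing (f j) a" using D_half_attained[OF fTD] .
    then show ?thesis using c0(2)[of j] by (intro exI[of _ a]) auto
  qed
  then obtain \<alpha> where \<alpha>: "\<And>j. \<alpha> j \<in> c00" "\<And>j. N (\<alpha> j) \<le> 1" "\<And>j. c0 / 2 \<le> pairing (f j) (\<alpha> j)" by metis
  define y where "y = (\<lambda>j. cut u j (\<alpha> j))"
  have um: "mono u" using blocks_mono[OF f] .
  have y: "blocks u y" using um by (auto simp: blocks_def y_def restr_def split: if_splits)
  have N1: "N (y j) \<le> 1" for j using N_restr_le[OF \<alpha>(1)] \<alpha>(2) order_trans unfolding y_def by blast
  have fcut: "cut u j (f j) = f j" for j using f unfolding blocks_def by (intro ext) (auto simp: restr_apply)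
  have fy: "pairing (f j) (y j) \<ge> c0 / 2" for j
    using \<alpha>(3)[of j] pairing_restr[OF \<alpha>(1), of "{u j..<u (Suc j)}" "f j" j] unfolding y_def fcut by simp
  have \<epsilon>: "c0 / 2 / K > 0" using c0 K by simp
  obtain F c where cF: "finite F" "F \<subseteq> {L..}" "\<And>j. c j \<ge> 0" "(\<Sum>j\<in>F. c j powr p) = 1"
    "N (lincomb y c F) \<le> c0 / 2 / K" by (rule no_lower_p_estimate[OF y N1 \<epsilon>, of L]) (rule that)
  define b where "b = (\<lambda>j. c j powr (p - 1))"
  have bq: "b j powr q = c j powr p" for j by (simp add: b_def powr_powr conj_exp_mult)
  have bc: "b j * c j = c j powr p" for j
  proof (cases "c j = 0")
    case False
    then have "b j * c j = c j powr (p - 1) * c j powr 1" using cF(3)[of j] by (simp add: b_def)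
    also have "\<dots> = c j powr p" by (subst powr_add[symmetric]) simp
    finally show ?thesis .
  qed (simp add: b_def)
  have cc: "lincomb y c F \<in> c00" by (intro c00_lincomb blocks_c00[OF y])
  have "c0 / 2 = (\<Sum>j\<in>F. c j powr p * (c0 / 2))" by (subst sum_distrib_right[symmetric]) (simp add: cF)
  also have "\<dots> \<le> (\<Sum>j\<in>F. b j * pairing (f j) (lincomb y c F))"
  proof (rule sum_mono)
    fix j assume j: "j \<in> F"
    have "pairing (f j) (lincomb y c F) = pairing (f j) (cut u j (lincomb y c F))"
      using pairing_restr[OF cc, of "{u j..<u (Suc j)}" "f j"] unfolding fcut .
    also have "\<dots> = c j * pairing (f j) (y j)"
      unfolding blocks_cut_lincomb[OF y cF(1)] using j by (simp add: pairing_scale)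
    finally have "b j * pairing (f j) (lincomb y c F) = c j powr p * pairing (f j) (y j)" using bc[of j] by (simp add: mult_ac)
    then show "c j powr p * (c0 / 2) \<le> b j * pairing (f j) (lincomb y c F)" using mult_left_mono[OF fy[of j], of "c j powr p"] by simp
  qed
  also have "\<dots> = pairing (lincomb f b F) (lincomb y c F)" by (simp add: pairing_lincomb)
  also have "\<dots> \<le> D (lincomb f b F) * N (lincomb y c F)" by (intro pairing_le D_lincomb fTD cc)
  also have "\<dots> \<le> D (lincomb f b F) * (c0 / 2 / K)"
    using cF(5) by (intro mult_left_mono D_nonneg D_lincomb fTD)
  finally have "D (lincomb f b F) \<ge> K" using c0 K by (simp add: field_simps)
  then show thesis using that[of F b] cF(1,2) bq cF(4) by (simp add: b_def)
qed

end

subsection \<open>Rearrangements and asymmetry\<close>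

lemma subseq_choice:
  assumes "\<And>j L. \<exists>n\<ge>L. P j (n::nat)"
  obtains f :: "nat \<Rightarrow> nat" where "strict_mono f" "\<And>j. P j (f j)"
proof -
  define g where "g = (\<lambda>j L. SOME n. n \<ge> L \<and> P j n)"
  have "g j L \<ge> L \<and> P j (g j L)" for j L unfolding g_def by (rule someI_ex) (use assms in blast)
  then have g: "\<And>j L. g j L \<ge> L" "\<And>j L. P j (g j L)" by blast+
  define f where "f = rec_nat (g 0 0) (\<lambda>j x. g (Suc j) (Suc x))"
  have fS: "f (Suc j) = g (Suc j) (Suc (f j))" for j by (simp add: f_def)
  have "f j < f (Suc j)" for j using g(1)[of "Suc (f j)" "Suc j"] by (simp add: fS)
  then have "strict_mono f" by (simp add: strict_mono_Suc_iff)
  moreover have "P j (f j)" for j by (cases j) (simp_all add: fS g(2), simp add: f_def g(2))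
  ultimately show thesis by (rule that)
qed

lemma block_index:
  assumes "mono (l::nat\<Rightarrow>nat)" obtains blk where "\<And>k i. i \<in> {l k..<l (Suc k)} \<Longrightarrow> blk i = k"
proof
  fix k i assume i: "i \<in> {l k..<l (Suc k)}"
  then have "i \<in> {l (SOME k. i \<in> {l k..<l (Suc k)})..<l (Suc (SOME k. i \<in> {l k..<l (Suc k)}))}"
    by (rule someI)
  then show "(SOME k. i \<in> {l k..<l (Suc k)}) = k" using mono_cut_unique[OF assms _ i] by blast
qed

lemma glue_permutations:
  assumes l: "strict_mono (l::nat\<Rightarrow>nat)" "l 0 = 0"
    and \<pi>: "\<And>k. bij_betw (\<pi> k) {l k..<l (Suc k)} {l k..<l (Suc k)}"
  obtains \<sigma> :: "nat \<Rightarrow> nat" where "bij \<sigma>" "\<And>k i. i \<in> {l k..<l (Suc k)} \<Longrightarrow> \<sigma> i = \<pi> k i"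
proof -
  have lm: "mono l" using l(1) by (rule strict_mono_mono)
  obtain blk where blk: "\<And>k i. i \<in> {l k..<l (Suc k)} \<Longrightarrow> blk i = k" by (rule block_index[OF lm]) (rule that)
  have cover: "\<exists>k. i \<in> {l k..<l (Suc k)}" for i
  proof -
    have "i < l (Suc i)" using strict_mono_imp_increasing[OF l(1), of "Suc i"] by simp
    then show ?thesis using cut_cover[OF lm, of i "Suc i"] l(2) by (metis le0)
  qed
  define \<sigma> where "\<sigma> = (\<lambda>i. \<pi> (blk i) i)"
  have \<sigma>: "\<sigma> i = \<pi> k i" if "i \<in> {l k..<l (Suc k)}" for k i using blk[OF that] by (simp add: \<sigma>_def)
  have img: "\<sigma> i \<in> {l k..<l (Suc k)}" if "i \<in> {l k..<l (Suc k)}" for k i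
    using \<sigma>[OF that] bij_betwE[OF \<pi>[of k]] that by simp
  have "bij \<sigma>"
  proof (rule bijI)
    show "inj \<sigma>"
    proof (rule injI)
      fix i j assume eq: "\<sigma> i = \<sigma> j"
      obtain k m where k: "i \<in> {l k..<l (Suc k)}" and m: "j \<in> {l m..<l (Suc m)}" using cover by metis
      have "k = m" using img[OF k] img[OF m] eq mono_cut_unique[OF lm] by metis
      then have "\<pi> k i = \<pi> k j" using eq \<sigma>[OF k] \<sigma>[OF m] by simp
      then show "i = j" using bij_betw_imp_inj_on[OF \<pi>[of k]] k m \<open>k = m\<close> by (auto dest: inj_onD)
    qed
    show "surj \<sigma>"
      unfolding surj_def
    proof
      fix y
      obtain k where k: "y \<in> {l k..<l (Suc k)}" using cover by blast
      then obtain i where "i \<in> {l k..<l (Suc k)}" "y = \<pi> k i"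
        using bij_betw_imp_surj_on[OF \<pi>[of k]] by blast
      then show "\<exists>x. y = \<sigma> x" using \<sigma> by metis
    qed
  qed
  then show thesis using \<sigma> by (rule that)
qed

lemma permutation_onto:
  assumes "finite B" "G \<subseteq> B" "A \<subseteq> B" "card A = card G"
  obtains \<pi> where "bij_betw \<pi> B B" "\<pi> ` A = G"
proof -
  have fin: "finite A" "finite G" using assms finite_subset by auto
  obtain f where f: "bij_betw f A G" using finite_same_card_bij[OF fin assms(4)] by blast
  have "card (B - A) = card (B - G)" using assms fin by (simp add: card_Diff_subset)
  then obtain g where g: "bij_betw g (B - A) (B - G)" using finite_same_card_bij assms(1) by (meson finite_Diff)
  have "bij_betw (\<lambda>x. if x \<in> A then f x else g x) (A \<union> (B - A)) (G \<union> (B - G))"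
    using f g by (intro bij_betw_disjoint_Un) auto
  moreover have "A \<union> (B - A) = B" "G \<union> (B - G) = B" using assms by auto
  moreover have "(\<lambda>x. if x \<in> A then f x else g x) ` A = G" using f by (auto simp: bij_betw_def)
  ultimately show thesis using that by auto
qed

lemma lincomb_cong: "(\<And>j. j \<in> F \<Longrightarrow> c j = d j) \<Longrightarrow> lincomb x c F = lincomb x d F"
  unfolding lincomb_def by (intro ext sum.cong) auto

lemma lincomb_scale: "lincomb x (\<lambda>j. r * c j) F = (\<lambda>i. r * lincomb x c F i)"
  by (simp add: lincomb_def sum_distrib_left mult.assoc)

lemma lincomb_scale_vectors: "lincomb (\<lambda>j i. r * x j i) c F = (\<lambda>i. r * lincomb x c F i)"
  by (simp add: lincomb_def sum_distrib_left mult_ac)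

lemma lincomb_reindex: "inj_on g F \<Longrightarrow> lincomb (x \<circ> g) (c \<circ> g) F = lincomb x c (g ` F)"
  by (simp add: lincomb_def sum.reindex)

context tirilman
begin

text \<open>If bad sets existed arbitrarily far out, a permutation could move each of them to the
  front of its own interval. The rearranged series would then have contiguous sections of norm at
  least \<epsilon> arbitrarily far out.\<close>

lemma unconditional_cauchy:
  assumes x: "\<And>j. x j \<in> TD" and unc: "unconditional p \<gamma> x" and C: "cauchy_series x a" and \<epsilon>: "\<epsilon> > 0"
  shows "\<exists>M. \<forall>G. finite G \<longrightarrow> G \<subseteq> {M..} \<longrightarrow> D (lincomb x a G) < \<epsilon>"
proof (rule ccontr)
  assume "\<not> ?thesis"
  then have "\<forall>M. \<exists>G. finite G \<and> G \<subseteq> {M..} \<and> D (lincomb x a G) \<ge> \<epsilon>" by (meson not_less)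
  then obtain GG where GG: "\<And>M. finite (GG M)" "\<And>M. GG M \<subseteq> {M..}" "\<And>M. D (lincomb x a (GG M)) \<ge> \<epsilon>" by metis
  obtain l where l: "strict_mono l" and l0: "l 0 = 0" and Gl: "\<And>k. GG (l k) \<subseteq> {l k..<l (Suc k)}"
    using consecutive_cuts[of "\<lambda>_. GG" 0] GG(1,2) by blast
  define G where "G = (\<lambda>k. GG (l k))"
  have Gsub: "G k \<subseteq> {l k..<l (Suc k)}" for k using Gl by (simp add: G_def)
  define A where "A = (\<lambda>k. {l k..<l k + card (G k)})"
  have Asub: "A k \<subseteq> {l k..<l (Suc k)}" for k
    using card_mono[OF _ Gsub[of k]] by (auto simp: A_def)
  have "\<exists>\<pi>. bij_betw \<pi> {l k..<l (Suc k)} {l k..<l (Suc k)} \<and> \<pi> ` A k = G k" for k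
    by (rule permutation_onto[OF _ Gsub Asub, of k]) (auto simp: A_def)
  then obtain \<pi> where \<pi>: "\<And>k. bij_betw (\<pi> k) {l k..<l (Suc k)} {l k..<l (Suc k)}" "\<And>k. \<pi> k ` A k = G k" by metis
  obtain \<sigma> where \<sigma>: "bij \<sigma>" "\<And>k i. i \<in> {l k..<l (Suc k)} \<Longrightarrow> \<sigma> i = \<pi> k i"
    using glue_permutations[OF l l0 \<pi>(1)] by blast
  have "series_conv p \<gamma> (x \<circ> \<sigma>) (a \<circ> \<sigma>)"
    using unc C \<sigma>(1) series_conv_iff[OF x] by (auto simp: unconditional_def)
  then have "cauchy_series (x \<circ> \<sigma>) (a \<circ> \<sigma>)" by (subst (asm) series_conv_iff) (simp_all add: x)
  then obtain M where M: "\<And>m n. M \<le> m \<Longrightarrow> m \<le> n \<Longrightarrow> D (lincomb (x \<circ> \<sigma>) (a \<circ> \<sigma>) {m..<n}) < \<epsilon>"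
    using \<epsilon> unfolding cauchy_series_def by meson
  have "M \<le> l M" using strict_mono_imp_increasing[OF l] .
  then have "D (lincomb (x \<circ> \<sigma>) (a \<circ> \<sigma>) (A M)) < \<epsilon>" unfolding A_def by (intro M) auto
  moreover have "\<sigma> ` A M = G M"
    using \<sigma>(2) Asub[of M] \<pi>(2)[of M] by (metis (no_types, lifting) image_cong subsetD)
  moreover have "inj_on \<sigma> (A M)" using bij_is_inj[OF \<sigma>(1)] by (rule inj_on_subset) simp
  ultimately have "D (lincomb x a (G M)) < \<epsilon>" by (simp add: lincomb_reindex)
  then show False using GG(3)[of "l M"] by (simp add: G_def)
qed

end

text \<open>With \<open>s\<close> read as a position in an \<open>n\<close> by \<open>n\<close>
  matrix stored row by row, the map is transposition: it exchanges quotient and remainder.\<close>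

lemma transpose_bij:
  fixes s :: nat assumes "s < n * n"
  shows "s div n + n * (s mod n) < n * n"
    and "(s div n + n * (s mod n)) mod n = s div n"
    and "(s div n + n * (s mod n)) div n = s mod n"
proof -
  have n: "n > 0" using assms by (cases n) auto
  have d: "s div n < n" using assms by (simp add: less_mult_imp_div_less)
  have "s mod n \<le> n - 1" using n by (simp add: less_Suc_eq_le[symmetric])
  then have "n * (s mod n) \<le> n * (n - 1)" by simp
  then have "s div n + n * (s mod n) < n + n * (n - 1)" using d by linarith
  also have "\<dots> = n * n" using n by (simp add: diff_mult_distrib2)
  finally show "s div n + n * (s mod n) < n * n" .
  show "(s div n + n * (s mod n)) mod n = s div n" using d by simp
  show "(s div n + n * (s mod n)) div n = s mod n" using d n by simp
qed

context tirilman_small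
begin

text \<open>Tiling a vector in two orders: repeating each coordinate gives flat blocks, for which the dual
  norm is comparable to the \<open>q\<close>-norm, while repeating the whole vector keeps its dual norm.\<close>

lemma tiling:
  assumes K: "K > 0"
  shows "\<exists>n>L. \<exists>\<pi> g. bij_betw \<pi> {L..<n} {L..<n} \<and> (\<forall>A\<subseteq>{L..<n}. D (lincomb estar g A) \<le> CS / \<gamma>)
    \<and> K \<le> D (lincomb (estar \<circ> \<pi>) g {L..<n})"
proof -
  have be: "blocks id estar" using blocks_estar[of id] by (simp add: strict_mono_def)
  have e1: "D (estar j) \<ge> 1" for j using D_abs_le[OF D_estar(1), of j j] by (simp add: estar_def)
  \<comment> \<open>The factor \<open>2 * CU\<close> anticipates the loss in
    \<open>D_lower_estimate\<close>.\<close>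
  have K2: "2 * CU * K > 0" using K CU_ge1 by simp
  obtain F b where bF: "finite F" "F \<subseteq> {0..}" "\<And>j. b j \<ge> 0" "(\<Sum>j\<in>F. b j powr q) = 1"
    "D (lincomb estar b F) \<ge> 2 * CU * K"
    by (rule no_upper_q_estimate[OF be zero_less_one e1 K2, of 0]) (rule that)
  obtain m where m: "F \<subseteq> {..<m}" "m \<ge> 1"
  proof -
    obtain k where "F \<subseteq> {..<k}" using bF(1) finite_nat_iff_bounded by blast
    then show thesis using that[of "Suc k"] by force
  qed
  have m0: "m > 0" using m by simp
  define r where "r = real m powr (-1/q)"
  have r0: "r > 0" using m by (simp add: r_def)
  have rm: "rt m * r = 1" using m by (simp add: r_def powr_minus_divide)
  have rq: "r powr q = 1 / real m" using m q0 by (simp add: r_def powr_powr powr_divide powr_minus_divide)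
  define bb where "bb = (\<lambda>i. if i \<in> F then b i else 0)"
  define n where "n = L + m * m"
  \<comment> \<open>\<open>g\<close> repeats each coordinate on a run of \<open>m\<close> places,
    \<open>h\<close> repeats the whole vector \<open>m\<close> times; transposition carries one to
    the other. The factor \<open>r\<close> offsets the repetition, since
    \<open>r powr q = 1 / m\<close>.\<close>
  define g where "g = (\<lambda>i. r * bb ((i - L) div m))"
  define h where "h = (\<lambda>i. if i \<in> {L..<n} then r * bb ((i - L) mod m) else 0)"
  define u where "u = (\<lambda>i. L + i * m)"
  have u: "strict_mono u" using m by (auto simp: u_def strict_mono_Suc_iff)
  have um: "mono u" using u by (rule strict_mono_mono)
  have inu: "x \<in> {u i..<u (Suc i)} \<longleftrightarrow> L \<le> x \<and> (x - L) div m = i" for x i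
  proof -
    have "L \<le> x \<and> (x - L) div m = i \<longleftrightarrow> L \<le> x \<and> i * m \<le> x - L \<and> x - L < Suc i * m"
      using m0 by (metis div_nat_eqI dividend_less_times_div le_add1 less_eq_div_iff_mult_less_eq lessI mult.commute times_div_less_eq_dividend mult_Suc dividend_less_div_times add.commute)
    moreover have "x \<in> {u i..<u (Suc i)} \<longleftrightarrow> L \<le> x \<and> i * m \<le> x - L \<and> x - L < Suc i * m"
      by (auto simp: u_def)
    ultimately show ?thesis by blast
  qed
  define \<pi> where "\<pi> = (\<lambda>i. L + ((i - L) div m + m * ((i - L) mod m)))"
  have \<pi>in: "\<pi> i \<in> {L..<n}" if "i \<in> {L..<n}" for i
    using transpose_bij(1)[of "i - L" m] that by (auto simp: \<pi>_def n_def)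
  have \<pi>\<pi>: "\<pi> (\<pi> i) = i" if "i \<in> {L..<n}" for i
  proof -
    have "i - L < m * m" using that by (auto simp: n_def)
    from transpose_bij(2,3)[OF this] have "\<pi> (\<pi> i) = L + ((i - L) mod m + m * ((i - L) div m))"
      by (simp add: \<pi>_def)
    then show ?thesis using that by simp
  qed
  have bij: "bij_betw \<pi> {L..<n} {L..<n}"
    by (rule bij_betw_byWitness[of _ \<pi>]) (use \<pi>in \<pi>\<pi> in auto)
  have gh: "g i = h (\<pi> i)" if "i \<in> {L..<n}" for i
  proof -
    have "i - L < m * m" using that by (auto simp: n_def)
    from transpose_bij(2)[OF this] show ?thesis using \<pi>in[OF that] by (simp add: g_def h_def \<pi>_def)
  qed
  have "D (lincomb estar g A) \<le> CS / \<gamma>" if A: "A \<subseteq> {L..<n}" for A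
  proof -
    \<comment> \<open>A run is a block of \<open>m\<close> equal coordinates. The height
      \<open>\<gamma> * r\<close> instead of \<open>r\<close> ensures \<open>D (f i) \<le> 1\<close>
      by \<open>D_cut_upper\<close>; this is the origin of the factor \<open>1 / \<gamma>\<close> in
      the bound.\<close>
    define f where "f = (\<lambda>i x. if x \<in> {u i..<u (Suc i)} then \<gamma> * r else 0)"
    have f: "blocks u f" using um by (auto simp: blocks_def f_def)
    have Df: "D (f i) \<le> 1" for i
    proof -
      define t where "t = (\<lambda>j. u i + j)"
      have "D (f i) \<le> rt m * (\<gamma> * r) / \<gamma>"
      proof (rule D_cut_upper)
        show "mono t" by (simp add: mono_def t_def)
        fix x assume "f i x \<noteq> 0" then show "t 0 \<le> x \<and> x < t m" by (auto simp: f_def t_def u_def split: if_splits)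
      next
        fix j
        have "cut t j (f i) = (\<lambda>x. f i (t j) * estar (t j) x)"
          by (auto simp: t_def restr_def estar_def)
        then have "D (cut t j (f i)) \<le> \<bar>f i (t j)\<bar> * D (estar (t j))" using D_scale_le(2)[OF D_estar(1)] by simp
        also have "\<dots> \<le> \<gamma> * r * 1" using D_estar D_nonneg[OF D_estar(1)] \<gamma>0 r0 by (intro mult_mono) (auto simp: f_def)
        finally show "D (cut t j (f i)) \<le> \<gamma> * r" by simp
      qed (use \<gamma>0 r0 in auto)
      also have "rt m * (\<gamma> * r) / \<gamma> = rt m * r" using \<gamma>0 by simp
      finally show ?thesis using rm by simp
    qed
    have big: "D (lincomb f b F) \<le> CS"
    proof (rule D_flat_blocks[OF f m(1) m(2) Df])
      fix i s show "\<bar>f i s\<bar> \<le> real m powr (-1/q)"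
        using \<gamma>0 \<gamma>1 r0 unfolding r_def[symmetric] by (auto simp: f_def abs_mult mult_left_le_one_le)
    next
      show "(\<Sum>i\<in>F. \<bar>b i\<bar> powr q) \<le> 1" using bF(3,4) by simp
    qed
    have finA: "finite A" using A finite_subset by blast
    have lTD: "lincomb f b F \<in> TD" by (intro D_lincomb blocks_TD[OF f])
    have "D (lincomb estar g A) \<le> D (\<lambda>x. (1/\<gamma>) * lincomb f b F x)"
    proof (rule D_mono(2)[OF D_scale_le(1)[OF lTD]])
      fix x
      show "\<bar>lincomb estar g A x\<bar> \<le> \<bar>(1/\<gamma>) * lincomb f b F x\<bar>"
      proof (cases "x \<in> A")
        case True
        define i where "i = (x - L) div m"
        have x: "x \<in> {u i..<u (Suc i)}" using True A by (subst inu) (auto simp: i_def)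
        have "lincomb f b F x = (if i \<in> F then b i * f i x else 0)"
          using x by (intro blocks_lincomb_apply[OF f bF(1)]) auto
        then have "lincomb f b F x = bb i * (\<gamma> * r)" using x by (simp add: f_def bb_def)
        then have "(1/\<gamma>) * lincomb f b F x = g x" using \<gamma>0 by (simp add: g_def i_def)
        then show ?thesis using True finA by (simp add: lincomb_estar)
      next
        case False then show ?thesis using finA by (simp add: lincomb_estar)
      qed
    qed
    also have "\<dots> = \<bar>1/\<gamma>\<bar> * D (lincomb f b F)" by (rule D_scale[OF lTD])
    also have "\<dots> \<le> \<bar>1/\<gamma>\<bar> * CS" using big by (intro mult_left_mono) auto
    finally show ?thesis using \<gamma>0 by simp
  qed
  moreover have "K \<le> D (lincomb (estar \<circ> \<pi>) g {L..<n})"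
  proof -
    have "lincomb (estar \<circ> \<pi>) g {L..<n} = lincomb (estar \<circ> \<pi>) (h \<circ> \<pi>) {L..<n}"
      by (rule lincomb_cong) (simp add: gh)
    also have "\<dots> = lincomb estar h {L..<n}"
      using bij by (subst lincomb_reindex) (auto simp: bij_betw_def)
    also have "\<dots> = h" by (rule ext) (simp add: lincomb_estar h_def)
    finally have eq: "lincomb (estar \<circ> \<pi>) g {L..<n} = h" .
    have hTD: "h \<in> TD" by (rule c00_TD, rule c00_subset[of "{L..<n}"]) (auto simp: h_def)
    have "r * (2 * CU * K) \<le> D (cut u j h)" if j: "j < m" for j
    proof -
      \<comment> \<open>On \<open>{u j..<u (Suc j)}\<close> the vector \<open>h\<close> is a shifted
        copy of \<open>r\<close> times \<open>b\<close>, and by \<open>D_spread\<close> shifting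
        does not lower the dual norm.\<close>
      define s where "s = (\<lambda>i. u j + i)"
      have s: "strict_mono s" by (simp add: s_def strict_mono_Suc_iff)
      have "cut u j h = lincomb (estar \<circ> s) (\<lambda>i. r * b i) F"
      proof
        fix x
        have "lincomb (estar \<circ> s) (\<lambda>i. r * b i) F x = (\<Sum>i\<in>F. if x = u j + i then r * b i else 0)"
          by (auto simp: lincomb_def estar_def s_def intro!: sum.cong)
        also have "\<dots> = (\<Sum>i\<in>F. if u j \<le> x \<and> i = x - u j then r * b (x - u j) else 0)"
          by (intro sum.cong) auto
        also have "\<dots> = (if u j \<le> x \<and> x - u j \<in> F then r * b (x - u j) else 0)"
          using bF(1) by (cases "u j \<le> x") auto
        also have "\<dots> = cut u j h x"
        proof (cases "x \<in> {u j..<u (Suc j)}")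
          case True
          have "j * m + m \<le> m * m" using j by (metis Suc_leI add.commute mult_Suc mult_le_mono1)
          then have "x \<in> {L..<n}" using True by (auto simp: u_def n_def)
          moreover have "(x - L) mod m = x - u j"
          proof -
            have "x - L = (x - u j) + j * m" using True by (auto simp: u_def)
            moreover have "x - u j < m" using True by (auto simp: u_def)
            ultimately show ?thesis by simp
          qed
          ultimately show ?thesis using True by (simp add: restr_apply h_def bb_def)
        next
          case False
          have "x - u j \<notin> F" if "u j \<le> x"
          proof
            assume "x - u j \<in> F" then have "x - u j < m" using m by auto
            then show False using False that by (auto simp: u_def)
          qed
          then show ?thesis using False by (auto simp: restr_def)
        qed
        finally show "cut u j h x = lincomb (estar \<circ> s) (\<lambda>i. r * b i) F x" by simp
      qed
      then have "D (lincomb estar (\<lambda>i. r * b i) F) \<le> D (cut u j h)" using D_spread[OF s] by simp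
      moreover have "D (lincomb estar (\<lambda>i. r * b i) F) = r * D (lincomb estar b F)"
        unfolding lincomb_scale using r0 D_scale[OF D_lincomb(1)[OF D_estar(1)]] by simp
      ultimately show ?thesis using bF(5) r0 by (smt (verit) mult_left_mono)
    qed
    \<comment> \<open>There are \<open>m\<close> copies and \<open>r powr q = 1 / m\<close>, so the
      lower \<open>q\<close>-estimate loses nothing but its constant.\<close>
    then have "(\<Sum>j<m. (r * (2 * CU * K)) powr q) \<le> (\<Sum>j<m. D (cut u j h) powr q)"
      using r0 K2 q0 by (intro sum_mono powr_mono2) auto
    also have "\<dots> \<le> (2 * CU * D h) powr q" by (intro D_lower_estimate hTD um) simp
    also have "(\<Sum>j<m. (r * (2 * CU * K)) powr q) = (2 * CU * K) powr q"
    proof -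
      have "(r * (2 * CU * K)) powr q = r powr q * (2 * CU * K) powr q" by (rule powr_mult)
      then show ?thesis using m0 by (simp add: rq)
    qed
    finally have "(2 * CU * K) powr q \<le> (2 * CU * D h) powr q" .
    then have "((2 * CU * K) powr q) powr (1/q) \<le> ((2 * CU * D h) powr q) powr (1/q)"
      by (rule powr_mono2[rotated 2]) (use q0 in auto)
    moreover have inv: "(X powr q) powr (1/q) = X" if "X \<ge> 0" for X using that q0 by (simp add: powr_powr)
    have "((2 * CU * K) powr q) powr (1/q) = 2 * CU * K" using K2 by (intro inv) simp
    moreover have "((2 * CU * D h) powr q) powr (1/q) = 2 * CU * D h"
      using CU_ge1 D_nonneg[OF hTD] by (intro inv) simp
    ultimately have "2 * CU * K \<le> 2 * CU * D h" by (simp only:)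
    then show ?thesis unfolding eq using CU_ge1 by simp
  qed
  moreover have "L < n" using m0 by (simp add: n_def)
  ultimately show ?thesis using bij by blast
qed

text \<open>Tilings with \<open>K = 2 ^ k\<close> are put on consecutive intervals with weights
  \<open>(1/2) ^ k\<close>. In natural order the pieces are summable in norm, while every permuted
  piece keeps norm at least 1.\<close>

lemma not_symmetric_estar: "\<not> symmetric_seq p \<gamma> estar"
proof
  assume sym: "symmetric_seq p \<gamma> estar"
  have "\<forall>k L. \<exists>n>L. \<exists>\<pi> g. bij_betw \<pi> {L..<n} {L..<n} \<and> (\<forall>A\<subseteq>{L..<n}. D (lincomb estar g A) \<le> CS / \<gamma>)
    \<and> 2 ^ k \<le> D (lincomb (estar \<circ> \<pi>) g {L..<n})" by (intro allI tiling) simp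
  then obtain nn pp gg where ng: "\<And>k L. nn k L > L" "\<And>k L. bij_betw (pp k L) {L..<nn k L} {L..<nn k L}"
    "\<And>k L A. A \<subseteq> {L..<nn k L} \<Longrightarrow> D (lincomb estar (gg k L) A) \<le> CS / \<gamma>"
    "\<And>k L. 2 ^ k \<le> D (lincomb (estar \<circ> pp k L) (gg k L) {L..<nn k L})" by metis
  define l where "l = rec_nat 0 (\<lambda>k. nn k)"
  have l0: "l 0 = 0" and lS: "l (Suc k) = nn k (l k)" for k by (auto simp: l_def)
  have l: "strict_mono l" using ng(1) by (simp add: strict_mono_Suc_iff lS)
  obtain \<sigma> where \<sigma>: "bij \<sigma>" "\<And>k i. i \<in> {l k..<l (Suc k)} \<Longrightarrow> \<sigma> i = pp k (l k) i"
    using glue_permutations[OF l l0, of "\<lambda>k. pp k (l k)"] ng(2) by (metis lS)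
  obtain blk where blk: "\<And>k i. i \<in> {l k..<l (Suc k)} \<Longrightarrow> blk i = k" by (rule block_index[OF strict_mono_mono[OF l]]) (rule that)
  define a where "a = (\<lambda>i. (1/2) ^ blk i * gg (blk i) (l (blk i)) i)"
  have aF: "lincomb y a F = (\<lambda>i. (1/2) ^ k * lincomb y (gg k (l k)) F i)" if "F \<subseteq> {l k..<l (Suc k)}" for k F y
    unfolding lincomb_scale[symmetric] by (rule lincomb_cong) (use that blk in \<open>auto simp: a_def\<close>)
  have "cauchy_series estar a"
  proof (rule cauchy_series_pieces[OF D_estar(1) l l0])
    show "summable (\<lambda>k. (1/2::real) ^ k * (CS / \<gamma>))" by (intro summable_mult2 summable_geometric) simp
    show "(1/2::real) ^ k * (CS / \<gamma>) \<ge> 0" for k using CS_pos \<gamma>0 by simp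
    fix k F assume F: "F \<subseteq> {l k..<l (Suc k)}"
    have "D (lincomb estar a F) = \<bar>(1/2) ^ k\<bar> * D (lincomb estar (gg k (l k)) F)"
      unfolding aF[OF F] by (rule D_scale[OF D_lincomb(1)[OF D_estar(1)]])
    also have "\<bar>(1/2) ^ k\<bar> = (1/2::real) ^ k" by simp
    also have "(1/2) ^ k * D (lincomb estar (gg k (l k)) F) \<le> (1/2) ^ k * (CS / \<gamma>)"
    proof (rule mult_left_mono)
      show "D (lincomb estar (gg k (l k)) F) \<le> CS / \<gamma>" using F by (intro ng(3)) (simp add: lS)
    qed simp
    finally show "D (lincomb estar a F) \<le> (1/2) ^ k * (CS / \<gamma>)" .
  qed
  then have "series_conv p \<gamma> (estar \<circ> \<sigma>) a"
    using sym \<sigma>(1) series_conv_iff[OF D_estar(1)] by (auto simp: symmetric_seq_def equivalent_def)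
  then have "cauchy_series (estar \<circ> \<sigma>) a" by (subst (asm) series_conv_iff) (simp_all add: D_estar)
  then obtain M where M: "\<And>m n. M \<le> m \<Longrightarrow> m \<le> n \<Longrightarrow> D (lincomb (estar \<circ> \<sigma>) a {m..<n}) < 1"
    unfolding cauchy_series_def by (meson zero_less_one)
  have "M \<le> l M" using strict_mono_imp_increasing[OF l] .
  then have less: "D (lincomb (estar \<circ> \<sigma>) a {l M..<l (Suc M)}) < 1"
    using strict_mono_mono[OF l] by (intro M) (auto simp: monoD)
  have perm: "lincomb (estar \<circ> \<sigma>) a {l M..<l (Suc M)} = lincomb (estar \<circ> pp M (l M)) a {l M..<l (Suc M)}"
    unfolding lincomb_def using \<sigma>(2) by (intro ext sum.cong) auto
  have "D (lincomb (estar \<circ> \<sigma>) a {l M..<l (Suc M)})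
      = \<bar>(1/2) ^ M\<bar> * D (lincomb (estar \<circ> pp M (l M)) (gg M (l M)) {l M..<l (Suc M)})"
    unfolding perm unfolding aF[OF order_refl] by (rule D_scale[OF D_lincomb(1)], simp add: D_estar)
  moreover have "(1/2) ^ M * 2 ^ M \<le> (1/2) ^ M * D (lincomb (estar \<circ> pp M (l M)) (gg M (l M)) {l M..<l (Suc M)})"
    using ng(4)[of M "l M"] by (intro mult_left_mono) (simp_all add: lS)
  moreover have "(1/2::real) ^ M * 2 ^ M = 1" by (simp add: power_mult_distrib[symmetric])
  ultimately show False using less by simp
qed

end

subsection \<open>Uniqueness of subsymmetric sequences\<close>

lemma bounded_subseq_convergent:
  fixes s :: "nat \<Rightarrow> real" assumes "\<And>n. \<bar>s n\<bar> \<le> B"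
  obtains r where "strict_mono r" "convergent (\<lambda>n. s (r n))"
proof -
  obtain r where r: "strict_mono r" "monoseq (\<lambda>n. s (r n))" using seq_monosub[of s] by blast
  have "Bseq (\<lambda>n. s (r n))" using assms by (intro BseqI'[of _ B]) simp
  then have "convergent (\<lambda>n. s (r n))" using r(2) by (rule Bseq_monoseq_convergent)
  then show thesis using r(1) that by blast
qed

lemma coordinatewise_convergent_subseq:
  fixes x :: "nat \<Rightarrow> nat \<Rightarrow> real" assumes bd: "\<And>j i. \<bar>x j i\<bar> \<le> B"
  obtains r where "strict_mono r" "\<And>i. convergent (\<lambda>j. x (r j) i)"
proof -
  interpret subseqs "\<lambda>i s. convergent (\<lambda>j. x (s j) i)"
  proof
    fix i and s :: "nat \<Rightarrow> nat"
    show "\<exists>r'. strict_mono r' \<and> convergent (\<lambda>j. x ((s \<circ> r') j) i)"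
      by (rule bounded_subseq_convergent[of "\<lambda>j. x (s j) i" B]) (use bd in auto)
  qed
  have "convergent (\<lambda>j. x (diagseq j) i)" for i
  proof -
    \<comment> \<open>The diagonal sequence is a subsequence of the \<open>i\<close>-th refinement
      only from index \<open>Suc i\<close> on.\<close>
    have "convergent (\<lambda>j. x ((diagseq \<circ> ((+) (Suc i))) j) i)"
    proof (rule diagseq_holds)
      fix r s :: "nat \<Rightarrow> nat" and n
      assume "strict_mono r" "convergent (\<lambda>j. x (s j) n)"
      then show "convergent (\<lambda>j. x ((s \<circ> r) j) n)"
        using LIMSEQ_subseq_LIMSEQ[of "\<lambda>j. x (s j) n" _ r] by (auto simp: convergent_def o_def)
    qed
    then have "convergent (\<lambda>j. x (diagseq (j + Suc i)) i)" by (simp add: o_def add.commute)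
    then show ?thesis using convergent_ignore_initial_segment[of "\<lambda>j. x (diagseq j) i" "Suc i"] by simp
  qed
  then show thesis using subseq_diagseq that by blast
qed

context tirilman
begin

text \<open>Given the left end \<open>w\<close> of a window, an index far enough out has little mass
  to the left of \<open>w\<close>, since finitely many coordinates tend to zero;
  \<open>D_tail\<close> then supplies the right end. Each side receives half of the error, and the
  halves decrease geometrically.\<close>

lemma gliding_hump:
  assumes d: "\<And>j. d j \<in> TD" and null: "\<And>i. (\<lambda>j. d j i) \<longlonglongrightarrow> 0" and \<eta>: "\<eta> > 0"
  obtains h u where "strict_mono h" "strict_mono u"
    "\<And>j. D (\<lambda>i. cut u j (d (h j)) i - d (h j) i) \<le> \<eta> * (1/2) ^ j"
proof -
  have step: "\<exists>n v. n \<ge> L \<and> v > w \<and> D (restr {..<w} (d n)) \<le> \<epsilon> \<and> D (restr {v..} (d n)) \<le> \<epsilon>"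
    if \<epsilon>: "\<epsilon> > 0" for \<epsilon> L w
  proof -
    have "(\<lambda>n. \<Sum>i<w. \<bar>d n i\<bar>) \<longlonglongrightarrow> (\<Sum>i<w. \<bar>0\<bar>)" by (intro tendsto_intros null)
    then have "(\<lambda>n. \<Sum>i<w. \<bar>d n i\<bar>) \<longlonglongrightarrow> 0" by simp
    from order_tendstoD(2)[OF this \<epsilon>] obtain n0 where n0: "\<And>n. n \<ge> n0 \<Longrightarrow> (\<Sum>i<w. \<bar>d n i\<bar>) < \<epsilon>"
      by (auto simp: eventually_sequentially)
    define n where "n = max n0 L"
    have "restr {..<w} (d n) = lincomb estar (d n) {..<w}" by (simp add: lincomb_estar restr_def)
    then have "D (restr {..<w} (d n)) \<le> (\<Sum>i<w. \<bar>d n i\<bar> * D (estar i))" by (simp add: D_lincomb D_estar)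
    also have "\<dots> \<le> (\<Sum>i<w. \<bar>d n i\<bar> * 1)" using D_estar by (intro sum_mono mult_left_mono) auto
    also have "\<dots> < \<epsilon>" using n0[of n] by (simp add: n_def)
    finally have 1: "D (restr {..<w} (d n)) \<le> \<epsilon>" by simp
    obtain M where "\<And>v. v \<ge> M \<Longrightarrow> D (restr {v..} (d n)) < \<epsilon>" using D_tail[OF d \<epsilon>, of n] by blast
    then have "D (restr {max M (Suc w)..} (d n)) \<le> \<epsilon>" by (simp add: less_imp_le)
    then show ?thesis using 1 by (intro exI[of _ n] exI[of _ "max M (Suc w)"]) (auto simp: n_def)
  qed
  define e where "e = (\<lambda>k::nat. \<eta> / 2 * (1/2) ^ k)"
  have e0: "e k > 0" for k using \<eta> by (simp add: e_def)
  have "\<forall>k L w. \<exists>n v. n \<ge> L \<and> v > w \<and> D (restr {..<w} (d n)) \<le> e k \<and> D (restr {v..} (d n)) \<le> e k"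
    using step e0 by blast
  then obtain nn vv where nv: "\<And>k L w. nn k L w \<ge> L" "\<And>k L w. vv k L w > w"
    "\<And>k L w. D (restr {..<w} (d (nn k L w))) \<le> e k" "\<And>k L w. D (restr {vv k L w..} (d (nn k L w))) \<le> e k"
    by metis
  define st where "st = rec_nat (0, 0) (\<lambda>k (L, w). (Suc (nn k L w), vv k L w))"
  define L where "L = (\<lambda>k. fst (st k))"
  define u where "u = (\<lambda>k. snd (st k))"
  define h where "h = (\<lambda>k. nn k (L k) (u k))"
  have LS: "L (Suc k) = Suc (h k)" and uS: "u (Suc k) = vv k (L k) (u k)" for k
    by (simp_all add: L_def u_def h_def st_def split: prod.split)
  have "h k < h (Suc k)" for k using nv(1)[of "L (Suc k)" "Suc k" "u (Suc k)"] by (simp add: h_def[of] LS)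
  then have h: "strict_mono h" by (simp add: strict_mono_Suc_iff)
  have u: "strict_mono u" using nv(2) by (simp add: strict_mono_Suc_iff uS)
  have "D (\<lambda>i. cut u j (d (h j)) i - d (h j) i) \<le> \<eta> * (1/2) ^ j" for j
  proof -
    have lt: "u j < u (Suc j)" using u by (simp add: strict_mono_Suc_iff)
    have "D (\<lambda>i. cut u j (d (h j)) i - d (h j) i)
        \<le> D (\<lambda>i. restr {..<u j} (d (h j)) i + restr {u (Suc j)..} (d (h j)) i)"
      by (rule D_mono(2)[OF D_add(1)[OF D_restr(1)[OF d] D_restr(1)[OF d]]]) (use lt in \<open>auto simp: restr_apply\<close>)
    also have "\<dots> \<le> D (restr {..<u j} (d (h j))) + D (restr {u (Suc j)..} (d (h j)))"
      by (intro D_add D_restr d)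
    also have "\<dots> \<le> e j + e j" using nv(3)[of "u j" j "L j"] nv(4)[of j "L j" "u j"]
      unfolding uS h_def by (intro add_mono)
    finally show ?thesis by (simp add: e_def)
  qed
  then show thesis using that h u by blast
qed

lemma cauchy_series_bounded:
  assumes "cauchy_series y a" "\<And>j. y j \<in> TD" "\<And>j. D (y j) \<ge> c" "c > 0"
  shows "\<exists>B. \<forall>j. \<bar>a j\<bar> \<le> B"
proof -
  have "Bseq (\<lambda>j. \<bar>a j\<bar> * D (y j))"
    using cauchy_series_terms[OF assms(1,2)] by (intro convergent_imp_Bseq) (auto simp: convergent_def)
  then obtain K where K: "\<And>j. norm (\<bar>a j\<bar> * D (y j)) \<le> K" by (auto simp: Bseq_def)
  have "\<bar>a j\<bar> \<le> K / c" for j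
  proof -
    have "\<bar>a j\<bar> * c \<le> \<bar>a j\<bar> * D (y j)" using assms(3) by (intro mult_left_mono) auto
    also have "\<dots> \<le> K" using K[of j] by simp
    finally show ?thesis using assms(4) by (simp add: pos_le_divide_eq)
  qed
  then show ?thesis by blast
qed

text \<open>The \<open>k\<close>-th dyadic group has \<open>2 ^ k\<close> coefficients of size at
  most \<open>(1/2) ^ k\<close>, so its dual norm is at most
  \<open>2 powr (k/q - k) / \<gamma>\<close>, a geometric sequence because
  \<open>1/q - 1 = -1/p\<close>. Hence the unit vectors admit convergent series that are not
  absolutely summable.\<close>

lemma cauchy_estar_harmonic: "cauchy_series estar (\<lambda>j. 1 / real (Suc j))"
proof -
  \<comment> \<open>The offset by 1 matches the coefficients \<open>1 / real (Suc j)\<close>: the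
    group \<open>{l k..<l (Suc k)}\<close> has denominators from \<open>2 ^ k\<close> on.\<close>
  define l where "l = (\<lambda>k. 2 ^ k - 1 :: nat)"
  have pow: "(2::nat) ^ k \<ge> 1" for k by simp
  have lS: "l (Suc k) = l k + 2 ^ k" for k using pow[of k] by (simp add: l_def)
  have l: "strict_mono l" by (simp add: strict_mono_Suc_iff lS)
  have l0: "l 0 = 0" by (simp add: l_def)
  define \<theta> where "\<theta> = (2::real) powr (-1/p)"
  have "\<theta> < 2 powr 0" unfolding \<theta>_def using p0 by (intro powr_less_mono) auto
  then have \<theta>: "0 < \<theta>" "\<theta> < 1" by (auto simp: \<theta>_def)
  show ?thesis
  proof (rule cauchy_series_pieces[OF D_estar(1) l l0])
    show "summable (\<lambda>k. \<theta> ^ k / \<gamma>)" using \<theta> by (intro summable_divide summable_geometric) simp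
    show "0 \<le> \<theta> ^ k / \<gamma>" for k using \<theta> \<gamma>0 by simp
    fix k F assume F: "F \<subseteq> {l k..<l (Suc k)}"
    define b where "b = lincomb estar (\<lambda>j. 1 / real (Suc j)) {l k..<l (Suc k)}"
    define t where "t = (\<lambda>j. l k + j)"
    have bx: "b x = (if x \<in> {l k..<l (Suc k)} then 1 / real (Suc x) else 0)" for x
      unfolding b_def by (simp add: lincomb_estar)
    have b1: "\<bar>b x\<bar> \<le> (1/2) ^ k" for x
    proof (cases "x \<in> {l k..<l (Suc k)}")
      case True
      then have "2 ^ k \<le> Suc x" using pow[of k] by (auto simp: l_def)
      then have "(2::real) ^ k \<le> real (Suc x)" by (metis of_nat_le_iff of_nat_numeral of_nat_power)
      then have "1 / real (Suc x) \<le> 1 / 2 ^ k" by (intro divide_left_mono) auto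
      then show ?thesis using True by (simp add: bx power_one_over)
    next
      case False
      then have "b x = 0" unfolding bx by (rule if_not_P)
      then show ?thesis by simp
    qed
    have "D (lincomb estar (\<lambda>j. 1 / real (Suc j)) F) \<le> D b"
      unfolding b_def by (rule D_le_subset_estar[OF F]) simp
    also have "\<dots> \<le> rt (2 ^ k) * (1/2) ^ k / \<gamma>"
    proof (rule D_cut_upper)
      show "mono t" by (simp add: t_def mono_def)
      fix x assume "b x \<noteq> 0" then show "t 0 \<le> x \<and> x < t (2 ^ k)" by (auto simp: bx t_def lS split: if_splits)
    next
      fix j
      have "cut t j b = (\<lambda>x. b (t j) * estar (t j) x)" by (auto simp: t_def restr_def estar_def)
      then have "D (cut t j b) \<le> \<bar>b (t j)\<bar> * D (estar (t j))" using D_scale_le(2)[OF D_estar(1)] by simp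
      also have "\<dots> \<le> (1/2) ^ k * 1" using b1 D_estar D_nonneg[OF D_estar(1)] by (intro mult_mono) auto
      finally show "D (cut t j b) \<le> (1/2) ^ k" by simp
    qed simp
    also have "rt (2 ^ k) * (1/2) ^ k = \<theta> ^ k"
    proof -
      have "rt (2 ^ k) = 2 powr (real k * (1/q))" by (simp add: powr_powr powr_realpow[symmetric])
      moreover have "(1/2::real) ^ k = 2 powr (- real k)" by (simp add: powr_minus_divide powr_realpow power_one_over)
      ultimately have "rt (2 ^ k) * (1/2) ^ k = 2 powr (real k * (1/q) + - real k)" by (simp only: powr_add)
      also have "real k * (1/q) + - real k = (-1/p) * real k"
      proof -
        have "1/q = 1 - 1/p" using pq by linarith
        then show ?thesis unfolding \<open>1/q = 1 - 1/p\<close> by (simp add: algebra_simps)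
      qed
      also have "2 powr ((-1/p) * real k) = \<theta> ^ k" 
        unfolding \<theta>_def powr_powr[symmetric] by (rule powr_realpow) simp
      finally show ?thesis .
    qed
    finally show "D (lincomb estar (\<lambda>j. 1 / real (Suc j)) F) \<le> \<theta> ^ k / \<gamma>" .
  qed
qed

end

section \<open>Seminormalisation of subsymmetric bases\<close>

locale subsymmetric_basis = tirilman_small +
  fixes x :: "nat \<Rightarrow> nat \<Rightarrow> real"
  assumes xTD: "\<And>j. x j \<in> TD" and x0: "\<And>j. x j \<noteq> (\<lambda>i. 0)" and unc: "unconditional p \<gamma> x"
    and subseq: "\<And>f a. strict_mono f \<Longrightarrow> cauchy_series (x \<circ> f) a \<longleftrightarrow> cauchy_series x a"
begin

lemma Dx_pos: "D (x j) > 0"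
proof -
  obtain i where "x j i \<noteq> 0" using x0[of j] by auto
  then show ?thesis using D_abs_le[OF xTD, of j i] by linarith
qed

text \<open>If the norms were unbounded, a subsequence could outgrow the original norms by factors
  \<open>2 ^ j\<close>. The coefficients below then make the original series absolutely convergent,
  while the terms along the subsequence do not tend to zero.\<close>

lemma Dx_bounded: obtains C where "C > 0" "\<And>j. D (x j) \<le> C"
proof -
  have "\<exists>C. \<forall>j. D (x j) \<le> C"
  proof (rule ccontr)
    assume "\<not> ?thesis"
    then have unb: "\<exists>j. D (x j) > C" for C by (meson not_less)
    have "\<exists>n\<ge>L. D (x n) \<ge> 2 ^ j * (1 + D (x j))" for j L
    proof (rule ccontr)
      assume "\<not> ?thesis"
      then have small: "D (x n) < 2 ^ j * (1 + D (x j))" if "n \<ge> L" for n using that by (meson not_less)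
      obtain n where n: "D (x n) > 2 ^ j * (1 + D (x j)) + (\<Sum>n<L. D (x n))" using unb by blast
      show False
      proof (cases "n \<ge> L")
        case True
        have "0 \<le> (\<Sum>n<L. D (x n))" by (intro sum_nonneg D_nonneg xTD)
        then show ?thesis using small[OF True] n by linarith
      next
        case False
        then have "D (x n) \<le> (\<Sum>n<L. D (x n))" using D_nonneg[OF xTD] by (intro member_le_sum) auto
        moreover have "0 \<le> 2 ^ j * (1 + D (x j))" using D_nonneg[OF xTD] by simp
        ultimately show ?thesis using n by linarith
      qed
    qed
    then obtain f where f: "strict_mono f" "\<And>j. D (x (f j)) \<ge> 2 ^ j * (1 + D (x j))"
      by (rule subseq_choice[where P="\<lambda>j n. D (x n) \<ge> 2 ^ j * (1 + D (x j))"]) (rule that)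
    define a where "a = (\<lambda>j. 1 / (2 ^ j * (1 + D (x j))))"
    have a0: "a j > 0" for j using Dx_pos[of j] by (simp add: a_def)
    have "cauchy_series x a"
    proof (rule cauchy_series_summable[OF _ xTD])
      show "summable (\<lambda>j. \<bar>a j\<bar> * D (x j))"
      proof (rule summable_comparison_test'[of "\<lambda>j. (1/2::real) ^ j" 0])
        fix j :: nat
        have "\<bar>a j\<bar> * D (x j) = (1/2) ^ j * (D (x j) / (1 + D (x j)))" using Dx_pos[of j] by (simp add: a_def power_one_over)
        also have "\<dots> \<le> (1/2) ^ j * 1" using Dx_pos[of j] by (intro mult_left_mono) auto
        finally show "norm (\<bar>a j\<bar> * D (x j)) \<le> (1/2) ^ j" using Dx_pos[of j] by simp
      qed (simp add: summable_geometric)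
    qed
    then have "cauchy_series (x \<circ> f) a" using subseq[OF f(1)] by simp
    then have "(\<lambda>j. \<bar>a j\<bar> * D ((x \<circ> f) j)) \<longlonglongrightarrow> 0" by (rule cauchy_series_terms) (simp add: xTD)
    moreover have "\<bar>a j\<bar> * D ((x \<circ> f) j) \<ge> 1" for j
    proof -
      have "a j * (2 ^ j * (1 + D (x j))) \<le> a j * D (x (f j))" using a0 f(2) by (intro mult_left_mono) (auto simp: less_imp_le)
      moreover have "a j * (2 ^ j * (1 + D (x j))) = 1" using Dx_pos[of j] by (simp add: a_def)
      ultimately show ?thesis using a0[of j] by simp
    qed
    ultimately have "(1::real) \<le> 0" by (intro LIMSEQ_le_const) auto
    then show False by simp
  qed
  then obtain C where C: "\<And>j. D (x j) \<le> C" by blast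
  then show thesis using that[of C] Dx_pos[of 0] by (meson less_le_trans)
qed

text \<open>The mirror image: along a subsequence of rapidly decreasing norms the coefficients
  \<open>1 / D (x j)\<close> give an absolutely convergent series, but the terms of the original one
  have norm 1.\<close>

lemma Dx_bounded_below: obtains c where "c > 0" "\<And>j. D (x j) \<ge> c"
proof -
  have "\<exists>c>0. \<forall>j. D (x j) \<ge> c"
  proof (rule ccontr)
    assume "\<not> ?thesis"
    then have unb: "\<exists>j. D (x j) < c" if "c > 0" for c using that by (meson not_less)
    have "\<exists>n\<ge>L. D (x n) \<le> (1/2) ^ j * D (x j)" for j L
    proof (rule ccontr)
      assume "\<not> ?thesis"
      then have big: "D (x n) > (1/2) ^ j * D (x j)" if "n \<ge> L" for n using that by (meson not_less)
      define c where "c = Min (insert ((1/2) ^ j * D (x j)) ((\<lambda>n. D (x n)) ` {..<L}))"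
      have "c > 0" unfolding c_def using Dx_pos by (subst Min_gr_iff) auto
      then obtain n where n: "D (x n) < c" using unb by blast
      show False
      proof (cases "n \<ge> L")
        case True
        have "c \<le> (1/2) ^ j * D (x j)" unfolding c_def by (intro Min_le) auto
        then show ?thesis using big[OF True] n by linarith
      next
        case False
        then have "c \<le> D (x n)" unfolding c_def by (intro Min_le) auto
        then show ?thesis using n by linarith
      qed
    qed
    then obtain f where f: "strict_mono f" "\<And>j. D (x (f j)) \<le> (1/2) ^ j * D (x j)"
      by (rule subseq_choice[where P="\<lambda>j n. D (x n) \<le> (1/2) ^ j * D (x j)"]) (rule that)
    define a where "a = (\<lambda>j. 1 / D (x j))"
    have "cauchy_series (x \<circ> f) a"
    proof (rule cauchy_series_summable)
      show "summable (\<lambda>j. \<bar>a j\<bar> * D ((x \<circ> f) j))"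
      proof (rule summable_comparison_test'[of "\<lambda>j. (1/2::real) ^ j" 0])
        fix j :: nat
        have "D (x (f j)) / D (x j) \<le> (1/2) ^ j" using f(2)[of j] Dx_pos[of j] by (subst pos_divide_le_eq)
        then show "norm (\<bar>a j\<bar> * D ((x \<circ> f) j)) \<le> (1/2) ^ j"
          using Dx_pos[of j] Dx_pos[of "f j"] by (simp add: a_def abs_mult)
      qed (simp add: summable_geometric)
    qed (simp add: xTD)
    then have "cauchy_series x a" using subseq[OF f(1)] by simp
    then have "(\<lambda>j. \<bar>a j\<bar> * D (x j)) \<longlonglongrightarrow> 0" by (rule cauchy_series_terms[OF _ xTD])
    moreover have "\<bar>a j\<bar> * D (x j) = 1" for j using Dx_pos[of j] by (simp add: a_def)
    ultimately show False by (simp add: LIMSEQ_const_iff)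
  qed
  then show thesis using that by blast
qed

end

lemma blocks_cut: "mono u \<Longrightarrow> blocks u (\<lambda>j. cut u j (d j))"
  by (auto simp: blocks_def restr_def split: if_splits)

lemma blocks_subseq:
  assumes "blocks u f" "strict_mono g" shows "blocks (u \<circ> g) (f \<circ> g)"
  unfolding blocks_def
proof (intro conjI allI impI)
  have um: "mono u" using blocks_mono[OF assms(1)] .
  show "mono (u \<circ> g)" using um strict_mono_mono[OF assms(2)] by (simp add: mono_def)
  fix j i assume "(f \<circ> g) j i \<noteq> 0"
  then have *: "u (g j) \<le> i" "i < u (Suc (g j))" using assms(1) by (auto simp: blocks_def)
  have "Suc (g j) \<le> g (Suc j)" using assms(2) by (simp add: strict_mono_Suc_iff Suc_leI)
  then have "u (Suc (g j)) \<le> u (g (Suc j))" using um by (rule monoD[rotated])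
  then show "(u \<circ> g) j \<le> i" "i < (u \<circ> g) (Suc j)" using * by auto
qed

section \<open>Interleaved differences, and blocks with large coordinates\<close>

context tirilman
begin

text \<open>A zero term would give the zero vector a second expansion, with coefficients
  \<open>estar j\<close>.\<close>

lemma basic_nonzero:
  assumes "basic p \<gamma> x" shows "x j \<noteq> (\<lambda>i. 0)"
proof
  assume z: "x j = (\<lambda>i. 0)"
  have "psum x c 0 = (\<lambda>i. 0)" for c by (simp add: psum_def)
  then have "(\<lambda>i. 0) \<in> cspan p \<gamma> x" unfolding cspan_def by (auto intro!: exI[of _ 0])
  then have ex1: "\<exists>!a. series_to p \<gamma> x a (\<lambda>i. 0)" using assms by (auto simp: basic_def)
  have "psum x (\<lambda>i. 0) n = (\<lambda>i. 0)" for n by (simp add: psum_def)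
  then have 1: "series_to p \<gamma> x (\<lambda>i. 0) (\<lambda>i. 0)" by (simp add: series_to_def)
  have "psum x (estar j) n = (\<lambda>i. 0)" for n
    unfolding psum_def by (intro ext sum.neutral) (auto simp: estar_def z)
  then have 2: "series_to p \<gamma> x (estar j) (\<lambda>i. 0)" by (simp add: series_to_def)
  have "estar j = (\<lambda>i. 0)" using ex1 1 2 by blast
  then have "estar j j = 0" by simp
  then show False by (simp add: estar_def)
qed

text \<open>Turns a series of differences into a series in the vectors themselves, to which
  subsymmetry can be applied. After an odd number of terms one unmatched summand is left over; it
  vanishes in the limit because \<open>a\<close> tends to zero and the \<open>y j\<close> are
  bounded.\<close>

lemma interleave_cauchy:
  assumes y: "\<And>j. y j \<in> TD" "\<And>j. D (y j) \<le> C" and a: "a \<longlonglongrightarrow> 0"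
    and c: "cauchy_series (\<lambda>j i. y (2 * j) i - y (2 * j + 1) i) a"
  shows "cauchy_series y (\<lambda>m. (if even m then 1 else -1) * a (m div 2))"
proof -
  define b where "b = (\<lambda>m. (if even m then 1 else -1) * a (m div 2))"
  define d where "d = (\<lambda>j i. y (2 * j) i - y (2 * j + 1) i)"
  define r where "r = (\<lambda>n i. if odd n then a (n div 2) * y (n - 1) i else 0)"
  have ps: "psum y b n i = psum d a (n div 2) i + r n i" for n i
  proof (induction n)
    case 0 then show ?case by (simp add: psum_def r_def)
  next
    case (Suc n)
    show ?case
    proof (cases "even n")
      case True
      then have "Suc n div 2 = n div 2" by simp
      then show ?thesis using Suc True by (simp add: psum_def r_def b_def)
    next
      case False
      then obtain k where k: "n = 2 * k + 1" by (elim oddE)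
      then show ?thesis using Suc by (simp add: psum_def r_def b_def d_def algebra_simps)
    qed
  qed
  have C0: "C \<ge> 0" using y(2)[of 0] D_nonneg[OF y(1), of 0] by linarith
  have rTD: "r n \<in> TD" for n unfolding r_def using D_scale_le(1)[OF y(1)] by (cases "odd n") auto
  have Dr: "D (r n) \<le> \<bar>a (n div 2)\<bar> * C" for n
  proof (cases "odd n")
    case True
    then have "D (r n) = \<bar>a (n div 2)\<bar> * D (y (n - 1))" unfolding r_def using D_scale[OF y(1)] by simp
    then show ?thesis using y(2)[of "n - 1"] by (simp add: mult_left_mono)
  qed (simp add: r_def C0)
  have dTD: "d j \<in> TD" for j unfolding d_def by (intro D_diff y)
  have "cauchy_series y b" unfolding cauchy_series_def
  proof (intro allI impI)
    fix \<epsilon> :: real assume \<epsilon>: "\<epsilon> > 0"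
    then have e: "\<epsilon> / 3 > 0" "\<epsilon> / 3 / (C + 1) > 0" using C0 by auto
    obtain M1 where M1: "\<And>m n. M1 \<le> m \<Longrightarrow> m \<le> n \<Longrightarrow> D (lincomb d a {m..<n}) < \<epsilon> / 3"
      using c e(1) unfolding cauchy_series_def d_def by meson
    obtain M2 where M2: "\<And>n. n \<ge> M2 \<Longrightarrow> \<bar>a n\<bar> < \<epsilon> / 3 / (C + 1)"
      using LIMSEQ_D[OF a e(2)] by auto
    have r: "D (r n) < \<epsilon> / 3" if "n div 2 \<ge> M2" for n
    proof -
      have "\<bar>a (n div 2)\<bar> * (C + 1) < \<epsilon> / 3" 
        using M2[OF that] C0 by (subst (asm) pos_less_divide_eq) auto
      moreover have "\<bar>a (n div 2)\<bar> * C \<le> \<bar>a (n div 2)\<bar> * (C + 1)" by (intro mult_left_mono) auto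
      ultimately show ?thesis using Dr[of n] by linarith
    qed
    have "D (lincomb y b {m..<n}) < \<epsilon>" if mn: "2 * max M1 M2 \<le> m" "m \<le> n" for m n
    proof -
      have div: "M1 \<le> m div 2" "M2 \<le> m div 2" "m div 2 \<le> n div 2" using mn by (auto simp: div_le_mono)
      have "lincomb y b {m..<n} = (\<lambda>i. lincomb d a {m div 2..<n div 2} i + (r n i - r m i))"
        unfolding lincomb_diff[OF mn(2)] lincomb_diff[OF div(3)] ps by (simp add: algebra_simps)
      then have "D (lincomb y b {m..<n}) \<le> D (lincomb d a {m div 2..<n div 2}) + D (\<lambda>i. r n i - r m i)"
        by (simp only:) (intro D_add D_diff D_lincomb dTD rTD)
      also have "D (\<lambda>i. r n i - r m i) \<le> D (r n) + D (r m)" by (intro D_diff rTD)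
      finally show ?thesis using M1[OF div(1,3)] r[of n] r[of m] div by linarith
    qed
    then show "\<exists>M. \<forall>m n. M \<le> m \<longrightarrow> m \<le> n \<longrightarrow> D (lincomb y b {m..<n}) < \<epsilon>" by blast
  qed
  then show ?thesis by (simp add: b_def)
qed

text \<open>Keeping only the coordinate \<open>s j\<close> of each block leaves multiples of unit
  vectors with factors at least \<delta>; by \<open>D_mono\<close> the blocks dominate these, and a
  subsequence of the unit vectors is equivalent to the whole.\<close>

lemma equivalent_large_coordinates:
  assumes f: "blocks u f" and g: "strict_mono g" and u: "strict_mono u"
    and s: "\<And>j. \<bar>f (g j) (s j)\<bar> \<ge> \<delta>" and \<delta>: "\<delta> > 0"
    and C: "cauchy_series (f \<circ> g) a"
  shows "cauchy_series estar a"
proof -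
  have sin: "u (g j) \<le> s j" "s j < u (Suc (g j))" for j
    using f s[of j] \<delta> by (auto simp: blocks_def)
  have sm: "strict_mono s"
    unfolding strict_mono_Suc_iff
  proof
    fix j
    have "Suc (g j) \<le> g (Suc j)" using g by (simp add: strict_mono_Suc_iff Suc_leI)
    then have "u (Suc (g j)) \<le> u (g (Suc j))" using blocks_mono[OF f] by (rule monoD[rotated])
    then show "s j < s (Suc j)" using sin(2)[of j] sin(1)[of "Suc j"] by linarith
  qed
  have fg: "blocks (u \<circ> g) (f \<circ> g)" by (rule blocks_subseq[OF f g])
  have "D (lincomb (estar \<circ> s) a {m..<n}) \<le> (1/\<delta>) * D (lincomb (f \<circ> g) a {m..<n})" for m n
  proof -
    let ?F = "{m..<n}"
    have TDl: "lincomb (f \<circ> g) a ?F \<in> TD" by (intro D_lincomb blocks_TD[OF fg])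
    have "D (lincomb (estar \<circ> s) a ?F) \<le> D (\<lambda>i. (1/\<delta>) * lincomb (f \<circ> g) a ?F i)"
    proof (rule D_mono(2)[OF D_scale_le(1)[OF TDl]])
      fix i
      show "\<bar>lincomb (estar \<circ> s) a ?F i\<bar> \<le> \<bar>(1/\<delta>) * lincomb (f \<circ> g) a ?F i\<bar>"
      proof (cases "lincomb (estar \<circ> s) a ?F i = 0")
        case False
        then obtain j where j: "j \<in> ?F" "a j * (estar \<circ> s) j i \<noteq> 0"
          unfolding lincomb_def by (rule sum.not_neutral_contains_not_neutral)
        then have i: "i = s j" by (auto simp: estar_def split: if_splits)
        have "lincomb (estar \<circ> s) a ?F i = (\<Sum>k\<in>?F. if k = j then a j else 0)"
          unfolding lincomb_def i using strict_mono_eq[OF sm] by (intro sum.cong) (auto simp: estar_def)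
        then have 1: "lincomb (estar \<circ> s) a ?F i = a j" using j(1) by simp
        have "Suc (g j) \<le> g (Suc j)" using g by (simp add: strict_mono_Suc_iff Suc_leI)
        then have "u (Suc (g j)) \<le> u (g (Suc j))" using blocks_mono[OF f] by (rule monoD[rotated])
        then have "lincomb (f \<circ> g) a ?F i = (if j \<in> ?F then a j * (f \<circ> g) j i else 0)"
          using sin[of j] i by (intro blocks_lincomb_apply[OF fg]) auto
        then have 2: "lincomb (f \<circ> g) a ?F i = a j * f (g j) (s j)" using j(1) i by simp
        have "\<bar>a j\<bar> * \<delta> \<le> \<bar>a j\<bar> * \<bar>f (g j) (s j)\<bar>" using s by (intro mult_left_mono) auto
        then show ?thesis unfolding 1 2 using \<delta> by (simp add: abs_mult pos_le_divide_eq)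
      qed simp
    qed
    also have "\<dots> = \<bar>1/\<delta>\<bar> * D (lincomb (f \<circ> g) a ?F)" by (rule D_scale[OF TDl])
    finally show ?thesis using \<delta> by simp
  qed
  then have "cauchy_series (estar \<circ> s) a" by (intro cauchy_series_dominated[OF C, of "1/\<delta>"]) (use \<delta> in auto)
  then show ?thesis using cauchy_estar_subseq[OF sm] by simp
qed

end

section \<open>Exclusion of flat subsymmetric block sequences\<close>

context tirilman_small
begin

text \<open>Combinations of \<open>q\<close>-mass 1 and norm at least \<open>2 ^ k\<close> are glued
  with weights \<open>(1/2) ^ k\<close> into coefficients \<open>a\<close> whose series in
  \<open>f\<close> diverges. Along a sufficiently sparse subsequence the blocks are so flat that
  \<open>D_flat_blocks\<close> bounds every piece uniformly, so the same coefficients converge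
  there.\<close>

lemma no_subsymmetric_flat_blocks:
  assumes f: "blocks u f" and C: "C > 0" "\<And>j. D (f j) \<le> C" and c: "c > 0" "\<And>j. D (f j) \<ge> c"
    and sub: "\<And>g a. strict_mono g \<Longrightarrow> cauchy_series (f \<circ> g) a \<Longrightarrow> cauchy_series f a"
    and flat: "\<And>\<delta>. \<delta> > 0 \<Longrightarrow> \<exists>L. \<forall>j\<ge>L. \<forall>s. \<bar>f j s\<bar> < \<delta>"
  shows False
proof -
  have fTD: "f j \<in> TD" for j using blocks_TD[OF f] .
  define good where "good = (\<lambda>k L bF. finite (snd bF) \<and> snd bF \<subseteq> {L..} \<and> (\<forall>j. fst bF j \<ge> (0::real))
    \<and> (\<Sum>j\<in>snd bF. fst bF j powr q) = 1 \<and> D (lincomb f (fst bF) (snd bF)) \<ge> 2 ^ (k::nat))"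
  have "\<exists>bF. good k L bF" for k L
  proof -
    have "(2::real) ^ k > 0" by simp
    from f c this show ?thesis
    proof (rule no_upper_q_estimate)
      fix F b
      assume "finite F" "F \<subseteq> {L..}" "\<And>j. b j \<ge> (0::real)" "(\<Sum>j\<in>F. b j powr q) = 1" "D (lincomb f b F) \<ge> 2 ^ k"
      then show ?thesis by (intro exI[of _ "(b, F)"]) (simp add: good_def)
    qed
  qed
  then obtain bF' where "\<And>k L. good k L (bF' k L)" by metis
  then have bF: "\<And>k L. finite (snd (bF' k L))" "\<And>k L. snd (bF' k L) \<subseteq> {L..}" "\<And>k L j. fst (bF' k L) j \<ge> 0"
    "\<And>k L. (\<Sum>j\<in>snd (bF' k L). fst (bF' k L) j powr q) = 1"
    "\<And>k L. D (lincomb f (fst (bF' k L)) (snd (bF' k L))) \<ge> 2 ^ k"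
    unfolding good_def by blast+
  obtain l where l: "strict_mono l" and l0: "l 0 = 0" and Fl: "\<And>k. snd (bF' k (l k)) \<subseteq> {l k..<l (Suc k)}"
    using consecutive_cuts[of "\<lambda>k L. snd (bF' k L)" 0] bF(1,2) by blast
  have l1: "l (Suc k) \<ge> 1" for k using strict_mono_imp_increasing[OF l, of "Suc k"] by simp
  define F where "F = (\<lambda>k. snd (bF' k (l k)))"
  define b where "b = (\<lambda>k. fst (bF' k (l k)))"
  have Fsub: "F k \<subseteq> {l k..<l (Suc k)}" for k using Fl by (simp add: F_def)
  obtain blk where blk: "\<And>k i. i \<in> {l k..<l (Suc k)} \<Longrightarrow> blk i = k"
    by (rule block_index[OF strict_mono_mono[OF l]]) (rule that)
  define a where "a = (\<lambda>j. (1/2) ^ blk j * (if j \<in> F (blk j) then b (blk j) j else 0))"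
  have aF: "lincomb y a A = (\<lambda>i. (1/2) ^ k * lincomb y (b k) (A \<inter> F k) i)" if A: "A \<subseteq> {l k..<l (Suc k)}" for k A y
  proof
    fix i
    have "finite A" using A finite_subset by blast
    have "lincomb y a A i = (\<Sum>j\<in>A. if j \<in> F k then (1/2) ^ k * (b k j * y j i) else 0)"
      unfolding lincomb_def using A blk by (intro sum.cong) (auto simp: a_def subset_iff)
    also have "\<dots> = (\<Sum>j\<in>A \<inter> F k. (1/2) ^ k * (b k j * y j i))"
      using \<open>finite A\<close> by (rule sum.inter_restrict[symmetric])
    finally show "lincomb y a A i = (1/2) ^ k * lincomb y (b k) (A \<inter> F k) i" by (simp add: lincomb_def sum_distrib_left)
  qed
  \<comment> \<open>The flatness demanded of the block used at index \<open>j\<close> is set by the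
    right end \<open>l (Suc (blk j))\<close> of its piece, since \<open>D_flat_blocks\<close> will
    be applied with that number as \<open>m\<close>. The scale \<open>C\<close> is removed later by
    passing to \<open>f'\<close>.\<close>
  have "\<exists>n\<ge>L. \<forall>s. \<bar>f n s\<bar> \<le> C * real (l (Suc (blk j))) powr (-1/q)" for j L
  proof -
    have "C * real (l (Suc (blk j))) powr (-1/q) > 0" using C(1) l1[of "blk j"] by simp
    from flat[OF this] obtain L' where "\<forall>n\<ge>L'. \<forall>s. \<bar>f n s\<bar> < C * real (l (Suc (blk j))) powr (-1/q)" by blast
    then show ?thesis by (intro exI[of _ "max L L'"]) (auto intro: less_imp_le)
  qed
  then obtain g where g: "strict_mono g" "\<And>j. \<forall>s. \<bar>f (g j) s\<bar> \<le> C * real (l (Suc (blk j))) powr (-1/q)"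
    by (rule subseq_choice[where P="\<lambda>j n. \<forall>s. \<bar>f n s\<bar> \<le> C * real (l (Suc (blk j))) powr (-1/q)"]) (rule that)
  define f' where "f' = (\<lambda>j i. (1/C) * (f \<circ> g) j i)"
  have fg: "blocks (u \<circ> g) (f \<circ> g)" by (rule blocks_subseq[OF f g(1)])
  have f': "blocks (u \<circ> g) f'" using fg by (auto simp: blocks_def f'_def)
  have "cauchy_series (f \<circ> g) a"
  proof (rule cauchy_series_pieces[OF _ l l0])
    show "summable (\<lambda>k. (1/2::real) ^ k * (C * CS))" by (intro summable_mult2 summable_geometric) simp
    show "(1/2::real) ^ k * (C * CS) \<ge> 0" for k using CS_pos C by simp
    fix k A assume A: "A \<subseteq> {l k..<l (Suc k)}"
    have finA: "finite A" using A finite_subset by blast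
    have "D (lincomb f' (b k) (A \<inter> F k)) \<le> CS"
    proof (rule D_flat_blocks[OF f' _ l1])
      show "A \<inter> F k \<subseteq> {..<l (Suc k)}" using A by auto
      fix j assume j: "j \<in> A \<inter> F k"
      then have bj: "blk j = k" using A blk by blast
      have "D (f' j) = \<bar>1/C\<bar> * D (f (g j))" unfolding f'_def o_apply by (rule D_scale[OF fTD])
      also have "\<dots> \<le> \<bar>1/C\<bar> * C" using C by (intro mult_left_mono) auto
      finally show "D (f' j) \<le> 1" using C by simp
      fix s
      have "\<bar>f (g j) s\<bar> \<le> C * real (l (Suc k)) powr (-1/q)" using g(2)[of j] bj by simp
      then have "(1/C) * \<bar>f (g j) s\<bar> \<le> (1/C) * (C * real (l (Suc k)) powr (-1/q))" using C by (intro mult_left_mono) auto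
      then show "\<bar>f' j s\<bar> \<le> real (l (Suc k)) powr (-1/q)" using C by (simp add: f'_def abs_mult)
    next
      have "(\<Sum>j\<in>A \<inter> F k. \<bar>b k j\<bar> powr q) = (\<Sum>j\<in>A \<inter> F k. b k j powr q)"
        using bF(3) by (intro sum.cong) (auto simp: b_def)
      also have "\<dots> \<le> (\<Sum>j\<in>F k. b k j powr q)" using bF(1) by (intro sum_mono2) (auto simp: F_def)
      finally show "(\<Sum>j\<in>A \<inter> F k. \<bar>b k j\<bar> powr q) \<le> 1" using bF(4) by (simp add: F_def b_def)
    qed
    moreover have "lincomb (f \<circ> g) (b k) (A \<inter> F k) = (\<lambda>i. C * lincomb f' (b k) (A \<inter> F k) i)"
      unfolding f'_def lincomb_scale_vectors using C by simp
    then have "D (lincomb (f \<circ> g) (b k) (A \<inter> F k)) = \<bar>C\<bar> * D (lincomb f' (b k) (A \<inter> F k))"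
      by (simp only:) (rule D_scale[OF D_lincomb(1)[OF blocks_TD[OF f']]])
    ultimately have small: "D (lincomb (f \<circ> g) (b k) (A \<inter> F k)) \<le> C * CS" using C by (simp add: mult_left_mono)
    have "D (lincomb (f \<circ> g) a A) = \<bar>(1/2) ^ k\<bar> * D (lincomb (f \<circ> g) (b k) (A \<inter> F k))"
      unfolding aF[OF A] by (rule D_scale[OF D_lincomb(1)[OF blocks_TD[OF fg]]])
    then show "D (lincomb (f \<circ> g) a A) \<le> (1/2) ^ k * (C * CS)" using mult_left_mono[OF small, of "(1/2) ^ k"] by simp
  qed (rule blocks_TD[OF fg])
  then have "cauchy_series f a" by (rule sub[OF g(1)])
  then obtain M where M: "\<And>m n. M \<le> m \<Longrightarrow> m \<le> n \<Longrightarrow> D (lincomb f a {m..<n}) < 1"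
    unfolding cauchy_series_def by (meson zero_less_one)
  have "M \<le> l M" using strict_mono_imp_increasing[OF l] .
  then have less: "D (lincomb f a {l M..<l (Suc M)}) < 1"
    using strict_mono_mono[OF l] by (intro M) (auto simp: monoD)
  have "{l M..<l (Suc M)} \<inter> F M = F M" using Fsub by blast
  then have "D (lincomb f a {l M..<l (Suc M)}) = \<bar>(1/2) ^ M\<bar> * D (lincomb f (b M) (F M))"
    unfolding aF[OF order_refl] using D_scale[OF D_lincomb(1)[where F="F M", OF fTD]] by simp
  moreover have "(1/2) ^ M * 2 ^ M \<le> (1/2) ^ M * D (lincomb f (b M) (F M))"
    using bF(5)[where k=M and L="l M"] by (intro mult_left_mono) (simp_all add: F_def b_def)
  moreover have "(1/2::real) ^ M * 2 ^ M = 1" by (simp add: power_mult_distrib[symmetric])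
  ultimately show False using less by simp
qed

end

section \<open>Null coordinates and equivalence with the unit vectors\<close>

context subsymmetric_basis
begin

text \<open>Along a subsequence with \<open>i\<close>-th coordinates at least \<delta> in absolute
  value, unconditionality bounds all finite sums of the \<open>a j * x (g j) i\<close> far out.
  Splitting by sign then bounds the sums of absolute values by 2, hence those of
  \<open>\<bar>a j\<bar>\<close> by \<open>2 / \<delta>\<close>.\<close>

lemma coordinates_null_or_l1:
  assumes "\<not> (\<lambda>j. x j i) \<longlonglongrightarrow> 0" and C: "cauchy_series x a"
  shows "summable (\<lambda>j. \<bar>a j\<bar>)"
proof -
  obtain \<delta> where \<delta>: "\<delta> > 0" "\<And>L. \<exists>j\<ge>L. \<bar>x j i\<bar> \<ge> \<delta>"
    using assms(1) unfolding LIMSEQ_iff by (auto simp: not_less)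
  from \<delta>(2) obtain g :: "nat \<Rightarrow> nat" where g: "strict_mono g" "\<And>j. \<bar>x (g j) i\<bar> \<ge> \<delta>"
    by (rule subseq_choice[where P="\<lambda>_ n. \<bar>x n i\<bar> \<ge> \<delta>"]) (rule that)
  have injg: "inj g" using g(1) by (rule strict_mono_imp_inj_on)
  have Cg: "cauchy_series (x \<circ> g) a" using C subseq[OF g(1)] by simp
  \<comment> \<open>Unconditionality is assumed for \<open>x\<close>, so the series along
    \<open>g\<close> is rewritten as a series in \<open>x\<close> with zero coefficients off the
    range of \<open>g\<close>.\<close>
  define a' where "a' = (\<lambda>i. if i \<in> range g then a (inv g i) else 0)"
  have a'g: "a' \<circ> g = a" using injg by (auto simp: a'_def)
  have "cauchy_series x a'" unfolding cauchy_series_def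
  proof (intro allI impI)
    fix \<epsilon> :: real assume "\<epsilon> > 0"
    then obtain M where M: "\<And>m n. M \<le> m \<Longrightarrow> m \<le> n \<Longrightarrow> D (lincomb (x \<circ> g) a {m..<n}) < \<epsilon>"
      using Cg unfolding cauchy_series_def by meson
    have "D (lincomb x a' {m..<n}) < \<epsilon>" if mn: "g M \<le> m" "m \<le> n" for m n
    proof -
      define s where "s = (\<lambda>v. LEAST k. v \<le> g k)"
      have s: "v \<le> g k \<longleftrightarrow> s v \<le> k" for k v unfolding s_def by (rule strict_mono_Least_iff[OF g(1)])
      have img: "g ` {s m..<s n} = {m..<n} \<inter> range g"
        using s by (auto simp: not_le[symmetric])
      have "lincomb x a' {m..<n} = lincomb x a' (g ` {s m..<s n})"
        unfolding lincomb_def img by (intro ext sum.mono_neutral_right) (auto simp: a'_def)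
      also have "\<dots> = lincomb (x \<circ> g) a {s m..<s n}"
        using lincomb_reindex[of g "{s m..<s n}" x a'] inj_on_subset[OF injg subset_UNIV] a'g by simp
      finally have eq: "lincomb x a' {m..<n} = lincomb (x \<circ> g) a {s m..<s n}" .
      have "M \<le> s m"
      proof (rule ccontr)
        assume "\<not> M \<le> s m"
        then have "g (s m) < g M" using g(1) by (simp add: strict_monoD)
        moreover have "m \<le> g (s m)" using s by simp
        ultimately show False using mn by simp
      qed
      moreover have "s m \<le> s n" using s mn by (meson order_refl order_trans)
      ultimately show ?thesis unfolding eq by (rule M)
    qed
    then show "\<exists>M. \<forall>m n. M \<le> m \<longrightarrow> m \<le> n \<longrightarrow> D (lincomb x a' {m..<n}) < \<epsilon>" by blast
  qed
  from unconditional_cauchy[OF xTD unc this zero_less_one]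
  obtain M where M: "\<And>G. finite G \<Longrightarrow> G \<subseteq> {M..} \<Longrightarrow> D (lincomb x a' G) < 1" by blast
  have sums: "\<bar>\<Sum>j\<in>J. a j * x (g j) i\<bar> < 1" if J: "finite J" "J \<subseteq> {M..}" for J
  proof -
    have "g ` J \<subseteq> {M..}"
    proof (rule image_subsetI)
      fix j assume "j \<in> J"
      then have "M \<le> j" using J by auto
      also have "j \<le> g j" using strict_mono_imp_increasing[OF g(1)] .
      finally show "g j \<in> {M..}" by simp
    qed
    then have "D (lincomb x a' (g ` J)) < 1" using J by (intro M) auto
    moreover have "lincomb x a' (g ` J) = lincomb (x \<circ> g) a J"
      using lincomb_reindex[of g J x a'] inj_on_subset[OF injg subset_UNIV] a'g by simp
    moreover have "\<bar>lincomb (x \<circ> g) a J i\<bar> \<le> D (lincomb (x \<circ> g) a J)"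
      by (intro D_abs_le D_lincomb) (simp add: xTD)
    ultimately show ?thesis by (simp add: lincomb_def)
  qed
  have bounded: "(\<Sum>j\<in>J. \<bar>a j\<bar>) \<le> 2 / \<delta>" if J: "finite J" "J \<subseteq> {M..}" for J
  proof -
    let ?w = "\<lambda>j. a j * x (g j) i"
    have "(\<Sum>j\<in>J. \<bar>?w j\<bar>) = (\<Sum>j\<in>{j\<in>J. ?w j \<ge> 0}. \<bar>?w j\<bar>) + (\<Sum>j\<in>{j\<in>J. \<not> ?w j \<ge> 0}. \<bar>?w j\<bar>)"
      using J by (subst sum.union_disjoint[symmetric]) (auto intro!: sum.cong)
    also have "(\<Sum>j\<in>{j\<in>J. ?w j \<ge> 0}. \<bar>?w j\<bar>) = (\<Sum>j\<in>{j\<in>J. ?w j \<ge> 0}. ?w j)" by (intro sum.cong) auto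
    also have "(\<Sum>j\<in>{j\<in>J. \<not> ?w j \<ge> 0}. \<bar>?w j\<bar>) = - (\<Sum>j\<in>{j\<in>J. \<not> ?w j \<ge> 0}. ?w j)"
      by (subst sum_negf[symmetric]) (intro sum.cong, auto)
    finally have "(\<Sum>j\<in>J. \<bar>?w j\<bar>) \<le> 2"
      using sums[of "{j\<in>J. ?w j \<ge> 0}"] sums[of "{j\<in>J. \<not> ?w j \<ge> 0}"] J by force
    moreover have "(\<Sum>j\<in>J. \<delta> * \<bar>a j\<bar>) \<le> (\<Sum>j\<in>J. \<bar>?w j\<bar>)"
    proof (rule sum_mono)
      fix j
      show "\<delta> * \<bar>a j\<bar> \<le> \<bar>?w j\<bar>"
        using mult_right_mono[OF g(2)[of j], of "\<bar>a j\<bar>"] by (simp add: abs_mult mult.commute)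
    qed
    ultimately have "\<delta> * (\<Sum>j\<in>J. \<bar>a j\<bar>) \<le> 2" by (simp add: sum_distrib_left)
    then show ?thesis using \<delta> by (simp add: pos_le_divide_eq mult.commute)
  qed
  have tail: "(\<Sum>j\<in>{M..<n}. \<bar>a j\<bar>) \<le> 2 / \<delta>" for n by (rule bounded) auto
  show ?thesis
  proof (rule summableI_nonneg_bounded)
    fix n
    have "(\<Sum>j<n. \<bar>a j\<bar>) \<le> (\<Sum>j\<in>{..<M} \<union> {M..<n}. \<bar>a j\<bar>)" by (intro sum_mono2) auto
    also have "\<dots> = (\<Sum>j<M. \<bar>a j\<bar>) + (\<Sum>j\<in>{M..<n}. \<bar>a j\<bar>)" by (intro sum.union_disjoint) auto
    finally show "(\<Sum>j<n. \<bar>a j\<bar>) \<le> (\<Sum>j<M. \<bar>a j\<bar>) + 2 / \<delta>" using tail[of n] by simp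
  qed simp
qed

text \<open>If some coordinate does not tend to zero, the series would only converge for absolutely
  summable coefficients; but differences of a coordinatewise convergent subsequence are close to
  blocks, whose series converge for harmonic coefficients.\<close>

lemma coordinates_null: "(\<lambda>j. x j i) \<longlonglongrightarrow> 0"
proof (rule ccontr)
  assume nn: "\<not> (\<lambda>j. x j i) \<longlonglongrightarrow> 0"
  obtain C where C: "C > 0" "\<And>j. D (x j) \<le> C" using Dx_bounded by blast
  have "\<bar>x j i\<bar> \<le> C" for j i using D_abs_le[OF xTD, of j i] C(2)[of j] by linarith
  then obtain r where r: "strict_mono r" "\<And>i. convergent (\<lambda>j. x (r j) i)"
    by (rule coordinatewise_convergent_subseq) (rule that)
  \<comment> \<open>Differences along a coordinatewise convergent subsequence have null coordinates,
    whatever the limits are.\<close>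
  define d where "d = (\<lambda>j i. x (r (2 * j)) i - x (r (2 * j + 1)) i)"
  have dTD: "d j \<in> TD" for j unfolding d_def by (intro D_diff xTD)
  have DdC: "D (d j) \<le> 2 * C" for j
  proof -
    have "D (d j) \<le> D (x (r (2 * j))) + D (x (r (2 * j + 1)))" unfolding d_def by (intro D_diff xTD)
    then show ?thesis using C(2)[of "r (2 * j)"] C(2)[of "r (2 * j + 1)"] by linarith
  qed
  have null: "(\<lambda>j. d j i) \<longlonglongrightarrow> 0" for i
  proof -
    obtain L where L: "(\<lambda>j. x (r j) i) \<longlonglongrightarrow> L" using r(2)[of i] by (auto simp: convergent_def)
    have "strict_mono (\<lambda>j::nat. 2 * j)" "strict_mono (\<lambda>j::nat. 2 * j + 1)" by (auto simp: strict_mono_def)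
    from this[THEN LIMSEQ_subseq_LIMSEQ[OF L]]
    have "(\<lambda>j. x (r (2 * j)) i) \<longlonglongrightarrow> L" "(\<lambda>j. x (r (2 * j + 1)) i) \<longlonglongrightarrow> L" by (simp_all add: o_def)
    from tendsto_diff[OF this] show ?thesis by (simp add: d_def)
  qed
  obtain h u where hu: "strict_mono h" "strict_mono u"
    "\<And>j. D (\<lambda>i. cut u j (d (h j)) i - d (h j) i) \<le> 1 * (1/2) ^ j"
    by (rule gliding_hump[OF dTD null zero_less_one]) (rule that)
  define f where "f = (\<lambda>j. cut u j (d (h j)))"
  have f: "blocks u f" unfolding f_def by (rule blocks_cut[OF strict_mono_mono[OF hu(2)]])
  have fTD: "f j \<in> TD" for j using blocks_TD[OF f] .
  have Df: "D (f j) \<le> 2 * C" for j unfolding f_def using D_restr(2)[OF dTD] DdC order_trans by blast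
  define a where "a = (\<lambda>j. 1 / real (Suc j))"
  have "cauchy_series f a"
  proof (rule cauchy_series_dominated[of estar a "2 * C"])
    show "cauchy_series estar a" unfolding a_def by (rule cauchy_estar_harmonic)
    show "D (lincomb f a {m..<n}) \<le> 2 * C * D (lincomb estar a {m..<n})" for m n
      using Df C by (intro D_domination[OF hu(2) f]) auto
  qed (use C in simp)
  then have "cauchy_series (d \<circ> h) a"
  proof (rule cauchy_series_perturb[of _ _ _ 1])
    show "summable (\<lambda>j. D (\<lambda>i. (d \<circ> h) j i - f j i))"
    proof (rule summable_comparison_test'[of "\<lambda>j. (1/2::real) ^ j" 0])
      fix j :: nat
      have "D (\<lambda>i. (d \<circ> h) j i - f j i) \<le> (1/2) ^ j"
        using hu(3)[of j] D_minus_commute[OF fTD dTD, of j "h j"] by (simp add: f_def)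
      then show "norm (D (\<lambda>i. (d \<circ> h) j i - f j i)) \<le> (1/2) ^ j"
        using D_nonneg[OF D_diff(1)[OF dTD fTD], of "h j" j] by simp
    qed (simp add: summable_geometric)
  qed (auto simp: fTD dTD a_def)
  \<comment> \<open>Lists the indices \<open>2 * h k\<close> and \<open>2 * h k + 1\<close> in turn,
    so that consecutive pairs of \<open>y\<close> have the differences
    \<open>d (h k)\<close>.\<close>
  define h' where "h' = (\<lambda>m. 2 * h (m div 2) + m mod 2)"
  have h': "strict_mono h'"
  proof (unfold strict_mono_Suc_iff, intro allI)
    fix n
    show "h' n < h' (Suc n)"
    proof (cases "even n")
      case True
      then obtain k where "n = 2 * k" by (elim evenE)
      then show ?thesis by (simp add: h'_def)
    next
      case False
      then obtain k where "n = 2 * k + 1" by (elim oddE)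
      moreover have "h k < h (Suc k)" using hu(1) by (simp add: strict_mono_Suc_iff)
      ultimately show ?thesis by (simp add: h'_def)
    qed
  qed
  define y where "y = x \<circ> (r \<circ> h')"
  have "cauchy_series y (\<lambda>m. (if even m then 1 else -1) * a (m div 2))"
  proof (rule interleave_cauchy)
    show "y j \<in> TD" "D (y j) \<le> C" for j by (simp_all add: y_def xTD C)
    show "a \<longlonglongrightarrow> 0" unfolding a_def using LIMSEQ_inverse_real_of_nat by (simp add: inverse_eq_divide)
    have "(\<lambda>j i. y (2 * j) i - y (2 * j + 1) i) = d \<circ> h"
      by (intro ext) (simp add: y_def h'_def d_def)
    then show "cauchy_series (\<lambda>j i. y (2 * j) i - y (2 * j + 1) i) a" using \<open>cauchy_series (d \<circ> h) a\<close> by simp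
  qed
  then have "cauchy_series x (\<lambda>m. (if even m then 1 else -1) * a (m div 2))"
    unfolding y_def using subseq[of "r \<circ> h'"] r(1) h' by (simp add: strict_mono_o)
  from coordinates_null_or_l1[OF nn this]
  have s: "summable (\<lambda>m. \<bar>(if even m then 1 else -1) * a (m div 2)\<bar>)" .
  \<comment> \<open>Each harmonic coefficient occurs twice with opposite signs, so the absolute
    values dominate the harmonic series: \<open>Suc (n div 2) \<le> n\<close> for
    \<open>n \<ge> 1\<close>.\<close>
  have "summable (\<lambda>n. inverse (real n))"
  proof (rule summable_comparison_test'[OF s])
    fix n :: nat assume "n \<ge> 1"
    have "inverse (real n) \<le> 1 / real (Suc (n div 2))"
    proof -
      have "Suc (n div 2) \<le> n" using \<open>n \<ge> 1\<close> by linarith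
      then show ?thesis using \<open>n \<ge> 1\<close> by (simp add: inverse_eq_divide frac_le del: of_nat_Suc)
    qed
    then show "norm (inverse (real n)) \<le> \<bar>(if even n then 1 else -1) * a (n div 2)\<bar>"
      by (simp add: a_def abs_mult del: of_nat_Suc)
  qed
  then show False using not_summable_harmonic[where 'a=real] by blast
qed

text \<open>Domination by the unit vectors holds for any bounded block sequence. The reverse is a
  dichotomy on the sup norms of the blocks, and subsymmetry is needed in both cases to return from a
  subsequence of blocks to \<open>x\<close>.\<close>

lemma equivalent_estar: "cauchy_series x a \<longleftrightarrow> cauchy_series estar a"
proof -
  obtain C where C: "C > 0" "\<And>j. D (x j) \<le> C" using Dx_bounded by blast
  obtain c where c: "c > 0" "\<And>j. D (x j) \<ge> c" using Dx_bounded_below by blast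
  \<comment> \<open>Perturbing by at most \<open>c / 2\<close> leaves the blocks bounded below by
    \<open>c / 2\<close>.\<close>
  have c2: "c / 2 > 0" using c by simp
  obtain h u where hu: "strict_mono h" "strict_mono u"
    "\<And>j. D (\<lambda>i. cut u j (x (h j)) i - x (h j) i) \<le> c / 2 * (1/2) ^ j"
    by (rule gliding_hump[OF xTD coordinates_null c2]) (rule that)
  define f where "f = (\<lambda>j. cut u j (x (h j)))"
  have f: "blocks u f" unfolding f_def by (rule blocks_cut[OF strict_mono_mono[OF hu(2)]])
  have fTD: "f j \<in> TD" for j using blocks_TD[OF f] .
  have DfC: "D (f j) \<le> C" for j unfolding f_def using D_restr(2)[OF xTD] C(2) order_trans by blast
  have dist: "D (\<lambda>i. f j i - x (h j) i) \<le> c / 2 * (1/2) ^ j" "D (\<lambda>i. x (h j) i - f j i) \<le> c / 2 * (1/2) ^ j" for j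
    using hu(3)[of j] D_minus_commute[OF fTD xTD, of j "h j"] by (simp_all add: f_def)
  have Dfc: "D (f j) \<ge> c / 2" for j
  proof -
    have "D (\<lambda>i. f j i + (x (h j) i - f j i)) \<le> D (f j) + D (\<lambda>i. x (h j) i - f j i)"
      by (intro D_add D_diff fTD xTD)
    then have "D (x (h j)) \<le> D (f j) + c / 2 * (1/2) ^ j" using dist(2)[of j] by simp
    moreover have "c / 2 * (1/2) ^ j \<le> c / 2 * 1" using c by (intro mult_left_mono power_le_one) auto
    ultimately show ?thesis using c(2)[of "h j"] by simp
  qed
  \<comment> \<open>The perturbation argument needs bounded coefficients; these come from the
    convergence of whichever series is assumed, as both sequences are bounded below in norm.\<close>
  have EQ: "cauchy_series (f \<circ> g) a \<longleftrightarrow> cauchy_series x a" if g: "strict_mono g" for g a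
  proof -
    have sum: "summable (\<lambda>j. D (w j))" if w: "\<And>j. w j \<in> TD" "\<And>j. D (w j) \<le> c / 2 * (1/2) ^ g j" for w
    proof (rule summable_comparison_test'[of "\<lambda>j. c / 2 * (1/2::real) ^ j" 0])
      show "summable (\<lambda>j. c / 2 * (1/2::real) ^ j)" by (intro summable_mult summable_geometric) simp
      fix j :: nat
      have "c / 2 * (1/2) ^ g j \<le> c / 2 * (1/2) ^ j"
        using c strict_mono_imp_increasing[OF g, of j] by (intro mult_left_mono power_decreasing) auto
      then show "norm (D (w j)) \<le> c / 2 * (1/2) ^ j" using w(2)[of j] D_nonneg[OF w(1), of j] by simp
    qed
    have hg: "strict_mono (h \<circ> g)" using hu(1) g by (rule strict_mono_o)
    have "cauchy_series (f \<circ> g) a \<longleftrightarrow> cauchy_series (x \<circ> (h \<circ> g)) a"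
    proof
      assume A: "cauchy_series (f \<circ> g) a"
      then obtain B where B: "\<And>j. \<bar>a j\<bar> \<le> B" using cauchy_series_bounded[OF A, of "c / 2"] fTD Dfc c2 by auto
      show "cauchy_series (x \<circ> (h \<circ> g)) a"
      proof (rule cauchy_series_perturb[OF A _ _ _ B])
        show "summable (\<lambda>j. D (\<lambda>i. (x \<circ> (h \<circ> g)) j i - (f \<circ> g) j i))"
        proof (rule sum)
          fix j
          show "(\<lambda>i. (x \<circ> (h \<circ> g)) j i - (f \<circ> g) j i) \<in> TD" by (intro D_diff) (simp_all add: fTD xTD)
          show "D (\<lambda>i. (x \<circ> (h \<circ> g)) j i - (f \<circ> g) j i) \<le> c / 2 * (1/2) ^ g j"
            using dist(2)[of "g j"] by (simp only: o_apply)
        qed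
      qed (simp_all add: fTD xTD)
    next
      assume A: "cauchy_series (x \<circ> (h \<circ> g)) a"
      then obtain B where B: "\<And>j. \<bar>a j\<bar> \<le> B" using cauchy_series_bounded[OF A, of c] xTD c by auto
      show "cauchy_series (f \<circ> g) a"
      proof (rule cauchy_series_perturb[OF A _ _ _ B])
        show "summable (\<lambda>j. D (\<lambda>i. (f \<circ> g) j i - (x \<circ> (h \<circ> g)) j i))"
        proof (rule sum)
          fix j
          show "(\<lambda>i. (f \<circ> g) j i - (x \<circ> (h \<circ> g)) j i) \<in> TD" by (intro D_diff) (simp_all add: fTD xTD)
          show "D (\<lambda>i. (f \<circ> g) j i - (x \<circ> (h \<circ> g)) j i) \<le> c / 2 * (1/2) ^ g j"
            using dist(1)[of "g j"] by (simp only: o_apply)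
        qed
      qed (simp_all add: fTD xTD)
    qed
    then show ?thesis using subseq[OF hg] by simp
  qed
  have EQ1: "cauchy_series f a \<longleftrightarrow> cauchy_series x a" for a using EQ[of id a] by (simp add: strict_mono_def)
  show ?thesis
  proof
    assume X: "cauchy_series x a"
    show "cauchy_series estar a"
    \<comment> \<open>The negation says that the sup norms of the \<open>f j\<close> tend to zero,
      which is the flatness hypothesis of \<open>no_subsymmetric_flat_blocks\<close>.\<close>
    proof (cases "\<exists>\<delta>>0. \<forall>L. \<exists>j\<ge>L. \<exists>s. \<bar>f j s\<bar> \<ge> \<delta>")
      case True
      then obtain \<delta> where \<delta>: "\<delta> > 0" "\<And>L. \<exists>j\<ge>L. \<exists>s. \<bar>f j s\<bar> \<ge> \<delta>" by blast
      from \<delta>(2) obtain g :: "nat \<Rightarrow> nat" where g: "strict_mono g" "\<And>j. \<exists>s. \<bar>f (g j) s\<bar> \<ge> \<delta>"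
        by (rule subseq_choice[where P="\<lambda>_ n. \<exists>s. \<bar>f n s\<bar> \<ge> \<delta>"]) (rule that)
      then obtain s where s: "\<And>j. \<bar>f (g j) (s j)\<bar> \<ge> \<delta>" by metis
      show ?thesis
        using equivalent_large_coordinates[OF f g(1) hu(2) s \<delta>(1)] EQ[OF g(1)] X by blast
    next
      case False
      have False
      proof (rule no_subsymmetric_flat_blocks[OF f C(1) DfC c2 Dfc])
        show "cauchy_series f a" if "strict_mono g" "cauchy_series (f \<circ> g) a" for g a
          using EQ[OF that(1)] EQ1 that(2) by simp
        show "\<exists>L. \<forall>j\<ge>L. \<forall>s. \<bar>f j s\<bar> < \<delta>" if "\<delta> > 0" for \<delta> using False that by (meson not_less)
      qed
      then show ?thesis ..
    qed
  next
    assume E: "cauchy_series estar a"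
    have "cauchy_series f a"
      by (rule cauchy_series_dominated[OF E C(1)], rule D_domination[OF hu(2) f]) (use DfC C in auto)
    then show "cauchy_series x a" using EQ1 by simp
  qed
qed

end

context tirilman_small
begin

lemma subsymmetric_equivalent_estar:
  assumes basic: "basic p \<gamma> x" and sub: "subsymmetric p \<gamma> x"
  shows "equivalent p \<gamma> x estar"
proof -
  have xTD: "x j \<in> TD" for j using basic by (simp add: basic_def)
  interpret subsymmetric_basis p \<gamma> x
  proof
    show "x j \<in> TD" for j by (rule xTD)
    show "x j \<noteq> (\<lambda>i. 0)" for j by (rule basic_nonzero[OF basic])
    show "unconditional p \<gamma> x" using sub by (simp add: subsymmetric_def)
    fix f :: "nat \<Rightarrow> nat" and a assume f: "strict_mono f"
    have "series_conv p \<gamma> x a \<longleftrightarrow> series_conv p \<gamma> (x \<circ> f) a"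
      using sub f by (simp add: subsymmetric_def equivalent_def)
    moreover have "series_conv p \<gamma> (x \<circ> f) a \<longleftrightarrow> cauchy_series (x \<circ> f) a" by (rule series_conv_iff) (simp add: xTD)
    ultimately show "cauchy_series (x \<circ> f) a \<longleftrightarrow> cauchy_series x a" using series_conv_iff[OF xTD] by simp
  qed
  show ?thesis unfolding equivalent_def series_conv_iff[OF xTD] series_conv_iff[OF D_estar(1)]
    using equivalent_estar by blast
qed

end

theorem theorem10:
  fixes p :: real
  assumes "1 < p"
  shows "\<exists>\<gamma>0 > 0. \<forall>\<gamma>. 0 < \<gamma> \<and> \<gamma> < 1 \<and> \<gamma> < \<gamma>0 \<longrightarrow>
           subsymmetric p \<gamma> estar \<and> \<not> symmetric_seq p \<gamma> estar \<and>
           (\<forall>x. basic p \<gamma> x \<and> subsymmetric p \<gamma> x \<longrightarrow> equivalent p \<gamma> x estar)"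
proof (intro exI[of _ "1/3"] conjI allI impI)
  fix \<gamma> :: real assume \<gamma>: "0 < \<gamma> \<and> \<gamma> < 1 \<and> \<gamma> < 1/3"
  interpret tirilman_small p \<gamma> using assms \<gamma> by unfold_locales auto
  show "subsymmetric p \<gamma> estar" by (rule subsymmetric_estar)
  show "\<not> symmetric_seq p \<gamma> estar" by (rule not_symmetric_estar)
  show "equivalent p \<gamma> x estar" if "basic p \<gamma> x \<and> subsymmetric p \<gamma> x" for x
    using subsymmetric_equivalent_estar that by blast
qed simp

end
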